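(* Let $\mathcal M\subseteq\mathcal B(H)$ be a type $I$ factor and let $\alpha$ and $\beta$ be $E_0$-semigroups acting, respectively, on $\mathcal M$ and $\mathcal M'$. The following are equivalent. (i) There is a one-parameter automorphism group $\gamma=\{\gamma_t:t\in\mathbb R\}$ acting on $\mathcal B(H)$ that satisfies $$\gamma_t\restriction_{\mathcal M}=\alpha_t\ \text{ and }\ \gamma_{-t}\restriction_{\mathcal M'}=\beta_t,\qquad t\ge0.$$ (ii) The product systems $\mathcal E_\alpha$ and $\mathcal E_\beta$ are anti-isomorphic. More explicitly, if $U=\{U_t:t\in\mathbb R\}$ is a strongly continuous one-parameter unitary group on $H$ whose automorphism group $\gamma_t(A)=U_tAU_t^*$ implements $\alpha$ and $\beta$ as in (i), then for every $t>0$ we have $U_t^*\mathcal E_\alpha(t)=\mathcal E_\beta(t)$, and the map $\theta:\mathcal E_\alpha\to\mathcal E_\beta$ defined by $$\theta((t,T))=(t,U_t^*T),\qquad t>0,\ T\in\mathcal E_\alpha(t),\qquad( * )$$ is an anti-isomorphism of product systems. Conversely, every anti-isomorphism $\theta:\mathcal E_\alpha\to\mathcal E_\beta$ has the form $( * )$ for a unique family $\{U_t:t>0\}$ of unitary operators. This family is a strongly continuous semigroup tending strongly to $\mathbf 1$ as $t\to0+$, and its extension to a one-parameter unitary group in $\mathcal B(H)$ gives rise to an automorphism group $\gamma$ satisfying (i) by way of $\gamma_t(A)=U_tAU_t^*$.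
   Context: $H$ is a separable Hilbert space and $\mathcal M'$ is the commutant of $\mathcal M$. An $E_0$-semigroup on a type $I_\infty$ factor $\mathcal M$ is a semigroup $\alpha=\{\alpha_t:t\ge0\}$ ($\alpha_0=\mathrm{id}$) of unit-preserving normal $*$-endomorphisms of $\mathcal M$ such that $t\mapsto\rho(\alpha_t(x))$ is continuous for every normal functional $\rho$ and $x\in\mathcal M$. One-parameter automorphism groups of $\mathcal B(H)$ are groups of $*$-automorphisms that are continuous in the sense that $t\mapsto\langle\gamma_t(A)\xi,\eta\rangle$ is continuous for all $A\in\mathcal B(H)$, $\xi,\eta\in H$. The product system of $\alpha$ is $\mathcal E_\alpha=\{(t,T):t>0,\ T\in\mathcal E_\alpha(t)\}$, where $\mathcal E_\alpha(t)=\{T\in\mathcal M:\alpha_t(A)T=TA\ \text{for all }A\in\mathcal M\}$ is a Hilbert space with inner product given by $T^*S=\langle S,T\rangle\mathbf 1$; multiplication is $(s,S)(t,T)=(s+t,ST)$, and the Borel structure is inherited from $(0,\infty)\times\mathcal B(H)$, $\mathcal B(H)$ having the $\sigma$-algebra generated by the weak operator topology. $\mathcal E_\beta$ is defined in the same way with $\mathcal M'$ in place of $\mathcal M$. An anti-isomorphism $\theta:\mathcal E_\alpha\to\mathcal E_\beta$ is a Borel isomorphism that restricts to a unitary operator $\mathcal E_\alpha(t)\to\mathcal E_\beta(t)$ for each $t>0$ and satisfies $\theta(xy)=\theta(y)\theta(x)$. *)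

theory Defs
  imports "HOL-Analysis.Analysis"
begin

text \<open>
  The complex inner product is linear in the first variable. Its real part is the inner product
  of \<^class>\<open>real_inner\<close>, so norm and topology are the inherited ones.
\<close>

class complex_hilbert = real_inner + banach +
  fixes scaleC :: "complex \<Rightarrow> 'a \<Rightarrow> 'a" (infixr \<open>*\<^sub>C\<close> 75)
    and cinner :: "'a \<Rightarrow> 'a \<Rightarrow> complex"
  assumes scaleC_add_right: "c *\<^sub>C (x + y) = c *\<^sub>C x + c *\<^sub>C y"
    and scaleC_add_left: "(c + d) *\<^sub>C x = c *\<^sub>C x + d *\<^sub>C x"
    and scaleC_scaleC: "c *\<^sub>C (d *\<^sub>C x) = (c * d) *\<^sub>C x"
    and scaleC_of_real: "complex_of_real r *\<^sub>C x = r *\<^sub>R x"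
    and cinner_commute: "cinner x y = cnj (cinner y x)"
    and cinner_add_left: "cinner (x + y) z = cinner x z + cinner y z"
    and cinner_scaleC_left: "cinner (c *\<^sub>C x) y = c * cinner x y"
    and inner_eq_Re_cinner: "inner x y = Re (cinner x y)"

lemma cinner_self: "cinner x x = complex_of_real ((norm x)\<^sup>2)"
proof -
  have "Im (cinner x x) = 0"
    using arg_cong[OF cinner_commute[of x x], of Im] by simp
  then show ?thesis
    by (simp add: complex_eq_iff power2_norm_eq_inner inner_eq_Re_cinner)
qed

lemma norm_scaleC: "norm (c *\<^sub>C x) = cmod c * norm x"
proof -
  have "cinner (c *\<^sub>C x) (c *\<^sub>C x) = c * cnj c * cinner x x"
    by (metis cinner_commute cinner_scaleC_left complex_cnj_mult mult.assoc)
  then have "complex_of_real ((norm (c *\<^sub>C x))\<^sup>2) = complex_of_real ((cmod c * norm x)\<^sup>2)"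
    by (simp add: cinner_self complex_norm_square[symmetric] power_mult_distrib)
  then have "(norm (c *\<^sub>C x))\<^sup>2 = (cmod c * norm x)\<^sup>2"
    by (simp only: of_real_eq_iff)
  then show ?thesis by simp
qed

lemma bounded_linear_scaleC: "bounded_linear (\<lambda>x. c *\<^sub>C x)"
proof (rule bounded_linear_intro)
  show "c *\<^sub>C (r *\<^sub>R x) = r *\<^sub>R (c *\<^sub>C x)" for r and x :: 'a
    by (simp add: scaleC_of_real[symmetric] scaleC_scaleC mult.commute)
  show "norm (c *\<^sub>C x) \<le> norm x * cmod c" for x :: 'a
    by (simp add: norm_scaleC mult.commute)
qed (rule scaleC_add_right)

text \<open>
  Elements of \<^typ>\<open>'h \<Rightarrow>\<^sub>L 'h\<close> are only real-linear; \<open>BH\<close> is the subset of complex-linear ones.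
\<close>

type_synonym 'h op = "'h \<Rightarrow>\<^sub>L 'h"

definition BH :: "'h::complex_hilbert op set" where
  "BH = {T :: 'h op. \<forall>c x. T (c *\<^sub>C x) = c *\<^sub>C T x}"

lift_definition scale_op :: "complex \<Rightarrow> 'h::complex_hilbert op \<Rightarrow> 'h op"
  is "\<lambda>c T x. c *\<^sub>C T x"
  by (rule bounded_linear_compose[OF bounded_linear_scaleC])

definition adj :: "'h::complex_hilbert op \<Rightarrow> 'h op" where
  "adj T = (THE S :: 'h op. \<forall>x y. cinner (T x) y = cinner x (S y))"

definition unitary :: "'h::complex_hilbert op \<Rightarrow> bool" where
  "unitary U \<longleftrightarrow> U \<in> BH \<and> adj U o\<^sub>L U = id_blinfun \<and> U o\<^sub>L adj U = id_blinfun"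

definition conj_by :: "'h::complex_hilbert op \<Rightarrow> 'h op \<Rightarrow> 'h op" where
  "conj_by U A = U o\<^sub>L A o\<^sub>L adj U"

definition projection :: "'h::complex_hilbert op \<Rightarrow> bool" where
  "projection p \<longleftrightarrow> p \<in> BH \<and> adj p = p \<and> p o\<^sub>L p = p"

definition weak_op_top :: "'h::complex_hilbert op topology" where
  "weak_op_top = topology_generated_by
     {{T :: 'h op. T \<in> BH \<and> cinner (T x) y \<in> V} | x y V. open V}"

definition ultraweak_top :: "'h::complex_hilbert op topology" where
  "ultraweak_top = topology_generated_by
     {{T :: 'h op. T \<in> BH \<and> (\<Sum>n. cinner (T (\<xi> n)) (\<eta> n)) \<in> V} | \<xi> \<eta> V.
        summable (\<lambda>n::nat. (norm (\<xi> n))\<^sup>2) \<and> summable (\<lambda>n. (norm (\<eta> n))\<^sup>2) \<and> open V}"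

definition op_borel :: "'h::complex_hilbert op measure" where
  "op_borel = sigma BH {V. openin weak_op_top V}"

definition commutant :: "'h::complex_hilbert op set \<Rightarrow> 'h op set" where
  "commutant M = {T \<in> BH. \<forall>A\<in>M. T o\<^sub>L A = A o\<^sub>L T}"

definition von_neumann_algebra :: "'h::complex_hilbert op set \<Rightarrow> bool" where
  "von_neumann_algebra M \<longleftrightarrow>
     M \<subseteq> BH \<and> adj ` M \<subseteq> M \<and> commutant (commutant M) = M"

definition factor :: "'h::complex_hilbert op set \<Rightarrow> bool" where
  "factor M \<longleftrightarrow> von_neumann_algebra M \<and>
     M \<inter> commutant M = range (\<lambda>c. scale_op c id_blinfun)"

text \<open>For projections, \<open>p o\<^sub>L q = q\<close> says \<open>q \<le> p\<close>.\<close>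

definition minimal_projection :: "'h::complex_hilbert op set \<Rightarrow> 'h op \<Rightarrow> bool" where
  "minimal_projection M p \<longleftrightarrow> p \<in> M \<and> projection p \<and> p \<noteq> 0 \<and>
     (\<forall>q\<in>M. projection q \<and> p o\<^sub>L q = q \<longrightarrow> q = 0 \<or> q = p)"

definition type_I_factor :: "'h::complex_hilbert op set \<Rightarrow> bool" where
  "type_I_factor M \<longleftrightarrow> factor M \<and> (\<exists>p. minimal_projection M p)"

definition clinear_on ::
  "'h::complex_hilbert op set \<Rightarrow> ('h op \<Rightarrow> 'h op) \<Rightarrow> bool" where
  "clinear_on M f \<longleftrightarrow> (\<forall>A\<in>M. \<forall>B\<in>M. f (A + B) = f A + f B) \<and>
     (\<forall>c. \<forall>A\<in>M. f (scale_op c A) = scale_op c (f A))"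

definition star_endo :: "'h::complex_hilbert op set \<Rightarrow> ('h op \<Rightarrow> 'h op) \<Rightarrow> bool" where
  "star_endo M f \<longleftrightarrow> f ` M \<subseteq> M \<and> clinear_on M f \<and>
     (\<forall>A\<in>M. \<forall>B\<in>M. f (A o\<^sub>L B) = f A o\<^sub>L f B) \<and> (\<forall>A\<in>M. f (adj A) = adj (f A))"

definition normal_map :: "'h::complex_hilbert op set \<Rightarrow> ('h op \<Rightarrow> 'h op) \<Rightarrow> bool" where
  "normal_map M f \<longleftrightarrow>
     continuous_map (subtopology ultraweak_top M) (subtopology ultraweak_top M) f"

definition normal_functional ::
  "'h::complex_hilbert op set \<Rightarrow> ('h op \<Rightarrow> complex) \<Rightarrow> bool" where
  "normal_functional M \<rho> \<longleftrightarrow>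
     (\<forall>A\<in>M. \<forall>B\<in>M. \<rho> (A + B) = \<rho> A + \<rho> B) \<and>
     (\<forall>c. \<forall>A\<in>M. \<rho> (scale_op c A) = c * \<rho> A) \<and>
     continuous_map (subtopology ultraweak_top M) euclidean \<rho>"

text \<open>Only the values \<open>\<alpha> t A\<close> with \<open>t \<ge> 0\<close> and \<open>A \<in> M\<close> are meaningful.\<close>

definition E0_semigroup ::
  "'h::complex_hilbert op set \<Rightarrow> (real \<Rightarrow> 'h op \<Rightarrow> 'h op) \<Rightarrow> bool" where
  "E0_semigroup M \<alpha> \<longleftrightarrow>
     (\<forall>t\<ge>0. star_endo M (\<alpha> t) \<and> normal_map M (\<alpha> t) \<and> \<alpha> t id_blinfun = id_blinfun) \<and>
     (\<forall>A\<in>M. \<alpha> 0 A = A) \<and>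
     (\<forall>s\<ge>0. \<forall>t\<ge>0. \<forall>A\<in>M. \<alpha> (s + t) A = \<alpha> s (\<alpha> t A)) \<and>
     (\<forall>\<rho>. normal_functional M \<rho> \<longrightarrow> (\<forall>A\<in>M. continuous_on {0..} (\<lambda>t. \<rho> (\<alpha> t A))))"

definition automorphism_group :: "(real \<Rightarrow> 'h::complex_hilbert op \<Rightarrow> 'h op) \<Rightarrow> bool" where
  "automorphism_group \<gamma> \<longleftrightarrow>
     (\<forall>t. star_endo BH (\<gamma> t) \<and> bij_betw (\<gamma> t) BH BH) \<and>
     (\<forall>A\<in>BH. \<gamma> 0 A = A) \<and>
     (\<forall>s t. \<forall>A\<in>BH. \<gamma> (s + t) A = \<gamma> s (\<gamma> t A)) \<and>
     (\<forall>A\<in>BH. \<forall>x y. continuous_on UNIV (\<lambda>t. cinner (\<gamma> t A x) y))"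

definition implements ::
  "'h::complex_hilbert op set \<Rightarrow> (real \<Rightarrow> 'h op \<Rightarrow> 'h op) \<Rightarrow> (real \<Rightarrow> 'h op \<Rightarrow> 'h op) \<Rightarrow>
   (real \<Rightarrow> 'h op \<Rightarrow> 'h op) \<Rightarrow> bool" where
  "implements M \<alpha> \<beta> \<gamma> \<longleftrightarrow>
     (\<forall>t\<ge>0. (\<forall>A\<in>M. \<gamma> t A = \<alpha> t A) \<and> (\<forall>B\<in>commutant M. \<gamma> (- t) B = \<beta> t B))"

definition unitary_group :: "(real \<Rightarrow> 'h::complex_hilbert op) \<Rightarrow> bool" where
  "unitary_group U \<longleftrightarrow> (\<forall>t. unitary (U t)) \<and> U 0 = id_blinfun \<and>
     (\<forall>s t. U (s + t) = U s o\<^sub>L U t) \<and> (\<forall>x. continuous_on UNIV (\<lambda>t. U t x))"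

definition fibre ::
  "'h::complex_hilbert op set \<Rightarrow> (real \<Rightarrow> 'h op \<Rightarrow> 'h op) \<Rightarrow> real \<Rightarrow> 'h op set" where
  "fibre M \<alpha> t = {T \<in> M. \<forall>A\<in>M. \<alpha> t A o\<^sub>L T = T o\<^sub>L A}"

text \<open>The inner product is determined by \<open>T\<^sup>* S = \<langle>S, T\<rangle> 1\<close>.\<close>

definition fibre_inner :: "'h::complex_hilbert op \<Rightarrow> 'h op \<Rightarrow> complex" where
  "fibre_inner S T = (THE c. adj T o\<^sub>L S = scale_op c id_blinfun)"

definition product_system ::
  "'h::complex_hilbert op set \<Rightarrow> (real \<Rightarrow> 'h op \<Rightarrow> 'h op) \<Rightarrow> (real \<times> 'h op) set" where
  "product_system M \<alpha> = Sigma {0<..} (fibre M \<alpha>)"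

definition ps_mult ::
  "real \<times> 'h::complex_hilbert op \<Rightarrow> real \<times> 'h op \<Rightarrow> real \<times> 'h op" where
  "ps_mult x y = (fst x + fst y, snd x o\<^sub>L snd y)"

definition ps_borel ::
  "'h::complex_hilbert op set \<Rightarrow> (real \<Rightarrow> 'h op \<Rightarrow> 'h op) \<Rightarrow> (real \<times> 'h op) measure" where
  "ps_borel M \<alpha> = restrict_space (borel \<Otimes>\<^sub>M op_borel) (product_system M \<alpha>)"

definition borel_isomorphism :: "'a measure \<Rightarrow> 'b measure \<Rightarrow> ('a \<Rightarrow> 'b) \<Rightarrow> bool" where
  "borel_isomorphism X Y f \<longleftrightarrow> bij_betw f (space X) (space Y) \<and>
     f \<in> measurable X Y \<and> the_inv_into (space X) f \<in> measurable Y X"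

definition fibre_unitary ::
  "'h::complex_hilbert op set \<Rightarrow> 'h op set \<Rightarrow> ('h op \<Rightarrow> 'h op) \<Rightarrow> bool" where
  "fibre_unitary E F f \<longleftrightarrow> bij_betw f E F \<and> clinear_on E f \<and>
     (\<forall>S\<in>E. \<forall>T\<in>E. fibre_inner (f S) (f T) = fibre_inner S T)"

definition anti_isomorphism ::
  "'h::complex_hilbert op set \<Rightarrow> (real \<Rightarrow> 'h op \<Rightarrow> 'h op) \<Rightarrow>
   'h op set \<Rightarrow> (real \<Rightarrow> 'h op \<Rightarrow> 'h op) \<Rightarrow> (real \<times> 'h op \<Rightarrow> real \<times> 'h op) \<Rightarrow> bool" where
  "anti_isomorphism M \<alpha> N \<beta> \<theta> \<longleftrightarrow>
     borel_isomorphism (ps_borel M \<alpha>) (ps_borel N \<beta>) \<theta> \<and>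
     (\<forall>t>0. \<exists>f. fibre_unitary (fibre M \<alpha> t) (fibre N \<beta> t) f \<and>
        (\<forall>T\<in>fibre M \<alpha> t. \<theta> (t, T) = (t, f T))) \<and>
     (\<forall>x\<in>product_system M \<alpha>. \<forall>y\<in>product_system M \<alpha>.
        \<theta> (ps_mult x y) = ps_mult (\<theta> y) (\<theta> x))"

definition has_form ::
  "'h::complex_hilbert op set \<Rightarrow> (real \<Rightarrow> 'h op \<Rightarrow> 'h op) \<Rightarrow>
   (real \<times> 'h op \<Rightarrow> real \<times> 'h op) \<Rightarrow> (real \<Rightarrow> 'h op) \<Rightarrow> bool" where
  "has_form M \<alpha> \<theta> U \<longleftrightarrow>
     (\<forall>t>0. \<forall>T\<in>fibre M \<alpha> t. \<theta> (t, T) = (t, adj (U t) o\<^sub>L T))"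

end

theory Submission
  imports Defs
begin

text \<open>
  If \<open>U\<close> implements \<open>\<alpha>\<close> and \<open>\<beta>\<close>, then \<open>T\<close> intertwines \<open>\<alpha>\<^sub>t\<close> with the identity on \<open>M\<close> exactly when
  \<open>U\<^sub>t\<^sup>* T\<close> intertwines \<open>\<beta>\<^sub>t\<close> with the identity on the commutant; anti-multiplicativity of
  \<open>T \<mapsto> U\<^sub>t\<^sup>* T\<close> holds because \<open>M\<close> and its commutant commute. Conversely, since \<open>\<alpha>\<^sub>t\<close> is normal and
  \<open>M\<close> is of type I, the ranges of the operators in the fibre over \<open>t\<close> are total in \<open>H\<close>, and likewise
  for \<open>\<beta>\<close>. Hence \<open>U\<^sub>t\<^sup>* T = \<theta>\<^sub>t(T)\<close> defines a unitary. It is weakly measurable in \<open>t\<close>, because the fibres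
  have a total family of weakly continuous sections, and a weakly measurable unitary semigroup on a
  separable space is strongly continuous. That every automorphism group of \<open>B(H)\<close> comes from a
  unitary group amounts to the triviality of the multipliers of the real line.
\<close>

subsection \<open>Complex Hilbert spaces\<close>

text \<open>Since \<theta> is only Borel, measurability of \<open>U\<close> has to be extracted from
  sections of the fibres explicit enough to be fed into \<theta>. They come from an atom
  \<open>e\<close>, a projection with \<open>e M e\<close> scalar: for \<open>B\<close> in
  \<open>M\<close> the rule sending \<open>A (e x)\<close> to
  \<open>\<alpha> t (A o\<^sub>L e) (B (e x))\<close> multiplies Gram matrices by a constant, so it
  extends to an element of the fibre. Finite sums of \<open>v o\<^sub>L adj v\<close> with
  \<open>v o\<^sub>L e = v\<close> approximate 1, and normality carries this through
  \<open>\<alpha> t\<close>; so \<open>adj (U t)\<close> is controlled by its values on the ranges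
  of the \<open>\<alpha> t v\<close>, where the sections describe it. A minimal projection is shown
  to be an atom without spectral theory: the square root of \<open>A o\<^sub>L A\<close> serves as
  absolute value and separates the positive part of \<open>A\<close>. For the multiplier,
  periodicity in the second variable requires the operator \<open>D\<close> of one period to commute
  with every \<open>V s\<close>; this is checked at rational multiples of the period, where both are
  powers of one operator up to scalars. Closeness to 1 gives the multiplier a single-valued
  logarithm small enough to satisfy the cocycle identity exactly.\<close>

lemma cinner_add_right: "cinner x (y + z) = cinner x y + cinner x z"
  by (metis cinner_add_left cinner_commute complex_cnj_add)

lemma cinner_scaleC_right: "cinner x (c *\<^sub>C y) = cnj c * cinner x y"
  by (metis cinner_scaleC_left cinner_commute complex_cnj_mult)

lemma scaleC_one [simp]: "1 *\<^sub>C x = x"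
  using scaleC_of_real[of 1 x] by simp

lemma scaleR_eq_scaleC: "r *\<^sub>R x = complex_of_real r *\<^sub>C x"
  by (simp add: scaleC_of_real)

lemma Re_cinner_le: "Re (cinner x y) \<le> norm x * norm y"
  using norm_cauchy_schwarz[of x y] by (simp add: inner_eq_Re_cinner)

lemma norm_cinner_le: "cmod (cinner x y) \<le> norm x * norm y"
proof (cases "cinner x y = 0")
  case False
  \<comment> \<open>Rotating \<open>x\<close> by this phase makes the inner product real and
    nonnegative, so the real Cauchy-Schwarz inequality applies.\<close>
  define u where "u = cnj (sgn (cinner x y))"
  have u: "cmod u = 1" using False by (simp add: u_def norm_sgn)
  have "u * cinner x y = cmod (cinner x y)"
    using False by (simp add: u_def sgn_eq complex_norm_square[symmetric] field_simps power2_eq_square)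
  then have "cmod (cinner x y) = Re (cinner (u *\<^sub>C x) y)"
    by (simp add: cinner_scaleC_left)
  also have "\<dots> \<le> norm (u *\<^sub>C x) * norm y" by (rule Re_cinner_le)
  finally show ?thesis by (simp add: norm_scaleC u)
qed auto

interpretation cinner: bounded_bilinear "cinner :: 'h::complex_hilbert \<Rightarrow> 'h \<Rightarrow> complex"
proof
  fix a a' b b' :: 'h and r :: real
  show "cinner (a + a') b = cinner a b + cinner a' b" by (rule cinner_add_left)
  show "cinner a (b + b') = cinner a b + cinner a b'" by (rule cinner_add_right)
  show "cinner (r *\<^sub>R a) b = r *\<^sub>R cinner a b"
    by (simp add: scaleR_eq_scaleC cinner_scaleC_left scaleR_conv_of_real)
  show "cinner a (r *\<^sub>R b) = r *\<^sub>R cinner a b"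
    by (simp add: scaleR_eq_scaleC cinner_scaleC_right scaleR_conv_of_real)
  show "\<exists>K. \<forall>a b::'h. norm (cinner a b) \<le> norm a * norm b * K"
    by (rule exI[of _ 1]) (simp add: norm_cinner_le)
qed

interpretation scaleC: bounded_bilinear "scaleC :: complex \<Rightarrow> 'h::complex_hilbert \<Rightarrow> 'h"
proof
  fix a a' :: complex and b b' :: 'h and r :: real
  show "(a + a') *\<^sub>C b = a *\<^sub>C b + a' *\<^sub>C b" by (rule scaleC_add_left)
  show "a *\<^sub>C (b + b') = a *\<^sub>C b + a *\<^sub>C b'" by (rule scaleC_add_right)
  show "(r *\<^sub>R a) *\<^sub>C b = r *\<^sub>R a *\<^sub>C b"
    by (simp add: scaleR_eq_scaleC scaleC_scaleC scaleR_conv_of_real)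
  show "a *\<^sub>C (r *\<^sub>R b) = r *\<^sub>R a *\<^sub>C b"
    by (simp add: scaleR_eq_scaleC scaleC_scaleC mult.commute)
  show "\<exists>K. \<forall>a (b::'h). norm (a *\<^sub>C b) \<le> norm a * norm b * K"
    by (rule exI[of _ 1]) (simp add: norm_scaleC)
qed

declare cinner.zero_left [simp] cinner.zero_right [simp] scaleC.zero_left [simp] scaleC.zero_right [simp]

lemmas cinner_simps = cinner.add_left cinner.add_right cinner.diff_left cinner.diff_right
  cinner.minus_left cinner.minus_right cinner_scaleC_left cinner_scaleC_right

lemma cinner_self_eq_0 [simp]: "cinner x x = 0 \<longleftrightarrow> x = 0"
  by (simp add: cinner_self)

lemma cinner_ext: "(\<And>y. cinner x y = cinner x' y) \<Longrightarrow> x = x'"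
  by (metis cinner.diff_left cinner_self_eq_0 eq_iff_diff_eq_0)

lemma cinner_ext_right: "(\<And>y. cinner y x = cinner y x') \<Longrightarrow> x = x'"
  by (metis cinner_commute cinner_ext)

lemma norm_eq_of_cinner: "cinner x x = cinner y y \<Longrightarrow> norm x = norm y"
  by (simp add: cinner_self of_real_eq_iff flip: of_real_power)

lemma norm_le_of_cinner:
  assumes "0 \<le> c" "\<And>y. cmod (cinner x y) \<le> c * norm y"
  shows "norm x \<le> c"
proof -
  have "norm x * norm x \<le> c * norm x"
    using assms(2)[of x] by (simp add: cinner_self norm_mult power2_eq_square)
  then show ?thesis using assms(1) by (cases "x = 0") auto
qed

subsection \<open>Orthogonal projection\<close>

definition csubspace :: "'h::complex_hilbert set \<Rightarrow> bool" where
  "csubspace K \<longleftrightarrow> 0 \<in> K \<and> (\<forall>x\<in>K. \<forall>y\<in>K. x + y \<in> K) \<and> (\<forall>c. \<forall>x\<in>K. c *\<^sub>C x \<in> K)"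

lemma csubspace_diff: "csubspace K \<Longrightarrow> x \<in> K \<Longrightarrow> y \<in> K \<Longrightarrow> x - y \<in> K"
proof -
  assume K: "csubspace K" "x \<in> K" "y \<in> K"
  then have "x + (-1) *\<^sub>C y \<in> K" by (simp add: csubspace_def)
  then show ?thesis by (simp add: scaleC.minus_left)
qed

text \<open>The parallelogram law makes a minimizing sequence Cauchy: midpoints stay in
  \<open>K\<close>, so they are no closer to \<open>x\<close> than the infimum
  \<open>d\<close>.\<close>

lemma nearest_point_exists:
  fixes K :: "'h::{real_inner,banach} set"
  assumes cl: "closed K" and ne: "K \<noteq> {}"
    and mid: "\<And>x y. x \<in> K \<Longrightarrow> y \<in> K \<Longrightarrow> (1/2) *\<^sub>R (x + y) \<in> K"
  obtains k where "k \<in> K" "\<And>y. y \<in> K \<Longrightarrow> norm (x - k) \<le> norm (x - y)"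
proof -
  define d where "d = infdist x K"
  have d_le: "d \<le> norm (x - y)" if "y \<in> K" for y
    using that by (simp add: d_def infdist_le dist_norm[symmetric])
  have d0: "0 \<le> d" by (simp add: d_def infdist_nonneg)
  have "\<exists>y\<in>K. norm (x - y) < d + 1 / Suc n" for n
  proof -
    have "(INF a\<in>K. dist x a) < d + 1 / Suc n" using ne by (simp add: d_def infdist_def)
    then show ?thesis using ne by (subst (asm) cINF_less_iff) (auto simp: dist_norm intro: bdd_belowI2[where m=0])
  qed
  then obtain y where y: "\<And>n. y n \<in> K" "\<And>n. norm (x - y n) < d + 1 / Suc n"
    by metis
  have par: "(norm (y m - y n))\<^sup>2 \<le> 2 * (norm (x - y m))\<^sup>2 + 2 * (norm (x - y n))\<^sup>2 - 4 * d\<^sup>2" for m n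
  proof -
    have "d \<le> norm (x - (1/2) *\<^sub>R (y m + y n))" by (intro d_le mid y)
    then have "d\<^sup>2 \<le> (norm (x - (1/2) *\<^sub>R (y m + y n)))\<^sup>2" using d0 by (rule power_mono)
    moreover have "4 * (norm (x - (1/2) *\<^sub>R (y m + y n)))\<^sup>2 + (norm (y m - y n))\<^sup>2 =
        2 * (norm (x - y m))\<^sup>2 + 2 * (norm (x - y n))\<^sup>2"
      by (simp add: power2_norm_eq_inner algebra_simps inner_commute)
    ultimately show ?thesis by simp
  qed
  have lim: "(\<lambda>n. (d + 1 / Suc n)\<^sup>2) \<longlonglongrightarrow> (d + 0)\<^sup>2"
    by (intro tendsto_intros LIMSEQ_Suc[OF lim_1_over_n])
  have "Cauchy y"
  proof (rule metric_CauchyI)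
    fix e :: real assume e: "0 < e"
    have "\<forall>\<^sub>F n in sequentially. (d + 1 / Suc n)\<^sup>2 < d\<^sup>2 + e\<^sup>2 / 4"
      using order_tendstoD(2)[OF lim, of "d\<^sup>2 + e\<^sup>2 / 4"] e by simp
    then obtain N where N: "\<And>n. n \<ge> N \<Longrightarrow> (d + 1 / Suc n)\<^sup>2 < d\<^sup>2 + e\<^sup>2 / 4"
      by (auto simp: eventually_sequentially)
    have b: "(norm (x - y n))\<^sup>2 < d\<^sup>2 + e\<^sup>2 / 4" if "n \<ge> N" for n
      using N[OF that] power_mono[OF less_imp_le[OF y(2)[of n]], of 2] by simp
    have "dist (y m) (y n) < e" if "m \<ge> N" "n \<ge> N" for m n
    proof -
      have "(norm (y m - y n))\<^sup>2 < e\<^sup>2" using par[of m n] b[OF that(1)] b[OF that(2)] by simp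
      then show ?thesis using e by (simp add: dist_norm power_less_imp_less_base)
    qed
    then show "\<exists>N. \<forall>m\<ge>N. \<forall>n\<ge>N. dist (y m) (y n) < e" by blast
  qed
  then obtain k where k: "y \<longlonglongrightarrow> k" using Cauchy_convergent convergent_def by blast
  have kK: "k \<in> K" using closed_sequentially[OF cl] y(1) k by blast
  have "(\<lambda>n. norm (x - y n)) \<longlonglongrightarrow> norm (x - k)" by (intro tendsto_intros k)
  moreover have "(\<lambda>n. d + 1 / Suc n) \<longlonglongrightarrow> d + 0"
    by (intro tendsto_intros LIMSEQ_Suc[OF lim_1_over_n])
  ultimately have "norm (x - k) \<le> d + 0"
    by (rule LIMSEQ_le) (use y(2) in \<open>auto intro: less_imp_le\<close>)
  then show ?thesis using that[OF kK] d_le by fastforce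
qed

lemma orthogonal_decomposition:
  fixes K :: "'h::complex_hilbert set"
  assumes cl: "closed K" and K: "csubspace K"
  obtains k where "k \<in> K" "\<And>y. y \<in> K \<Longrightarrow> cinner (x - k) y = 0"
proof -
  have R: "r *\<^sub>R z \<in> K" if "z \<in> K" for r z using K that by (simp add: csubspace_def scaleR_eq_scaleC)
  obtain k where k: "k \<in> K" "\<And>y. y \<in> K \<Longrightarrow> norm (x - k) \<le> norm (x - y)"
  proof (rule nearest_point_exists[OF cl])
    show "K \<noteq> {}" using K by (auto simp: csubspace_def)
    show "\<And>u v. u \<in> K \<Longrightarrow> v \<in> K \<Longrightarrow> (1 / 2) *\<^sub>R (u + v) \<in> K"
      using K R by (simp add: csubspace_def)
  qed blast
  have "cinner (x - k) y = 0" if y: "y \<in> K" for y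
  proof (cases "y = 0")
    case False
    define w where "w = x - k"
    \<comment> \<open>The coefficient for which \<open>w - c *\<^sub>C y\<close> is shortest; a
      nonzero \<open>cinner w y\<close> would then produce a point of \<open>K\<close> nearer to
      \<open>x\<close> than \<open>k\<close>.\<close>
    define c where "c = cinner w y / of_real ((norm y)\<^sup>2)"
    have "norm w \<le> norm (x - (k + c *\<^sub>C y))" unfolding w_def
      using K k y by (intro k(2)) (simp add: csubspace_def)
    then have le: "norm w \<le> norm (w - c *\<^sub>C y)" by (simp add: w_def algebra_simps)
    have n: "of_real ((norm y)\<^sup>2) \<noteq> (0::complex)" using False by simp
    have cyw: "cinner y w = cnj (cinner w y)" by (rule cinner_commute)
    have "cinner (w - c *\<^sub>C y) (w - c *\<^sub>C y) =
        cinner w w - cnj c * cinner w y - c * (cinner y w - cnj c * cinner y y)"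
      by (simp add: cinner_simps algebra_simps)
    also have "cinner y w - cnj c * cinner y y = 0"
      using n by (simp add: c_def cinner_self[of y] cyw)
    also have "cnj c * cinner w y = of_real ((cmod (cinner w y))\<^sup>2 / (norm y)\<^sup>2)"
      unfolding c_def by (simp add: complex_norm_square mult.commute del: of_real_power)
    finally have "complex_of_real ((norm (w - c *\<^sub>C y))\<^sup>2) =
        of_real ((norm w)\<^sup>2 - (cmod (cinner w y))\<^sup>2 / (norm y)\<^sup>2)"
      by (simp add: cinner_self)
    then have "(norm (w - c *\<^sub>C y))\<^sup>2 = (norm w)\<^sup>2 - (cmod (cinner w y))\<^sup>2 / (norm y)\<^sup>2"
      by (simp only: of_real_eq_iff)
    moreover have "(norm w)\<^sup>2 \<le> (norm (w - c *\<^sub>C y))\<^sup>2" using le by (simp add: power_mono)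
    ultimately have "(cmod (cinner w y))\<^sup>2 / (norm y)\<^sup>2 \<le> 0" by simp
    then have "cmod (cinner w y) = 0" using False
      by (metis divide_le_0_iff norm_eq_zero power2_less_eq_zero_iff)
    then show ?thesis by (simp add: w_def)
  qed simp
  with k(1) show ?thesis using that by blast
qed

section \<open>Total sets and induction over them\<close>

definition total_set :: "'h::complex_hilbert set \<Rightarrow> bool" where
  "total_set S \<longleftrightarrow> (\<forall>y. (\<forall>a\<in>S. cinner a y = 0) \<longrightarrow> y = 0)"

text \<open>Totality is phrased as a trivial orthogonal complement, the form in which it is
  established for orbits and ranges; this is the bridge to density of the linear span.\<close>

lemma total_subset_closed_csubspace:
  assumes "total_set S" "S \<subseteq> K" "closed K" "csubspace K"
  shows "K = UNIV"
proof -
  have "x \<in> K" for x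
  proof -
    obtain k where k: "k \<in> K" "\<And>y. y \<in> K \<Longrightarrow> cinner (x - k) y = 0"
      using orthogonal_decomposition[OF assms(3,4)] by blast
    have "cinner a (x - k) = 0" if "a \<in> S" for a
      using k(2)[of a] that assms(2) by (subst cinner_commute) auto
    then have "x - k = 0" using assms(1) unfolding total_set_def by blast
    then show ?thesis using k by simp
  qed
  then show ?thesis by auto
qed

text \<open>The vectors with \<open>P\<close> form a closed subspace containing \<open>S\<close>.
  Every density argument below (equality of operators, measurability, strong limits) takes the form
  of this induction.\<close>

lemma total_induct [consumes 1, case_names zero base add scale limit]:
  assumes "total_set S"
    and zero: "P 0"
    and base: "\<And>a. a \<in> S \<Longrightarrow> P a"
    and add: "\<And>x y. P x \<Longrightarrow> P y \<Longrightarrow> P (x + y)"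
    and scale: "\<And>c x. P x \<Longrightarrow> P (c *\<^sub>C x)"
    and limit: "\<And>f x. (\<And>n::nat. P (f n)) \<Longrightarrow> f \<longlonglongrightarrow> x \<Longrightarrow> P x"
  shows "P x"
proof -
  have "{x. P x} = UNIV"
  proof (rule total_subset_closed_csubspace[OF assms(1)])
    show "closed {x. P x}" unfolding closed_sequential_limits using limit by auto
    show "csubspace {x. P x}" using zero add scale by (auto simp: csubspace_def)
  qed (use base in auto)
  then show ?thesis by auto
qed

lemma riesz_representation:
  fixes f :: "'h::complex_hilbert \<Rightarrow> complex"
  assumes add: "\<And>x y. f (x + y) = f x + f y" and sc: "\<And>c x. f (c *\<^sub>C x) = c * f x"
    and bd: "\<And>x. cmod (f x) \<le> norm x * C"
  obtains z where "\<And>x. f x = cinner x z"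
proof (cases "\<forall>x. f x = 0")
  case True
  then show ?thesis using that[of 0] by (simp add: cinner.zero_right)
next
  case False
  have bl: "bounded_linear f"
    by (rule bounded_linear_intro[where K=C])
      (auto simp: add sc bd scaleR_eq_scaleC scaleR_conv_of_real)
  interpret bounded_linear f by (rule bl)
  define K where "K = {x. f x = 0}"
  have cl: "closed K" unfolding K_def
    by (intro closed_Collect_eq continuous_on continuous_on_const continuous_on_id)
  have sub: "csubspace K" by (auto simp: csubspace_def K_def add sc zero)
  from False obtain x0 where x0: "f x0 \<noteq> 0" by blast
  obtain k where k: "k \<in> K" "\<And>y. y \<in> K \<Longrightarrow> cinner (x0 - k) y = 0"
    using orthogonal_decomposition[OF cl sub] by blast
  define w where "w = x0 - k"
  have fw: "f w = f x0" using k by (simp add: w_def diff K_def)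
  then have w0: "w \<noteq> 0" using x0 zero by auto
  \<comment> \<open>The vector \<open>w\<close> is orthogonal to the kernel of \<open>f\<close>, and
    subtracting the multiple \<open>f x / f w\<close> of it moves any \<open>x\<close> into that
    kernel.\<close>
  have "f x = cinner x ((cnj (f w) / cinner w w) *\<^sub>C w)" for x
  proof -
    have "x - (f x / f w) *\<^sub>C w \<in> K" using fw x0 by (simp add: K_def diff sc)
    then have "cinner w (x - (f x / f w) *\<^sub>C w) = 0" using k(2) by (simp add: w_def)
    then have "cinner (x - (f x / f w) *\<^sub>C w) w = 0" by (subst cinner_commute) simp
    then have "cinner x w = (f x / f w) * cinner w w" by (simp add: cinner_simps)
    moreover have "cnj (cinner w w) = cinner w w" by (metis cinner_commute)
    ultimately show ?thesis using w0 fw x0 by (simp add: cinner_simps)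
  qed
  then show ?thesis using that by blast
qed

subsection \<open>Bounded operators and adjoints\<close>

lemma BH_apply: "T \<in> BH \<Longrightarrow> T (c *\<^sub>C x) = c *\<^sub>C T x"
  by (simp add: BH_def)

lemma scale_op_apply [simp]: "scale_op c T x = c *\<^sub>C T x"
  by transfer rule

lemma adjoint_exists:
  assumes T: "T \<in> BH"
  obtains S where "S \<in> BH" "\<And>x y. cinner (T x) y = cinner x (S y)"
proof -
  have "\<exists>z. \<forall>x. cinner (T x) y = cinner x z" for y
  proof -
    have "cmod (cinner (T x) y) \<le> norm x * (norm T * norm y)" for x
    proof -
      have "cmod (cinner (T x) y) \<le> norm (T x) * norm y" by (rule norm_cinner_le)
      also have "\<dots> \<le> (norm T * norm x) * norm y" by (intro mult_right_mono norm_blinfun) auto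
      finally show ?thesis by (simp add: algebra_simps)
    qed
    then obtain z where "\<And>x. cinner (T x) y = cinner x z"
      by (rule riesz_representation[rotated 2])
        (auto simp: blinfun.add_right BH_apply[OF T] cinner_simps)
    then show ?thesis by blast
  qed
  then obtain S where S: "\<And>x y. cinner (T x) y = cinner x (S y)" by metis
  have bd: "norm (S y) \<le> norm T * norm y" for y
  proof (rule norm_le_of_cinner)
    fix x
    have "cmod (cinner (S y) x) = cmod (cinner (T x) y)"
      unfolding S by (subst cinner_commute) simp
    also have "\<dots> \<le> norm (T x) * norm y" by (rule norm_cinner_le)
    also have "\<dots> \<le> (norm T * norm x) * norm y" by (intro mult_right_mono norm_blinfun) auto
    finally show "cmod (cinner (S y) x) \<le> norm T * norm y * norm x" by (simp add: algebra_simps)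
  qed auto
  have add: "S (x + y) = S x + S y" for x y
    by (rule cinner_ext_right) (simp add: cinner_simps flip: S)
  have sc: "S (c *\<^sub>C x) = c *\<^sub>C S x" for c x
    by (rule cinner_ext_right) (simp add: cinner_simps flip: S)
  have "bounded_linear S"
    by (rule bounded_linear_intro[where K="norm T"])
      (use bd in \<open>auto simp: add sc scaleR_eq_scaleC mult.commute\<close>)
  then have "blinfun_apply (Blinfun S) = S" by (rule bounded_linear_Blinfun_apply)
  then show ?thesis using that[of "Blinfun S"] by (simp add: BH_def sc S)
qed

text \<open>\<open>adj\<close> is a definite description, so every adjoint is computed by exhibiting
  an operator that solves the defining identity.\<close>

lemma adj_unique:
  fixes S T :: "'h::complex_hilbert op"
  assumes "\<And>x y. cinner (T x) y = cinner x (S y)"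
  shows "adj T = S"
  unfolding adj_def
proof (rule the_equality)
  fix S' :: "'h op" assume "\<forall>x y. cinner (T x) y = cinner x (S' y)"
  then show "S' = S" by (intro blinfun_eqI cinner_ext_right) (simp flip: assms)
qed (use assms in auto)

lemma
  assumes T: "T \<in> BH"
  shows adj_BH [simp]: "adj T \<in> BH"
    and cinner_adj: "cinner (T x) y = cinner x (adj T y)"
proof -
  obtain S where S: "S \<in> BH" "\<And>x y. cinner (T x) y = cinner x (S y)"
    using adjoint_exists[OF T] by blast
  then show "adj T \<in> BH" "cinner (T x) y = cinner x (adj T y)"
    using adj_unique[of T S] by auto
qed

lemma cinner_adj_left: "T \<in> BH \<Longrightarrow> cinner (adj T x) y = cinner x (T y)"
  by (metis cinner_adj cinner_commute)

lemma adj_adj [simp]: "T \<in> BH \<Longrightarrow> adj (adj T) = T"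
  by (rule adj_unique) (rule cinner_adj_left)

lemma BH_compose [simp]: "S \<in> BH \<Longrightarrow> T \<in> BH \<Longrightarrow> S o\<^sub>L T \<in> BH"
  and BH_id [simp]: "id_blinfun \<in> BH"
  and BH_zero [simp]: "0 \<in> BH"
  and BH_scale [simp]: "T \<in> BH \<Longrightarrow> scale_op c T \<in> BH"
  by (auto simp: BH_def scaleC_scaleC mult.commute)

lemma BH_add [simp]: "S \<in> BH \<Longrightarrow> T \<in> BH \<Longrightarrow> S + T \<in> BH"
  and BH_diff [simp]: "S \<in> BH \<Longrightarrow> T \<in> BH \<Longrightarrow> S - T \<in> BH"
  by (auto simp: BH_def blinfun.add_left blinfun.diff_left scaleC.add_right scaleC.diff_right)

lemma adj_compose: "S \<in> BH \<Longrightarrow> T \<in> BH \<Longrightarrow> adj (S o\<^sub>L T) = adj T o\<^sub>L adj S"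
  by (rule adj_unique) (simp add: cinner_adj)

lemma adj_add: "S \<in> BH \<Longrightarrow> T \<in> BH \<Longrightarrow> adj (S + T) = adj S + adj T"
  by (rule adj_unique) (simp add: cinner_adj cinner_simps blinfun.add_left)

lemma adj_diff: "S \<in> BH \<Longrightarrow> T \<in> BH \<Longrightarrow> adj (S - T) = adj S - adj T"
  by (rule adj_unique) (simp add: cinner_adj cinner_simps blinfun.diff_left)

lemma adj_scale: "T \<in> BH \<Longrightarrow> adj (scale_op c T) = scale_op (cnj c) (adj T)"
  by (rule adj_unique) (simp add: cinner_adj cinner_simps)

lemma adj_id [simp]: "adj id_blinfun = id_blinfun"
  by (rule adj_unique) simp

lemma adj_zero [simp]: "adj 0 = 0"
  by (rule adj_unique) simp

lemma scale_op_compose_left: "scale_op c S o\<^sub>L T = scale_op c (S o\<^sub>L T)"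
  and scale_op_compose_right: "S \<in> BH \<Longrightarrow> S o\<^sub>L scale_op c T = scale_op c (S o\<^sub>L T)"
  by (auto intro!: blinfun_eqI simp: BH_apply)

lemma compose_id [simp]: "T o\<^sub>L id_blinfun = T" "id_blinfun o\<^sub>L T = T"
  by (auto intro!: blinfun_eqI)

lemma compose_add_left: "(S + T) o\<^sub>L R = (S o\<^sub>L R) + (T o\<^sub>L R)"
  and compose_add_right: "R o\<^sub>L (S + T) = (R o\<^sub>L S) + (R o\<^sub>L T)"
  and compose_diff_left: "(S - T) o\<^sub>L R = (S o\<^sub>L R) - (T o\<^sub>L R)"
  and compose_diff_right: "R o\<^sub>L (S - T) = (R o\<^sub>L S) - (R o\<^sub>L T)"
  by (auto intro!: blinfun_eqI simp: blinfun.add_left blinfun.add_right blinfun.diff_left blinfun.diff_right)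

lemma blinfun_apply_cong: "S = T \<Longrightarrow> blinfun_apply S x = T x"
  by simp

lemma isometry_cinner:
  assumes "V \<in> BH" "adj V o\<^sub>L V = id_blinfun"
  shows "cinner (V x) (V y) = cinner x y"
  using blinfun_apply_cong[OF assms(2), of y] by (simp add: cinner_adj[OF assms(1)])

lemma isometry_norm:
  assumes "V \<in> BH" "adj V o\<^sub>L V = id_blinfun"
  shows "norm (V x) = norm x"
  by (rule norm_eq_of_cinner) (simp add: isometry_cinner assms)

lemma unitary_BH [simp]: "unitary U \<Longrightarrow> U \<in> BH"
  and unitary_left: "unitary U \<Longrightarrow> adj U o\<^sub>L U = id_blinfun"
  and unitary_right: "unitary U \<Longrightarrow> U o\<^sub>L adj U = id_blinfun"
  by (auto simp: unitary_def)

lemma unitary_adj_apply [simp]: "unitary U \<Longrightarrow> adj U (U x) = x"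
  and unitary_apply_adj [simp]: "unitary U \<Longrightarrow> U (adj U x) = x"
  using blinfun_apply_cong[OF unitary_left] blinfun_apply_cong[OF unitary_right] by fastforce+

lemma unitary_norm [simp]: "unitary U \<Longrightarrow> norm (U x) = norm x"
  by (simp add: isometry_norm unitary_left)

lemma unitary_cinner [simp]: "unitary U \<Longrightarrow> cinner (U x) (U y) = cinner x y"
  by (simp add: isometry_cinner unitary_left)

lemma unitary_adj [simp]: "unitary U \<Longrightarrow> unitary (adj U)"
  by (simp add: unitary_def)

lemma unitary_id [simp]: "unitary id_blinfun"
  by (simp add: unitary_def)

lemma unitary_compose [simp]: "unitary U \<Longrightarrow> unitary V \<Longrightarrow> unitary (U o\<^sub>L V)"
  unfolding unitary_def[of "U o\<^sub>L V"]
  by (auto simp: adj_compose intro!: blinfun_eqI)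

lemma unitary_scale: "unitary U \<Longrightarrow> cmod c = 1 \<Longrightarrow> unitary (scale_op c U)"
  unfolding unitary_def[of "scale_op c U"]
  by (auto simp: adj_scale BH_apply scaleC_scaleC complex_norm_square[symmetric]
      mult.commute[of "cnj c"] intro!: blinfun_eqI)

text \<open>Polarization: norms determine the real parts of inner products, and replacing
  \<open>x\<close> by \<open>\<i> *\<^sub>C x\<close> recovers the imaginary parts.\<close>

lemma unitaryI:
  assumes "U \<in> BH" "\<And>x. norm (U x) = norm x" "\<And>y. \<exists>x. U x = y"
  shows "unitary U"
proof -
  have pol: "4 * Re (cinner x y) = (norm (x + y))\<^sup>2 - (norm (x - y))\<^sup>2" for x y :: 'a
    using inner_eq_Re_cinner[of x y]
    by (simp add: power2_norm_eq_inner inner_simps inner_commute)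
  have Re: "Re (cinner (U x) (U y)) = Re (cinner x y)" for x y
  proof -
    have "norm (U x + U y) = norm (x + y)" "norm (U x - U y) = norm (x - y)"
      using assms(2)[of "x + y"] assms(2)[of "x - y"]
      by (simp_all add: blinfun.add_right blinfun.diff_right)
    then show ?thesis using pol[of "U x" "U y"] pol[of x y] by simp
  qed
  have "cinner (U x) (U y) = cinner x y" for x y
    using Re[of x y] Re[of "\<i> *\<^sub>C x" y] by (simp add: BH_apply assms(1) cinner_simps complex_eq_iff)
  then have l: "adj U o\<^sub>L U = id_blinfun"
    by (intro blinfun_eqI cinner_ext) (simp add: cinner_adj_left assms(1))
  have "U o\<^sub>L adj U = id_blinfun"
  proof (rule blinfun_eqI)
    fix y obtain x where "U x = y" using assms(3) by blast
    then show "(U o\<^sub>L adj U) y = id_blinfun y" using blinfun_apply_cong[OF l, of x] by auto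
  qed
  with l assms(1) show ?thesis by (simp add: unitary_def)
qed

lemma total_eqI:
  assumes "total_set S" "A \<in> BH" "B \<in> BH" "\<And>x. x \<in> S \<Longrightarrow> A x = B x"
  shows "A = B"
proof (rule blinfun_eqI)
  fix x show "A x = B x" using assms(1)
  proof (induction x rule: total_induct)
    case (limit f x)
    have "(\<lambda>n. A (f n)) \<longlonglongrightarrow> A x" "(\<lambda>n. B (f n)) \<longlonglongrightarrow> B x"
      by (intro tendsto_intros limit)+
    then show ?case by (auto simp: limit(1) intro: LIMSEQ_unique)
  qed (use assms in \<open>auto simp: blinfun.add_right BH_apply\<close>)
qed

subsection \<open>Operators prescribed on a total family\<close>

lemma csubspace_closure:
  assumes K: "csubspace K"
  shows "csubspace (closure K)"
  unfolding csubspace_def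
proof (intro conjI ballI allI)
  show "0 \<in> closure K" using K closure_subset by (auto simp: csubspace_def)
next
  fix x y assume "x \<in> closure K" "y \<in> closure K"
  then obtain f g :: "nat \<Rightarrow> 'a" where fg: "\<And>n. f n \<in> K" "f \<longlonglongrightarrow> x" "\<And>n. g n \<in> K" "g \<longlonglongrightarrow> y"
    unfolding closure_sequential by blast
  have "(\<lambda>n. f n + g n) \<longlonglongrightarrow> x + y" by (intro tendsto_intros fg)
  then show "x + y \<in> closure K" using K fg(1,3) unfolding closure_sequential csubspace_def
    by (intro exI[of _ "\<lambda>n. f n + g n"]) auto
next
  fix c x assume "x \<in> closure K"
  then obtain f where f: "\<And>n. f n \<in> K" "f \<longlonglongrightarrow> x"
    unfolding closure_sequential by blast
  have "(\<lambda>n. c *\<^sub>C f n) \<longlonglongrightarrow> c *\<^sub>C x"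
    by (intro scaleC.tendsto tendsto_const f)
  then show "c *\<^sub>C x \<in> closure K" using K f(1) unfolding closure_sequential csubspace_def
    by (intro exI[of _ "\<lambda>n. c *\<^sub>C f n"]) auto
qed

text \<open>The span of the pairs \<open>(a i, b i)\<close>, kept as a relation because the vectors
  \<open>a i\<close> may be linearly dependent; it becomes the graph of an operator only once Gram
  matrices are compared.\<close>

inductive_set graph_span :: "('i \<Rightarrow> 'h::complex_hilbert) \<Rightarrow> ('i \<Rightarrow> 'h) \<Rightarrow> 'i set \<Rightarrow> ('h \<times> 'h) set"
  for a b I where
  zero: "(0, 0) \<in> graph_span a b I"
| step: "(x, y) \<in> graph_span a b I \<Longrightarrow> i \<in> I \<Longrightarrow> (x + c *\<^sub>C a i, y + c *\<^sub>C b i) \<in> graph_span a b I"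

lemma graph_span_add:
  "(x', y') \<in> graph_span a b I \<Longrightarrow> (x, y) \<in> graph_span a b I \<Longrightarrow> (x + x', y + y') \<in> graph_span a b I"
  by (induction rule: graph_span.induct)
    (auto simp: add.assoc[symmetric] intro: graph_span.step)

lemma graph_span_scale:
  "(x, y) \<in> graph_span a b I \<Longrightarrow> (c *\<^sub>C x, c *\<^sub>C y) \<in> graph_span a b I"
  by (induction rule: graph_span.induct)
    (auto simp: scaleC.add_right scaleC_scaleC intro: graph_span.intros)

lemma graph_span_gen: "i \<in> I \<Longrightarrow> (a i, b i) \<in> graph_span a b I"
  using graph_span.step[OF graph_span.zero, of i I 1 a b] by simp

text \<open>A linear relation that multiplies inner products by \<open>k\<close> is single-valued,
  since its pairs satisfy \<open>norm y = sqrt k * norm x\<close>; its closure has closed dense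
  domain, hence is the graph of an operator. The factor \<open>k\<close> may be 0, which occurs for
  intertwiners that vanish.\<close>

lemma gram_extension:
  fixes a b :: "'i \<Rightarrow> 'h::complex_hilbert"
  assumes tot: "total_set (a ` I)" and k: "0 \<le> k"
    and gram: "\<And>i j. i \<in> I \<Longrightarrow> j \<in> I \<Longrightarrow> cinner (b i) (b j) = of_real k * cinner (a i) (a j)"
  obtains V where "V \<in> BH" "\<And>i. i \<in> I \<Longrightarrow> V (a i) = b i"
    "\<And>x y. cinner (V x) (V y) = of_real k * cinner x y"
proof -
  define G where "G = graph_span a b I"
  have gi: "cinner y (b i) = of_real k * cinner x (a i)" if "(x, y) \<in> graph_span a b I" "i \<in> I" for x y i
    using that
    by (induction rule: graph_span.induct) (auto simp: cinner_simps gram algebra_simps)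
  have gg: "cinner y y' = of_real k * cinner x x'" if "(x', y') \<in> G" "(x, y) \<in> G" for x y x' y'
    using that(1) unfolding G_def
    by (induction rule: graph_span.induct) (simp_all add: cinner_simps gi[OF that(2)[unfolded G_def]] algebra_simps)
  define C where "C = closure G"
  have cc: "cinner y y' = of_real k * cinner x x'" if mem: "(x', y') \<in> C" "(x, y) \<in> C" for x y x' y'
  proof -
    obtain f where f: "\<And>n. f n \<in> G" "f \<longlonglongrightarrow> (x', y')"
      using mem(1) unfolding C_def closure_sequential by blast
    obtain g where g: "\<And>n. g n \<in> G" "g \<longlonglongrightarrow> (x, y)"
      using mem(2) unfolding C_def closure_sequential by blast
    have "(\<lambda>n. cinner (snd (g n)) (snd (f n))) \<longlonglongrightarrow> cinner (snd (x, y)) (snd (x', y'))"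
      by (intro cinner.tendsto tendsto_snd f g)
    moreover have "(\<lambda>n. of_real k * cinner (fst (g n)) (fst (f n))) \<longlonglongrightarrow> of_real k * cinner (fst (x, y)) (fst (x', y'))"
      by (intro tendsto_intros cinner.tendsto tendsto_fst f g)
    moreover have "cinner (snd (g n)) (snd (f n)) = of_real k * cinner (fst (g n)) (fst (f n))" for n
      by (rule gg) (use f g in auto)
    ultimately show ?thesis by (simp add: LIMSEQ_unique)
  qed
  have addC: "(x + x', y + y') \<in> C" if mem: "(x', y') \<in> C" "(x, y) \<in> C" for x y x' y'
  proof -
    obtain f where f: "\<And>n. f n \<in> G" "f \<longlonglongrightarrow> (x', y')"
      using mem(1) unfolding C_def closure_sequential by blast
    obtain g where g: "\<And>n. g n \<in> G" "g \<longlonglongrightarrow> (x, y)"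
      using mem(2) unfolding C_def closure_sequential by blast
    have "(\<lambda>n. g n + f n) \<longlonglongrightarrow> (x, y) + (x', y')" by (intro tendsto_intros f g)
    moreover have "g n + f n \<in> G" for n
      using graph_span_add[of "fst (f n)" "snd (f n)" a b I "fst (g n)" "snd (g n)"] f(1)[of n] g(1)[of n]
      by (simp add: G_def plus_prod_def)
    ultimately show ?thesis unfolding C_def closure_sequential
      by (intro exI[of _ "\<lambda>n. g n + f n"]) auto
  qed
  have scC: "(c *\<^sub>C x, c *\<^sub>C y) \<in> C" if mem: "(x, y) \<in> C" for c x y
  proof -
    obtain g where g: "\<And>n. g n \<in> G" "g \<longlonglongrightarrow> (x, y)"
      using mem unfolding C_def closure_sequential by blast
    have "(\<lambda>n. (c *\<^sub>C fst (g n), c *\<^sub>C snd (g n))) \<longlonglongrightarrow> (c *\<^sub>C fst (x, y), c *\<^sub>C snd (x, y))"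
      by (intro tendsto_Pair scaleC.tendsto tendsto_const tendsto_fst tendsto_snd g)
    moreover have "(c *\<^sub>C fst (g n), c *\<^sub>C snd (g n)) \<in> G" for n
      using graph_span_scale[of "fst (g n)" "snd (g n)" a b I c] g(1)[of n] by (simp add: G_def)
    ultimately show ?thesis unfolding C_def closure_sequential fst_conv snd_conv
      by (intro exI[of _ "\<lambda>n. (c *\<^sub>C fst (g n), c *\<^sub>C snd (g n))"]) auto
  qed
  have GC: "G \<subseteq> C" by (simp add: C_def closure_subset)
  have C0: "(0, 0) \<in> C" using GC graph_span.zero unfolding G_def by blast
  have nrm: "norm y = sqrt k * norm x" if "(x, y) \<in> C" for x y
  proof -
    have "complex_of_real ((norm y)\<^sup>2) = of_real (k * (norm x)\<^sup>2)"
      using cc[OF that that] by (simp add: cinner_self)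
    then have "(norm y)\<^sup>2 = k * (norm x)\<^sup>2" by (simp only: of_real_eq_iff)
    then show ?thesis using k
      by (metis norm_ge_zero real_sqrt_abs real_sqrt_mult abs_of_nonneg)
  qed
  have diffC: "(x - x', y - y') \<in> C" if "(x', y') \<in> C" "(x, y) \<in> C" for x y x' y'
    using addC[OF scC[OF that(1), of "-1"] that(2)] by (simp add: scaleC.minus_left)
  have ex: "\<exists>y. (x, y) \<in> C" for x
  proof -
    have "fst ` C = UNIV"
    proof (rule total_subset_closed_csubspace[OF tot])
      show "a ` I \<subseteq> fst ` C"
        using graph_span_gen[of _ I a b] GC by (force simp: G_def)
      show "csubspace (fst ` C)"
        unfolding csubspace_def
      proof (intro conjI ballI allI)
        show "0 \<in> fst ` C" using C0 by force
        show "x + y \<in> fst ` C" if "x \<in> fst ` C" "y \<in> fst ` C" for x y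
          using that addC by force
        show "c *\<^sub>C x \<in> fst ` C" if "x \<in> fst ` C" for c x
          using that scC by force
      qed
      show "closed (fst ` C)"
        unfolding closed_sequential_limits
      proof (intro allI impI, elim conjE)
        fix f x assume f: "\<forall>n. f n \<in> fst ` C" "f \<longlonglongrightarrow> x"
        have "\<exists>y. (f n, y) \<in> C" for n using f(1)[rule_format, of n] by force
        then obtain g where g: "\<And>n. (f n, g n) \<in> C" by metis
        have "Cauchy g"
        proof (rule metric_CauchyI)
          fix e :: real assume e: "0 < e"
          \<comment> \<open>The summand 1 keeps the quotient meaningful when \<open>k\<close> is
            0.\<close>
          define e' where "e' = e / (sqrt k + 1)"
          have k1: "0 < sqrt k + 1" using k by (simp add: add_nonneg_pos)
          then have e': "e' > 0" using e by (simp add: e'_def)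
          obtain N where N: "\<And>m n. m \<ge> N \<Longrightarrow> n \<ge> N \<Longrightarrow> dist (f m) (f n) < e'"
            using metric_CauchyD[OF LIMSEQ_imp_Cauchy[OF f(2)] e'] by metis
          have "dist (g m) (g n) < e" if "m \<ge> N" "n \<ge> N" for m n
          proof -
            have "dist (g m) (g n) = sqrt k * dist (f m) (f n)"
              using nrm[OF diffC[OF g g]] by (simp add: dist_norm)
            also have "\<dots> \<le> sqrt k * e'" using N[OF that] k by (intro mult_left_mono) auto
            also have "\<dots> < (sqrt k + 1) * e'" using e' by (simp add: algebra_simps)
            also have "\<dots> = e" using k1 by (simp add: e'_def)
            finally show ?thesis .
          qed
          then show "\<exists>N. \<forall>m\<ge>N. \<forall>n\<ge>N. dist (g m) (g n) < e" by blast
        qed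
        then obtain y where y: "g \<longlonglongrightarrow> y" using Cauchy_convergent convergent_def by blast
        have "(\<lambda>n. (f n, g n)) \<longlonglongrightarrow> (x, y)" by (intro tendsto_intros f y)
        then have "(x, y) \<in> C"
          using closed_sequentially[of C "\<lambda>n. (f n, g n)"] g by (simp add: C_def)
        then show "x \<in> fst ` C" by force
      qed
    qed
    then have "x \<in> fst ` C" by simp
    then show ?thesis by force
  qed
  then obtain v where v: "\<And>x. (x, v x) \<in> C" by metis
  have uniq: "y = v x" if "(x, y) \<in> C" for x y
    using nrm[OF diffC[OF that v[of x]]] by simp
  have bl: "bounded_linear v"
  proof (rule bounded_linear_intro[where K="sqrt k"])
    show "v (x + y) = v x + v y" for x y using uniq[OF addC[OF v v]] by (simp add: add.commute)
    show "v (r *\<^sub>R x) = r *\<^sub>R v x" for r x using uniq[OF scC[OF v]] by (simp add: scaleR_eq_scaleC)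
    show "norm (v x) \<le> norm x * sqrt k" for x using nrm[OF v[of x]] by (simp add: mult.commute)
  qed
  have app: "blinfun_apply (Blinfun v) = v" by (rule bounded_linear_Blinfun_apply[OF bl])
  show ?thesis
  proof (rule that[of "Blinfun v"])
    show "Blinfun v \<in> BH" using uniq[OF scC[OF v]] by (simp add: BH_def app)
    show "Blinfun v (a i) = b i" if "i \<in> I" for i
      using uniq[of "a i" "b i"] graph_span_gen[OF that, of a b] GC by (auto simp: app G_def)
    show "cinner (Blinfun v x) (Blinfun v y) = of_real k * cinner x y" for x y
      unfolding app by (rule cc[OF v v])
  qed
qed

text \<open>Extending in both directions gives two operators that invert each other on total sets,
  which supplies surjectivity.\<close>

lemma total_image_unitary:
  fixes a b :: "'i \<Rightarrow> 'h::complex_hilbert"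
  assumes "total_set (a ` I)" "total_set (b ` I)"
    and gram: "\<And>i j. i \<in> I \<Longrightarrow> j \<in> I \<Longrightarrow> cinner (b i) (b j) = cinner (a i) (a j)"
  obtains V where "unitary V" "\<And>i. i \<in> I \<Longrightarrow> V (a i) = b i"
proof -
  obtain V where V: "V \<in> BH" "\<And>i. i \<in> I \<Longrightarrow> V (a i) = b i" "\<And>x y. cinner (V x) (V y) = cinner x y"
    using gram_extension[OF assms(1), of 1 b] gram by (metis mult_1 of_real_1 zero_le_one)
  obtain W where W: "W \<in> BH" "\<And>i. i \<in> I \<Longrightarrow> W (b i) = a i"
    using gram_extension[OF assms(2), of 1 a] gram by (metis mult_1 of_real_1 zero_le_one)
  have "V o\<^sub>L W = id_blinfun"
    by (rule total_eqI[OF assms(2)]) (auto simp: V W)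
  then have "V (W y) = y" for y by (metis blinfun_apply_blinfun_compose blinfun_apply_id_blinfun)
  then have "unitary V" by (intro unitaryI V) (auto intro: norm_eq_of_cinner simp: V)
  then show ?thesis using V that by blast
qed

subsection \<open>Projections\<close>

text \<open>The orthogonality relation determines the point of \<open>K\<close> uniquely
  (\<open>u\<close>); linearity and idempotence of the chosen map follow from this
  uniqueness.\<close>

lemma projection_onto:
  fixes K :: "'h::complex_hilbert set"
  assumes cl: "closed K" and K: "csubspace K"
  obtains p where "projection p" "\<And>x. p x \<in> K" "\<And>x. x \<in> K \<Longrightarrow> p x = x"
    "\<And>x y. y \<in> K \<Longrightarrow> cinner (x - p x) y = 0"
proof -
  have "\<exists>k. k \<in> K \<and> (\<forall>y\<in>K. cinner (x - k) y = 0)" for x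
    using orthogonal_decomposition[OF cl K, of x] by metis
  then obtain f where f: "\<And>x. f x \<in> K" "\<And>x y. y \<in> K \<Longrightarrow> cinner (x - f x) y = 0"
    by metis
  have u: "z = f x" if "z \<in> K" "\<And>y. y \<in> K \<Longrightarrow> cinner (x - z) y = 0" for x z
  proof -
    have "f x - z \<in> K" using K f that by (intro csubspace_diff) auto
    then have "cinner (x - z) (f x - z) - cinner (x - f x) (f x - z) = 0" using that f by simp
    then have "cinner (f x - z) (f x - z) = 0" by (simp add: cinner_simps algebra_simps)
    then show ?thesis by simp
  qed
  have add: "f (x + y) = f x + f y" for x y
  proof (rule u[symmetric])
    show "f x + f y \<in> K" using K f by (auto simp: csubspace_def)
    show "cinner (x + y - (f x + f y)) z = 0" if "z \<in> K" for z
      using f(2)[OF that, of x] f(2)[OF that, of y] by (simp add: cinner_simps)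
  qed
  have sc: "f (c *\<^sub>C x) = c *\<^sub>C f x" for c x
  proof (rule u[symmetric])
    show "c *\<^sub>C f x \<in> K" using K f by (auto simp: csubspace_def)
    show "cinner (c *\<^sub>C x - c *\<^sub>C f x) y = 0" if "y \<in> K" for y
      using f(2)[OF that, of x] by (simp add: cinner_simps)
  qed
  have fK: "f x = x" if "x \<in> K" for x using that by (intro u[symmetric]) auto
  have nf: "norm (f x) \<le> norm x" for x
  proof -
    have "cinner (x - f x) (f x) = 0" using f by blast
    then have "cinner (f x) (f x) = cinner x (f x)" by (simp add: cinner_simps)
    then have "complex_of_real ((norm (f x))\<^sup>2) = cinner x (f x)" by (simp add: cinner_self)
    then have "(norm (f x))\<^sup>2 = Re (cinner x (f x))" by (metis Re_complex_of_real)
    then have "norm (f x) * norm (f x) \<le> norm x * norm (f x)"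
      using Re_cinner_le[of x "f x"] by (simp add: power2_eq_square)
    then show ?thesis by (cases "f x = 0") auto
  qed
  have "bounded_linear f"
    by (rule bounded_linear_intro[where K=1]) (auto simp: add sc scaleR_eq_scaleC nf)
  then have app: "blinfun_apply (Blinfun f) = f" by (rule bounded_linear_Blinfun_apply)
  have "cinner (f x) y = cinner x (f y)" for x y
  proof -
    have "cinner (x - f x) (f y) = 0" "cinner (y - f y) (f x) = 0" using f by auto
    moreover have "cinner (f x) (y - f y) = cnj (cinner (y - f y) (f x))" by (rule cinner_commute)
    ultimately show ?thesis by (simp add: cinner_simps)
  qed
  then have "adj (Blinfun f) = Blinfun f" by (intro adj_unique) (simp add: app)
  then have "projection (Blinfun f)"
    by (auto simp: projection_def BH_def app sc fK f intro!: blinfun_eqI)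
  then show ?thesis using that[of "Blinfun f"] f fK by (simp add: app)
qed

lemma projection_BH [simp]: "projection p \<Longrightarrow> p \<in> BH"
  and projection_adj: "projection p \<Longrightarrow> adj p = p"
  and projection_idem: "projection p \<Longrightarrow> p o\<^sub>L p = p"
  by (auto simp: projection_def)

lemma projection_apply [simp]: "projection p \<Longrightarrow> p (p x) = p x"
  using blinfun_apply_cong[OF projection_idem] by fastforce

lemma projection_cinner: "projection p \<Longrightarrow> cinner (p x) y = cinner x (p y)"
  by (simp add: cinner_adj projection_adj)

text \<open>Invariance of the range under \<open>T\<close> gives \<open>p T p = T p\<close>;
  invariance under \<open>adj T\<close> gives, after taking adjoints,
  \<open>p T p = p T\<close>.\<close>

lemma projection_commute:
  assumes p: "projection p" and T: "T \<in> BH"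
    and inv: "\<And>x. p (T (p x)) = T (p x)" "\<And>x. p (adj T (p x)) = adj T (p x)"
  shows "T o\<^sub>L p = p o\<^sub>L T"
proof (rule blinfun_eqI)
  fix x
  have "p (T x) = p (T (p x))"
  proof (rule cinner_ext_right)
    fix y
    have "cinner y (p (T x)) = cinner (adj T (p y)) x"
      using p T by (simp add: cinner_adj_left flip: projection_cinner)
    also have "\<dots> = cinner (p (adj T (p y))) x" by (simp add: inv)
    also have "\<dots> = cinner y (p (T (p x)))"
      using p T by (simp add: cinner_adj_left projection_cinner)
    finally show "cinner y (p (T x)) = cinner y (p (T (p x)))" .
  qed
  then show "(T o\<^sub>L p) x = (p o\<^sub>L T) x" by (simp add: inv)
qed

lemma projection_norm_le: "projection p \<Longrightarrow> norm (p x) \<le> norm x"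
proof -
  assume p: "projection p"
  have "norm (p x) * norm (p x) = Re (cinner (p x) (p x))" by (simp add: cinner_self power2_eq_square)
  also have "\<dots> = Re (cinner x (p x))" using p by (simp add: projection_cinner)
  also have "\<dots> \<le> norm x * norm (p x)" by (rule Re_cinner_le)
  finally show ?thesis by (cases "p x = 0") auto
qed

subsection \<open>Commutants and von Neumann algebras\<close>

lemma commutant_BH: "T \<in> commutant M \<Longrightarrow> T \<in> BH"
  and commutantD: "T \<in> commutant M \<Longrightarrow> A \<in> M \<Longrightarrow> T o\<^sub>L A = A o\<^sub>L T"
  by (auto simp: commutant_def)

lemma commutantI:
  "T \<in> BH \<Longrightarrow> (\<And>A. A \<in> M \<Longrightarrow> T o\<^sub>L A = A o\<^sub>L T) \<Longrightarrow> T \<in> commutant M"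
  by (simp add: commutant_def)

lemma commutant_apply: "T \<in> commutant M \<Longrightarrow> A \<in> M \<Longrightarrow> T (A x) = A (T x)"
  using blinfun_apply_cong[OF commutantD, of T M A x] by simp

lemma commutant_closed_ops:
  assumes "M \<subseteq> BH"
  shows "id_blinfun \<in> commutant M" "0 \<in> commutant M"
    "S \<in> commutant M \<Longrightarrow> T \<in> commutant M \<Longrightarrow> S o\<^sub>L T \<in> commutant M"
    "S \<in> commutant M \<Longrightarrow> T \<in> commutant M \<Longrightarrow> S + T \<in> commutant M"
    "S \<in> commutant M \<Longrightarrow> T \<in> commutant M \<Longrightarrow> S - T \<in> commutant M"
    "S \<in> commutant M \<Longrightarrow> scale_op c S \<in> commutant M"
proof -
  show "id_blinfun \<in> commutant M" "0 \<in> commutant M" by (auto simp: commutant_def)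
  assume S: "S \<in> commutant M"
  show "scale_op c S \<in> commutant M"
    using S assms by (auto simp: commutant_def scale_op_compose_left scale_op_compose_right)
  assume T: "T \<in> commutant M"
  have "(S o\<^sub>L T) o\<^sub>L A = A o\<^sub>L (S o\<^sub>L T)" if "A \<in> M" for A
    by (rule blinfun_eqI) (simp add: commutant_apply[OF T that] commutant_apply[OF S that])
  then show "S o\<^sub>L T \<in> commutant M" using S T by (auto simp: commutant_def)
  show "S + T \<in> commutant M" "S - T \<in> commutant M"
    using S T assms by (auto simp: commutant_def compose_add_left compose_add_right
        compose_diff_left compose_diff_right)
qed

lemma commutant_adj:
  assumes "M \<subseteq> BH" "adj ` M \<subseteq> M" "T \<in> commutant M"
  shows "adj T \<in> commutant M"
proof -
  have T: "T \<in> BH" using assms(3) by (rule commutant_BH)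
  have "adj T o\<^sub>L A = A o\<^sub>L adj T" if A: "A \<in> M" for A
  proof -
    have "adj A \<in> M" "A \<in> BH" using assms A by auto
    then show ?thesis
      using arg_cong[OF commutantD[OF assms(3), of "adj A"], of adj] T by (simp add: adj_compose)
  qed
  then show ?thesis using T by (simp add: commutant_def)
qed

lemma commutant_limit:
  assumes "\<And>n. T n \<in> commutant M" "T \<longlonglongrightarrow> S"
  shows "S \<in> commutant M"
proof -
  have p: "(\<lambda>n. T n x) \<longlonglongrightarrow> S x" for x by (intro tendsto_intros assms)
  have "S (c *\<^sub>C x) = c *\<^sub>C S x" for c x
  proof (rule LIMSEQ_unique[OF p])
    have "(\<lambda>n. c *\<^sub>C T n x) \<longlonglongrightarrow> c *\<^sub>C S x" by (intro scaleC.tendsto tendsto_const p)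
    then show "(\<lambda>n. T n (c *\<^sub>C x)) \<longlonglongrightarrow> c *\<^sub>C S x"
      using commutant_BH[OF assms(1)] by (simp add: BH_apply)
  qed
  moreover have "S (A x) = A (S x)" if "A \<in> M" for A x
  proof (rule LIMSEQ_unique[OF p])
    have "(\<lambda>n. A (T n x)) \<longlonglongrightarrow> A (S x)" by (intro tendsto_intros p)
    then show "(\<lambda>n. T n (A x)) \<longlonglongrightarrow> A (S x)"
      using commutant_apply[OF assms(1) that] by simp
  qed
  ultimately show ?thesis by (auto simp: commutant_def BH_def intro!: blinfun_eqI)
qed

locale vn_algebra =
  fixes M :: "'h::complex_hilbert op set"
  assumes vn: "von_neumann_algebra M"
begin

lemma in_BH [simp]: "A \<in> M \<Longrightarrow> A \<in> BH"
  and in_adj [simp]: "A \<in> M \<Longrightarrow> adj A \<in> M"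
  and subset_BH: "M \<subseteq> BH" and adj_image: "adj ` M \<subseteq> M"
  and bicommutant: "commutant (commutant M) = M"
  using vn by (auto simp: von_neumann_algebra_def)

lemma commutant_subset_BH: "commutant M \<subseteq> BH"
  by (auto simp: commutant_def)

lemma in_id [simp]: "id_blinfun \<in> M"
  and in_zero [simp]: "0 \<in> M"
  and in_compose [simp]: "S \<in> M \<Longrightarrow> T \<in> M \<Longrightarrow> S o\<^sub>L T \<in> M"
  and in_add [simp]: "S \<in> M \<Longrightarrow> T \<in> M \<Longrightarrow> S + T \<in> M"
  and in_diff [simp]: "S \<in> M \<Longrightarrow> T \<in> M \<Longrightarrow> S - T \<in> M"
  and in_scale [simp]: "S \<in> M \<Longrightarrow> scale_op c S \<in> M"
  using commutant_closed_ops[OF commutant_subset_BH] unfolding bicommutant by auto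

lemma in_limit: "(\<And>n. T n \<in> M) \<Longrightarrow> T \<longlonglongrightarrow> S \<Longrightarrow> S \<in> M"
  using commutant_limit[of T "commutant M" S] unfolding bicommutant .

lemma vn_commutant: "von_neumann_algebra (commutant M)"
  using commutant_adj[OF subset_BH adj_image] commutant_subset_BH
  by (auto simp: von_neumann_algebra_def bicommutant)

lemma projection_in_algebra:
  assumes p: "projection p"
    and inv: "\<And>B x. B \<in> commutant M \<Longrightarrow> p (B (p x)) = B (p x)"
  shows "p \<in> M"
proof -
  have "p o\<^sub>L B = B o\<^sub>L p" if B: "B \<in> commutant M" for B
    using B by (intro projection_commute[symmetric] p commutant_BH[OF B] inv
        commutant_adj[OF subset_BH adj_image])
  then have "p \<in> commutant (commutant M)" using p by (simp add: commutant_def)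
  then show ?thesis by (simp add: bicommutant)
qed

text \<open>The source of all projections in \<open>M\<close> below: by the bicommutant property, a
  closed subspace invariant under the commutant has its projection in \<open>M\<close>.\<close>

lemma invariant_projection:
  assumes "closed K" "csubspace K" and inv: "\<And>B x. B \<in> commutant M \<Longrightarrow> x \<in> K \<Longrightarrow> B x \<in> K"
  obtains p where "p \<in> M" "projection p" "\<And>x. p x \<in> K" "\<And>x. x \<in> K \<Longrightarrow> p x = x"
    "\<And>x y. y \<in> K \<Longrightarrow> cinner (x - p x) y = 0"
proof -
  obtain p where p: "projection p" "\<And>x. p x \<in> K" "\<And>x. x \<in> K \<Longrightarrow> p x = x"
    "\<And>x y. y \<in> K \<Longrightarrow> cinner (x - p x) y = 0"
    using projection_onto[OF assms(1,2)] by blast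
  then have "p \<in> M" by (intro projection_in_algebra) (auto intro: inv)
  then show ?thesis using p that by blast
qed

end

lemma compose_assoc: "(R o\<^sub>L S) o\<^sub>L T = R o\<^sub>L (S o\<^sub>L T)"
  by (rule blinfun_eqI) simp

lemma scaleR_eq_scale_op: "r *\<^sub>R T = scale_op (complex_of_real r) T"
  by (rule blinfun_eqI) (simp add: blinfun.scaleR_left scaleC_of_real)

subsection \<open>Square roots and minimal projections\<close>

lemma selfadjoint_inner: "A \<in> BH \<Longrightarrow> adj A = A \<Longrightarrow> inner (A x) y = inner x (A y)"
  by (simp add: inner_eq_Re_cinner cinner_adj)

text \<open>The square root of \<open>A\<^sup>2 = 1 - X\<close> is \<open>1 - Y\<close>, where \<open>Y = (X + Y\<^sup>2) / 2\<close> is the limit of the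
  obvious iteration. The scalar iteration for \<open>X = 1\<close> dominates it in norm.\<close>

lemma square_root_exists:
  fixes M :: "'h::complex_hilbert op set"
  assumes "vn_algebra M" and A: "A \<in> M" "adj A = A" "norm A \<le> 1"
  obtains D where "D \<in> M" "D o\<^sub>L D = A o\<^sub>L A"
    "\<And>R. R o\<^sub>L A = A o\<^sub>L R \<Longrightarrow> R o\<^sub>L D = D o\<^sub>L R" "\<And>x. 0 \<le> inner (D x) x"
proof -
  interpret vn_algebra M by fact
  define X where "X = id_blinfun - (A o\<^sub>L A)"
  have XM: "X \<in> M" using A by (simp add: X_def)
  have nX: "norm X \<le> 1"
  proof (rule norm_blinfun_bound)
    fix x
    note sa = selfadjoint_inner[OF in_BH[OF A(1)] A(2)]
    have "norm (A (A x)) \<le> norm (A x)"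
      using norm_blinfun[of A "A x"] A(3) by (smt (verit) mult_left_le_one_le norm_ge_zero)
    then have "(norm (A (A x)))\<^sup>2 \<le> (norm (A x))\<^sup>2" by (simp add: power_mono)
    moreover have "(norm (X x))\<^sup>2 = (norm x)\<^sup>2 - 2 * (norm (A x))\<^sup>2 + (norm (A (A x)))\<^sup>2"
      using sa[of "A x" x] sa[of x "A x"]
      by (simp add: X_def blinfun.diff_left power2_norm_eq_inner inner_simps inner_commute)
    ultimately have "(norm (X x))\<^sup>2 \<le> (norm x)\<^sup>2" using zero_le_power2[of "norm (A x)"] by linarith
    then show "norm (X x) \<le> 1 * norm x" using power2_le_imp_le by fastforce
  qed simp
  define Y where "Y = rec_nat 0 (\<lambda>_ T. (1/2) *\<^sub>R (X + (T o\<^sub>L T)))"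
  define y where "y = rec_nat 0 (\<lambda>_ t::real. (1 + t\<^sup>2) / 2)"
  have Y0: "Y 0 = 0" and YS: "Y (Suc n) = (1/2) *\<^sub>R (X + (Y n o\<^sub>L Y n))" for n
    by (simp_all add: Y_def)
  have y0: "y 0 = 0" and yS: "y (Suc n) = (1 + (y n)\<^sup>2) / 2" for n
    by (simp_all add: y_def)
  have y01: "0 \<le> y n \<and> y n \<le> 1" for n
  proof (induction n)
    case (Suc n)
    then have "(y n)\<^sup>2 \<le> 1" by (simp add: power_le_one)
    then show ?case by (simp add: yS)
  qed (simp add: y0)
  have nY: "norm (Y n) \<le> y n" for n
  proof (induction n)
    case (Suc n)
    have "norm (Y n o\<^sub>L Y n) \<le> norm (Y n) * norm (Y n)" by (rule norm_blinfun_compose)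
    also have "\<dots> \<le> (y n)\<^sup>2" using Suc y01[of n] by (simp add: power2_eq_square mult_mono)
    finally have "norm (X + (Y n o\<^sub>L Y n)) \<le> 1 + (y n)\<^sup>2" using nX norm_triangle_le by (smt (verit))
    then show ?case by (simp add: YS yS)
  qed (simp add: Y0 y0)
  have dY: "norm (Y (Suc n) - Y n) \<le> y (Suc n) - y n" for n
  proof (induction n)
    case 0
    then show ?case using nX by (simp add: YS Y0 yS y0)
  next
    case (Suc n)
    let ?a = "Y (Suc n)" and ?b = "Y n"
    \<comment> \<open>The difference of squares is split in an order that is valid without
      commutation. The scalar iteration obeys the same formula exactly, so the domination is
      inherited by the next step.\<close>
    have eq: "Y (Suc (Suc n)) - Y (Suc n) = (1/2) *\<^sub>R ((?a o\<^sub>L (?a - ?b)) + ((?a - ?b) o\<^sub>L ?b))"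
    proof -
      have "Y (Suc (Suc n)) - Y (Suc n) = (1/2) *\<^sub>R ((?a o\<^sub>L ?a) - (?b o\<^sub>L ?b))"
        using YS[of n] unfolding YS[of "Suc n"] by (simp add: algebra_simps)
      then show ?thesis by (simp add: compose_diff_left compose_diff_right)
    qed
    have "norm (?a o\<^sub>L (?a - ?b)) \<le> y (Suc n) * (y (Suc n) - y n)"
      using norm_blinfun_compose[of ?a "?a - ?b"] mult_mono[OF nY[of "Suc n"] Suc] y01[of "Suc n"]
      by simp
    moreover have "norm ((?a - ?b) o\<^sub>L ?b) \<le> (y (Suc n) - y n) * y n"
      using norm_blinfun_compose[of "?a - ?b" ?b] mult_mono[OF Suc nY[of n]] order_trans[OF norm_ge_zero Suc]
      by simp
    ultimately have "norm ((?a o\<^sub>L (?a - ?b)) + ((?a - ?b) o\<^sub>L ?b)) \<le>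
        y (Suc n) * (y (Suc n) - y n) + (y (Suc n) - y n) * y n"
      by (rule norm_triangle_mono)
    also have "\<dots> = 2 * (y (Suc (Suc n)) - y (Suc n))"
      by (simp add: yS[of "Suc n"] yS[of n] algebra_simps power2_eq_square add_divide_distrib diff_divide_distrib)
    finally show ?case by (simp add: eq)
  qed
  have dY': "norm (Y (n + k) - Y n) \<le> y (n + k) - y n" for n k
  proof (induction k)
    case (Suc k)
    have "norm (Y (n + Suc k) - Y n) \<le> norm (Y (n + Suc k) - Y (n + k)) + norm (Y (n + k) - Y n)"
      using norm_triangle_ineq[of "Y (n + Suc k) - Y (n + k)" "Y (n + k) - Y n"] by simp
    then show ?case using Suc dY[of "n + k"] by simp
  qed simp
  have "incseq y" by (rule incseq_SucI) (use order_trans[OF norm_ge_zero dY] in \<open>simp add: le_diff_eq\<close>)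
  then have "Cauchy y" using incseq_convergent[of y 1] y01 LIMSEQ_imp_Cauchy by metis
  have "Cauchy Y"
  proof (rule metric_CauchyI)
    fix e :: real assume "0 < e"
    then obtain N where N: "\<And>m n. m \<ge> N \<Longrightarrow> n \<ge> N \<Longrightarrow> dist (y m) (y n) < e"
      using metric_CauchyD[OF \<open>Cauchy y\<close>] by metis
    have "dist (Y m) (Y n) < e" if "m \<ge> n" "n \<ge> N" for m n
      using dY'[of n "m - n"] N[of m n] that by (simp add: dist_norm)
    then show "\<exists>N. \<forall>m\<ge>N. \<forall>n\<ge>N. dist (Y m) (Y n) < e" by (metis dist_commute nat_le_linear)
  qed
  then obtain L where L: "Y \<longlonglongrightarrow> L" using Cauchy_convergent convergent_def by blast
  have YM: "Y n \<in> M" for n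
    by (induction n) (simp_all add: Y0 YS XM scaleR_eq_scale_op)
  then have LM: "L \<in> M" using L by (rule in_limit)
  have "(\<lambda>n. Y (Suc n)) \<longlonglongrightarrow> (1/2) *\<^sub>R (X + (L o\<^sub>L L))"
    unfolding YS by (intro tendsto_intros L bounded_bilinear.tendsto[OF bounded_bilinear_blinfun_compose])
  then have "L = (1/2) *\<^sub>R (X + (L o\<^sub>L L))" using LIMSEQ_Suc[OF L] LIMSEQ_unique by blast
  then have "2 *\<^sub>R L = 2 *\<^sub>R ((1/2) *\<^sub>R (X + (L o\<^sub>L L)))" by (rule arg_cong)
  then have L2: "L o\<^sub>L L = 2 *\<^sub>R L - X" by simp
  have nL: "norm L \<le> 1"
    by (rule LIMSEQ_le_const2[OF tendsto_norm[OF L]]) (use nY y01 order_trans in blast)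
  show ?thesis
  proof (rule that[of "id_blinfun - L"])
    show "id_blinfun - L \<in> M" using LM by simp
    show "(id_blinfun - L) o\<^sub>L (id_blinfun - L) = A o\<^sub>L A"
      by (simp add: compose_diff_left compose_diff_right L2 X_def scaleR_2)
    show "R o\<^sub>L (id_blinfun - L) = (id_blinfun - L) o\<^sub>L R" if R: "R o\<^sub>L A = A o\<^sub>L R" for R
    proof -
      have Rx: "R (A x) = A (R x)" for x using blinfun_apply_cong[OF R, of x] by simp
      have "R o\<^sub>L Y n = Y n o\<^sub>L R" for n
      proof (induction n)
        case (Suc n)
        have "R (Y n x) = Y n (R x)" for x using blinfun_apply_cong[OF Suc, of x] by simp
        then show ?case
          by (intro blinfun_eqI) (simp add: YS X_def Rx blinfun.add_left blinfun.add_right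
              blinfun.diff_left blinfun.diff_right blinfun.scaleR_left blinfun.scaleR_right)
      qed (auto simp: Y0 intro!: blinfun_eqI)
      moreover have "(\<lambda>n. R o\<^sub>L Y n) \<longlonglongrightarrow> (R o\<^sub>L L)" "(\<lambda>n. Y n o\<^sub>L R) \<longlonglongrightarrow> (L o\<^sub>L R)"
        by (intro tendsto_intros L bounded_bilinear.tendsto[OF bounded_bilinear_blinfun_compose])+
      ultimately have "R o\<^sub>L L = L o\<^sub>L R" using LIMSEQ_unique by auto
      then show ?thesis by (simp add: compose_diff_left compose_diff_right)
    qed
    show "0 \<le> inner ((id_blinfun - L) x) x" for x
    proof -
      have "inner (L x) x \<le> norm (L x) * norm x" by (rule norm_cauchy_schwarz)
      also have "\<dots> \<le> (1 * norm x) * norm x"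
        using norm_blinfun[of L x] nL by (intro mult_right_mono) (meson mult_right_mono norm_ge_zero order_trans, simp)
      finally show ?thesis
        by (simp add: blinfun.diff_left inner_diff_left dot_square_norm power2_eq_square)
    qed
  qed
qed

lemma csubspace_range: "C \<in> BH \<Longrightarrow> csubspace (range (blinfun_apply C))"
  unfolding csubspace_def
proof (intro conjI ballI allI)
  assume C: "C \<in> BH"
  show "0 \<in> range (blinfun_apply C)" using blinfun.zero_right by (metis rangeI)
  show "x + y \<in> range (blinfun_apply C)" if "x \<in> range (blinfun_apply C)" "y \<in> range (blinfun_apply C)" for x y
    using that by (auto simp: image_iff) (metis blinfun.add_right)
  show "c *\<^sub>C x \<in> range (blinfun_apply C)" if "x \<in> range (blinfun_apply C)" for c x
    using that by (auto simp: image_iff) (metis BH_apply[OF C])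
qed

lemma closure_invariant:
  fixes B :: "'h::complex_hilbert op"
  assumes "\<And>x. x \<in> S \<Longrightarrow> B x \<in> S" "x \<in> closure S"
  shows "B x \<in> closure S"
proof -
  obtain f where f: "\<And>n. f n \<in> S" "f \<longlonglongrightarrow> x" using assms(2) unfolding closure_sequential by blast
  have "(\<lambda>n. B (f n)) \<longlonglongrightarrow> B x" by (intro tendsto_intros f)
  then show ?thesis unfolding closure_sequential using assms(1) f(1)
    by (intro exI[of _ "\<lambda>n. B (f n)"]) auto
qed

lemma closed_eq_blinfun: "closed {x. blinfun_apply S x = blinfun_apply T x}"
  by (intro closed_Collect_eq continuous_intros)

text \<open>With \<open>D\<close> the absolute value of the rescaled operator \<open>B\<close>, one
  has \<open>(D - B) (D + B) = 0\<close>. The closed range of \<open>e (D + B)\<close> gives a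
  subprojection of \<open>e\<close> in \<open>M\<close>, which minimality forces to be 0 or
  \<open>e\<close>; in the first case \<open>B\<close> is \<open>- D\<close> on the range of
  \<open>e\<close>, in the second it is \<open>D\<close>.\<close>

lemma minimal_projection_sign:
  fixes M :: "'h::complex_hilbert op set"
  assumes "vn_algebra M" and e: "minimal_projection M e"
    and A: "A \<in> M" "adj A = A" "A o\<^sub>L e = e o\<^sub>L A"
  shows "(\<forall>x. 0 \<le> inner (A (e x)) (e x)) \<or> (\<forall>x. inner (A (e x)) (e x) \<le> 0)"
proof -
  interpret vn_algebra M by fact
  have eM: "e \<in> M" and pe: "projection e"
    and min: "\<And>q. q \<in> M \<Longrightarrow> projection q \<Longrightarrow> e o\<^sub>L q = q \<Longrightarrow> q = 0 \<or> q = e"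
    using e by (auto simp: minimal_projection_def)
  \<comment> \<open>Scaling to norm at most 1, as the square root requires; the summand 1 covers
    \<open>A = 0\<close>.\<close>
  define r where "r = 1 / (norm A + 1)"
  have r: "r > 0" by (simp add: r_def add_nonneg_pos)
  define B where "B = r *\<^sub>R A"
  have BM: "B \<in> M" using A by (simp add: B_def scaleR_eq_scale_op)
  have Bsa: "adj B = B" using A by (simp add: B_def scaleR_eq_scale_op adj_scale)
  have "norm B \<le> 1" by (simp add: B_def r_def divide_le_eq add_nonneg_pos)
  then obtain D where D: "D \<in> M" "D o\<^sub>L D = B o\<^sub>L B"
      "\<And>R. R o\<^sub>L B = B o\<^sub>L R \<Longrightarrow> R o\<^sub>L D = D o\<^sub>L R" "\<And>x. 0 \<le> inner (D x) x"
    using square_root_exists[OF assms(1) BM Bsa] by blast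
  have eB: "e o\<^sub>L B = B o\<^sub>L e"
    using blinfun_apply_cong[OF A(3)]
    by (intro blinfun_eqI) (simp add: B_def blinfun.scaleR_left blinfun.scaleR_right)
  have eBx: "e (B x) = B (e x)" for x using blinfun_apply_cong[OF eB, of x] by simp
  have eDx: "e (D x) = D (e x)" for x using blinfun_apply_cong[OF D(3)[OF eB], of x] by simp
  have BDx: "B (D x) = D (B x)" for x using blinfun_apply_cong[OF D(3)[of B], of x] by simp
  have DDx: "D (D x) = B (B x)" for x using blinfun_apply_cong[OF D(2), of x] by simp
  define C where "C = e o\<^sub>L (D + B)"
  have CM: "C \<in> M" using eM D(1) BM by (simp add: C_def)
  define K where "K = closure (range (blinfun_apply C))"
  have clK: "closed K" and subK: "csubspace K"
    unfolding K_def by (simp_all add: csubspace_closure csubspace_range CM)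
  have inv: "T x \<in> K" if T: "T \<in> commutant M" "x \<in> K" for T x
    unfolding K_def
  proof (rule closure_invariant[OF _ T(2)[unfolded K_def]])
    show "T z \<in> range (blinfun_apply C)" if "z \<in> range (blinfun_apply C)" for z
      using that commutant_apply[OF T(1) CM] by auto
  qed
  obtain p where p: "p \<in> M" "projection p" "\<And>x. p x \<in> K" "\<And>x. x \<in> K \<Longrightarrow> p x = x"
    by (rule invariant_projection[OF clK subK inv]) auto
  have "K \<subseteq> {x. e x = id_blinfun x}"
    unfolding K_def by (rule closure_minimal[OF _ closed_eq_blinfun]) (auto simp: C_def pe)
  then have "e (p x) = p x" for x using p(3)[of x] by auto
  then have "e o\<^sub>L p = p" by (intro blinfun_eqI) simp
  then consider "p = 0" | "p = e" using min p by blast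
  then show ?thesis
  proof cases
    case 1
    have "C x = 0" for x
    proof -
      have "C x \<in> K" unfolding K_def by (rule subsetD[OF closure_subset]) simp
      then show ?thesis using p(4)[of "C x"] 1 by simp
    qed
    then have "B (e x) = - D (e x)" for x
      by (simp add: C_def blinfun.add_left blinfun.add_right eBx eDx eq_neg_iff_add_eq_0 add.commute)
    then have "inner (B (e x)) (e x) \<le> 0" for x using D(4)[of "e x"] by simp
    then have "r * inner (A (e x)) (e x) \<le> 0" for x
      by (simp add: B_def blinfun.scaleR_left)
    then show ?thesis using r by (simp add: mult_le_0_iff)
  next
    case 2
    \<comment> \<open>On vectors \<open>C x\<close> this is \<open>D (D + B) = B (D + B)\<close>, a
      consequence of \<open>D o\<^sub>L D = B o\<^sub>L B\<close> and of \<open>D\<close> commuting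
      with \<open>B\<close> and \<open>e\<close>.\<close>
    have "K \<subseteq> {x. D x = B x}"
      unfolding K_def
      by (rule closure_minimal[OF _ closed_eq_blinfun])
        (auto simp: C_def blinfun.add_left blinfun.add_right BDx DDx eDx eBx)
    then have "D (e x) = B (e x)" for x using p(3)[of x] 2 by auto
    then have "0 \<le> inner (B (e x)) (e x)" for x using D(4)[of "e x"] by simp
    then have "0 \<le> r * inner (A (e x)) (e x)" for x
      by (simp add: B_def blinfun.scaleR_left)
    then show ?thesis using r by (simp add: zero_le_mult_iff)
  qed
qed

text \<open>Minimality in algebraic form, \<open>e M e\<close> scalar. This is what computes Gram
  matrices of vectors \<open>A (e x)\<close>, which the order-theoretic form does not do
  directly.\<close>

definition atom :: "'h::complex_hilbert op set \<Rightarrow> 'h op \<Rightarrow> bool" where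
  "atom M e \<longleftrightarrow> e \<in> M \<and> projection e \<and> e \<noteq> 0 \<and> (\<forall>A\<in>M. \<exists>c. e o\<^sub>L A o\<^sub>L e = scale_op c e)"

text \<open>Take \<open>c\<close> to be the Rayleigh quotient of \<open>A\<close> at one vector
  \<open>e x0\<close>. After subtracting \<open>c + l\<close> the form has the sign of
  \<open>- l\<close> at that vector, hence weakly that sign on the whole range of \<open>e\<close>;
  letting \<open>l\<close> tend to 0 from both sides makes the form equal to \<open>c\<close> times
  the squared norm.\<close>

lemma minimal_projection_compress_selfadjoint:
  fixes M :: "'h::complex_hilbert op set"
  assumes "vn_algebra M" and e: "minimal_projection M e" and A: "A \<in> M" "adj A = A"
  obtains c where "\<And>x. e (A (e x)) = c *\<^sub>R e x"
proof -
  interpret vn_algebra M by fact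
  have eM: "e \<in> M" and pe: "projection e" and e0: "e \<noteq> 0"
    using e by (auto simp: minimal_projection_def)
  note ea = projection_adj[OF pe]
  from e0 obtain x0 where x0: "e x0 \<noteq> 0" by (metis blinfun_eqI zero_blinfun.rep_eq)
  define c where "c = inner (A (e x0)) (e x0) / (norm (e x0))\<^sup>2"
  define B where "B l = (e o\<^sub>L A o\<^sub>L e) - (c + l) *\<^sub>R e" for l
  have sae: "inner (e x) y = inner x (e y)" for x y
    by (rule selfadjoint_inner) (auto simp: pe ea)
  have saA: "inner (A x) y = inner x (A y)" for x y
    by (rule selfadjoint_inner) (auto simp: A)
  have BM: "B l \<in> M" for l using A eM by (simp add: B_def scaleR_eq_scale_op)
  have Bsa: "adj (B l) = B l" for l
    using A eM by (simp add: B_def scaleR_eq_scale_op adj_diff adj_scale adj_compose ea compose_assoc)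
  have Be: "B l o\<^sub>L e = e o\<^sub>L B l" for l
    by (rule blinfun_eqI) (simp add: B_def blinfun.diff_left blinfun.diff_right blinfun.scaleR_left blinfun.scaleR_right pe)
  have Bq: "inner (B l (e x)) (e x) = inner (A (e x)) (e x) - (c + l) * (norm (e x))\<^sup>2" for l x
    by (simp add: B_def blinfun.diff_left blinfun.scaleR_left pe inner_simps dot_square_norm sae)
  have q0: "inner (A (e x0)) (e x0) = c * (norm (e x0))\<^sup>2" using x0 by (simp add: c_def)
  have n0: "0 < (norm (e x0))\<^sup>2" using x0 by simp
  have up: "inner (A (e x)) (e x) \<le> (c + l) * (norm (e x))\<^sup>2" if l: "l > 0" for l x
  proof -
    have "\<not> 0 \<le> inner (B l (e x0)) (e x0)"
      unfolding Bq q0 using mult_pos_pos[OF l n0] by (simp add: algebra_simps)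
    then have "inner (B l (e x)) (e x) \<le> 0"
      using minimal_projection_sign[OF assms(1) e BM Bsa Be] by blast
    then show ?thesis by (simp add: Bq)
  qed
  have lo: "inner (A (e x)) (e x) \<ge> (c + l) * (norm (e x))\<^sup>2" if l: "l < 0" for l x
  proof -
    have "\<not> inner (B l (e x0)) (e x0) \<le> 0"
      unfolding Bq q0 using mult_neg_pos[OF l n0] by (simp add: algebra_simps)
    then have "0 \<le> inner (B l (e x)) (e x)"
      using minimal_projection_sign[OF assms(1) e BM Bsa Be] by blast
    then show ?thesis by (simp add: Bq)
  qed
  have eq: "inner (A (e x)) (e x) = c * (norm (e x))\<^sup>2" for x
  proof (cases "e x = 0")
    case False
    then have n: "0 < (norm (e x))\<^sup>2" by simp
    show ?thesis
    proof (rule antisym; rule field_le_epsilon)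
      fix d :: real assume d: "0 < d"
      then show "inner (A (e x)) (e x) \<le> c * (norm (e x))\<^sup>2 + d"
        using up[of "d / (norm (e x))\<^sup>2" x] n False by (simp add: distrib_right)
      show "c * (norm (e x))\<^sup>2 \<le> inner (A (e x)) (e x) + d"
        using lo[of "- (d / (norm (e x))\<^sup>2)" x] n d False by (simp add: algebra_simps)
    qed
  qed simp
  have "e (A (e x)) = c *\<^sub>R e x" for x
  proof -
    define T where "T z = e (A z) - c *\<^sub>R z" for z
    have ee: "e (e z) = e z" for z by (simp add: pe)
    have T0: "inner (T (e z)) (e z) = 0" for z
      using eq[of z] by (simp add: T_def inner_simps sae ee dot_square_norm)
    have Tadd: "T (u + v) = T u + T v" for u v
      by (simp add: T_def blinfun.add_right algebra_simps)
    have Tsa: "inner (T (e u)) (e v) = inner (e u) (T (e v))" for u v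
      using sae[of u "A (e v)"] saA[of "e u" "e v"]
      by (simp add: T_def inner_simps) (simp add: sae ee saA)
    \<comment> \<open>Polarization for a symmetric operator: a vanishing quadratic form kills the
      real bilinear form, so \<open>T\<close> vanishes on the range of \<open>e\<close>.\<close>
    have "inner (T (e u)) (e v) = 0" for u v
    proof -
      have "inner (T (e u + e v)) (e u + e v) = 0"
        using T0[of "u + v"] by (simp add: blinfun.add_right)
      then have "inner (T (e u)) (e v) + inner (T (e v)) (e u) = 0"
        by (simp add: Tadd inner_simps T0)
      moreover have "inner (T (e v)) (e u) = inner (T (e u)) (e v)"
        using Tsa[of v u] by (simp add: inner_commute)
      ultimately show ?thesis by simp
    qed
    moreover have "T (e x) = e (T (e x))"
      by (simp add: T_def blinfun.diff_right blinfun.scaleR_right ee)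
    ultimately have "inner (T (e x)) (T (e x)) = 0" by metis
    then show ?thesis by (simp add: T_def)
  qed
  then show ?thesis using that by blast
qed

lemma minimal_projection_atom:
  fixes M :: "'h::complex_hilbert op set"
  assumes "vn_algebra M" and e: "minimal_projection M e"
  shows "atom M e"
proof -
  interpret vn_algebra M by fact
  have eM: "e \<in> M" and pe: "projection e" and e0: "e \<noteq> 0"
    using e by (auto simp: minimal_projection_def)
  have "\<exists>c. e o\<^sub>L A o\<^sub>L e = scale_op c e" if A: "A \<in> M" for A
  proof -
    define R where "R = scale_op (1/2) (A + adj A)"
    define S where "S = scale_op (- \<i> / 2) (A - adj A)"
    have sa: "R \<in> M" "adj R = R" "S \<in> M" "adj S = S"
      using A by (auto simp: R_def S_def adj_scale adj_add adj_diff add.commute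
          blinfun.add_left blinfun.diff_left scaleC.diff_right scaleC.minus_left intro!: blinfun_eqI)
    obtain a b where a: "\<And>x. e (R (e x)) = a *\<^sub>R e x" and b: "\<And>x. e (S (e x)) = b *\<^sub>R e x"
      using minimal_projection_compress_selfadjoint[OF assms sa(1,2)]
        minimal_projection_compress_selfadjoint[OF assms sa(3,4)] by metis
    have AH: "A x = R x + \<i> *\<^sub>C S x" for x
    proof -
      have "R x + \<i> *\<^sub>C S x = (1/2 + 1/2) *\<^sub>C A x + (1/2 - 1/2) *\<^sub>C adj A x"
        unfolding scaleC.add_left scaleC.diff_left
        by (simp add: R_def S_def blinfun.add_left blinfun.diff_left scaleC.diff_right
          scaleC.add_right scaleC_scaleC scaleC.minus_left)
      then show ?thesis by simp
    qed
    have "(e o\<^sub>L A o\<^sub>L e) x = scale_op (complex_of_real a + \<i> * complex_of_real b) e x" for x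
      using a b pe by (simp add: AH blinfun.add_right BH_apply scaleR_eq_scaleC scaleC_scaleC scaleC_add_left)
    then show ?thesis by (blast intro: blinfun_eqI)
  qed
  then show ?thesis using eM pe e0 by (simp add: atom_def)
qed

lemma factor_vn: "factor M \<Longrightarrow> vn_algebra M"
  by (simp add: factor_def vn_algebra_def)

lemma factor_commutant: "factor M \<Longrightarrow> factor (commutant M)"
  using vn_algebra.vn_commutant[OF factor_vn, of M] vn_algebra.bicommutant[OF factor_vn, of M]
  by (simp add: factor_def Int_commute)

text \<open>The orthogonal complement of the orbit is invariant under \<open>M\<close> and under its
  commutant, so its projection is central and therefore scalar. The scalar is 0, because a nonzero
  vector \<open>e x0\<close> lies outside the complement.\<close>

lemma factor_atom_total:
  fixes M :: "'h::complex_hilbert op set"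
  assumes "factor M" "atom M e"
  shows "total_set {blinfun_apply A (e x) | A x. A \<in> M}"
proof -
  interpret vn_algebra M using assms(1) by (rule factor_vn)
  interpret C: vn_algebra "commutant M" using factor_vn[OF factor_commutant[OF assms(1)]] .
  have eM: "e \<in> M" and e0: "e \<noteq> 0" using assms(2) by (auto simp: atom_def)
  define K where "K = {y. \<forall>A\<in>M. \<forall>x. cinner (A (e x)) y = 0}"
  have "K = (\<Inter>A\<in>M. \<Inter>x. {y. cinner (blinfun_apply A (e x)) y = 0})" by (auto simp: K_def)
  moreover have "closed {y. cinner z y = 0}" for z :: 'h
    by (intro closed_Collect_eq cinner.continuous_on continuous_intros)
  ultimately have cl: "closed K" by auto
  have sub: "csubspace K" by (auto simp: csubspace_def K_def cinner_simps)
  have invM: "B y \<in> K" if "B \<in> M" "y \<in> K" for B y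
    unfolding K_def
  proof (clarify)
    fix A x assume "A \<in> M"
    then have "adj B o\<^sub>L A \<in> M" using that by simp
    then have "cinner ((adj B o\<^sub>L A) (e x)) y = 0" using that(2) unfolding K_def by blast
    then show "cinner (A (e x)) (B y) = 0" using that by (simp add: cinner_adj_left)
  qed
  have invC: "B y \<in> K" if B: "B \<in> commutant M" "y \<in> K" for B y
    unfolding K_def
  proof (clarify)
    fix A x assume A: "A \<in> M"
    have "cinner (A (e x)) (B y) = cinner (adj B (A (e x))) y"
      using B by (simp add: cinner_adj_left)
    also have "adj B (A (e x)) = A (e (adj B x))"
      using commutant_apply[OF C.in_adj[OF B(1)]] A eM by simp
    finally show "cinner (A (e x)) (B y) = 0" using A B(2) by (simp add: K_def)
  qed
  obtain p where p: "p \<in> M" "projection p" "\<And>x. p x \<in> K" "\<And>x. x \<in> K \<Longrightarrow> p x = x"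
    by (rule invariant_projection[OF cl sub invC]) auto
  have "p \<in> commutant M"
  proof (rule C.projection_in_algebra[OF p(2)])
    fix B x assume "B \<in> commutant (commutant M)"
    then have "B (p x) \<in> K" using invM p(3) by (simp add: bicommutant)
    then show "p (B (p x)) = B (p x)" by (rule p(4))
  qed
  then obtain c where c: "p = scale_op c id_blinfun"
    using p(1) assms(1) unfolding factor_def by blast
  obtain x0 where x0: "e x0 \<noteq> 0" using e0 by (metis blinfun_eqI zero_blinfun.rep_eq)
  have "e x0 \<notin> K"
  proof
    assume "e x0 \<in> K"
    then have "cinner (id_blinfun (e x0)) (e x0) = 0" unfolding K_def using in_id by blast
    then show False using x0 by simp
  qed
  have "c = 0"
  proof (rule ccontr)
    assume "c \<noteq> 0"
    then have "e x0 = p ((1/c) *\<^sub>C e x0)" by (simp add: c scaleC_scaleC)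
    then have "e x0 \<in> K" using p(3)[of "(1/c) *\<^sub>C e x0"] by simp
    then show False using \<open>e x0 \<notin> K\<close> by blast
  qed
  then have "y = 0" if "y \<in> K" for y using p(4)[OF that] by (simp add: c)
  then show ?thesis unfolding total_set_def K_def by blast
qed

text \<open>Type I is assumed for \<open>M\<close> only, but \<beta> needs an atom of the commutant.
  It is the projection onto the closure of \<open>M \<xi>\<close>, for a unit vector \<xi> in the
  range of \<open>e\<close>.\<close>

lemma atom_commutant:
  fixes M :: "'h::complex_hilbert op set"
  assumes "factor M" "atom M e"
  obtains f where "atom (commutant M) f"
proof -
  interpret vn_algebra M using assms(1) by (rule factor_vn)
  interpret C: vn_algebra "commutant M" using factor_vn[OF factor_commutant[OF assms(1)]] .
  have eM: "e \<in> M" and pe: "projection e" and e0: "e \<noteq> 0"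
    and ec: "\<And>A. A \<in> M \<Longrightarrow> \<exists>c. e o\<^sub>L A o\<^sub>L e = scale_op c e" using assms(2) by (auto simp: atom_def)
  obtain x0 where x0: "e x0 \<noteq> 0" using e0 by (metis blinfun_eqI zero_blinfun.rep_eq)
  define \<xi> where "\<xi> = (1 / norm (e x0)) *\<^sub>R e x0"
  have n\<xi>: "cinner \<xi> \<xi> = 1" using x0 by (simp add: cinner_self \<xi>_def)
  have e\<xi>: "e \<xi> = \<xi>" by (simp add: \<xi>_def blinfun.scaleR_right pe)
  define V where "V = (\<lambda>A. blinfun_apply A \<xi>) ` M"
  have subV: "csubspace V"
    unfolding csubspace_def
  proof (intro conjI ballI allI)
    show "0 \<in> V" unfolding V_def by (intro image_eqI[of _ _ 0]) auto
    show "x + y \<in> V" if xy: "x \<in> V" "y \<in> V" for x y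
    proof -
      obtain A B where "A \<in> M" "B \<in> M" "x = A \<xi>" "y = B \<xi>" using xy by (auto simp: V_def)
      then show ?thesis unfolding V_def by (intro image_eqI[of _ _ "A + B"]) (auto simp: blinfun.add_left)
    qed
    show "c *\<^sub>C x \<in> V" if x: "x \<in> V" for c x
    proof -
      obtain A where "A \<in> M" "x = A \<xi>" using x by (auto simp: V_def)
      then show ?thesis unfolding V_def by (intro image_eqI[of _ _ "scale_op c A"]) auto
    qed
  qed
  have inv: "B x \<in> closure V" if "B \<in> M" "x \<in> closure V" for B x
  proof (rule closure_invariant[OF _ that(2)])
    fix z assume "z \<in> V"
    then obtain A where "A \<in> M" "z = A \<xi>" by (auto simp: V_def)
    then show "B z \<in> V" unfolding V_def using that(1) by (intro image_eqI[of _ _ "B o\<^sub>L A"]) auto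
  qed
  obtain f where f: "f \<in> commutant M" "projection f" "\<And>x. f x \<in> closure V" "\<And>x. x \<in> closure V \<Longrightarrow> f x = x"
    using C.invariant_projection[of "closure V"] inv csubspace_closure[OF subV] unfolding bicommutant
    by (metis closed_closure)
  have "\<xi> \<in> V" unfolding V_def by (intro image_eqI[of _ _ id_blinfun]) auto
  then have f\<xi>: "f \<xi> = \<xi>" using f(4) closure_subset by blast
  then have f0: "f \<noteq> 0" using n\<xi> by (metis cinner.zero_left zero_blinfun.rep_eq zero_neq_one)
  have "\<exists>c. f o\<^sub>L B o\<^sub>L f = scale_op c f" if B: "B \<in> commutant M" for B
  proof -
    define c where "c = cinner (B \<xi>) \<xi>"
    have BB: "B \<in> BH" using B by (rule commutant_BH)
    \<comment> \<open>Since \<open>B\<close> commutes with \<open>adj C o\<^sub>L A\<close> and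
      \<xi> is fixed by \<open>e\<close>, only the scalar \<open>k\<close> of
      \<open>e (adj C) A e\<close> enters, and it enters both sides in the same way.\<close>
    have form: "cinner (B (A \<xi>)) (C \<xi>) = c * cinner (A \<xi>) (C \<xi>)" if AC: "A \<in> M" "C \<in> M" for A C
    proof -
      obtain k where k: "e o\<^sub>L (adj C o\<^sub>L A) o\<^sub>L e = scale_op k e" using ec[of "adj C o\<^sub>L A"] AC by auto
      have k\<xi>: "e (adj C (A \<xi>)) = k *\<^sub>C \<xi>" using blinfun_apply_cong[OF k, of \<xi>] by (simp add: e\<xi>)
      have Bk: "e (adj C (A (B \<xi>))) = k *\<^sub>C B \<xi>"
      proof -
        have "e (adj C (A (B \<xi>))) = B (e (adj C (A \<xi>)))"
          using commutant_apply[OF B] AC eM by simp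
        then show ?thesis by (simp add: k\<xi> BH_apply[OF BB])
      qed
      have "cinner (B (A \<xi>)) (C \<xi>) = cinner (adj C (A (B \<xi>))) \<xi>"
        using commutant_apply[OF B AC(1)] AC by (simp add: cinner_adj_left)
      also have "\<dots> = cinner (e (adj C (A (B \<xi>)))) \<xi>" by (simp add: projection_cinner pe e\<xi>)
      also have "\<dots> = k * c" by (simp add: Bk cinner_simps c_def)
      also have "k = cinner (e (adj C (A \<xi>))) \<xi>" by (simp add: k\<xi> cinner_simps n\<xi>)
      also have "\<dots> = cinner (A \<xi>) (C \<xi>)" using AC by (simp add: projection_cinner pe e\<xi> cinner_adj_left)
      finally show ?thesis by simp
    qed
    have perp: "f z = 0" if z: "\<And>v. v \<in> V \<Longrightarrow> cinner z v = 0" for z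
    proof -
      have "closure V \<subseteq> {v. cinner z v = 0}"
        by (rule closure_minimal) (use z in \<open>auto intro!: closed_Collect_eq cinner.continuous_on continuous_intros\<close>)
      then have "cinner z (f z) = 0" using f(3) by blast
      then have "cinner (f z) (f z) = 0" using f(2) by (simp add: projection_cinner)
      then show ?thesis by simp
    qed
    have "f (B (A \<xi>)) = c *\<^sub>C (A \<xi>)" if A: "A \<in> M" for A
    proof -
      have "f (B (A \<xi>) - c *\<^sub>C (A \<xi>)) = 0"
        by (rule perp) (auto simp: V_def form[OF A] cinner_simps)
      moreover have "A \<xi> \<in> closure V" using A closure_subset[of V] by (auto simp: V_def)
      then have "f (A \<xi>) = A \<xi>" by (rule f(4))
      ultimately show ?thesis using f(2) by (simp add: blinfun.diff_right BH_apply)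
    qed
    then have "closure V \<subseteq> {x. (f o\<^sub>L B) x = scale_op c id_blinfun x}"
      by (intro closure_minimal closed_eq_blinfun) (auto simp: V_def)
    then have "(f o\<^sub>L B) (f x) = scale_op c id_blinfun (f x)" for x using f(3) by blast
    then have "f o\<^sub>L B o\<^sub>L f = scale_op c f" by (intro blinfun_eqI) simp
    then show ?thesis by blast
  qed
  then have "atom (commutant M) f" using f f0 by (auto simp: atom_def)
  then show ?thesis using that by blast
qed

subsection \<open>Separability and approximate units\<close>

text \<open>A dense sequence of the ambient space need not meet \<open>Z\<close>. For every pair of
  a centre \<open>d n\<close> and a radius \<open>1 / Suc m\<close> a point of \<open>Z\<close> in
  that ball is selected if there is one, and any point of \<open>Z\<close> otherwise.\<close>

lemma separable_sequence:
  fixes Z :: "'a::metric_space set"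
  assumes sep: "separable_space (euclidean :: 'a topology)" and ne: "Z \<noteq> {}"
  obtains z :: "nat \<Rightarrow> 'a" where "\<And>n. z n \<in> Z" "Z \<subseteq> closure (range z)"
proof -
  obtain C :: "'a set" where C: "countable C" "closure C = UNIV"
    using sep by (auto simp: separable_space_def)
  then have "C \<noteq> {}" by auto
  define d where "d = from_nat_into C"
  have rd: "range d = C" using C(1) \<open>C \<noteq> {}\<close> by (simp add: d_def)
  define Q where "Q k z \<longleftrightarrow> z \<in> Z \<and>
    (let (n, m) = prod_decode k in (\<exists>w\<in>Z. dist w (d n) < 1 / Suc m) \<longrightarrow> dist z (d n) < 1 / Suc m)" for k z
  have "\<exists>z. Q k z" for k
  proof -
    obtain n m where "prod_decode k = (n, m)" by fastforce
    then show ?thesis using ne by (cases "\<exists>w\<in>Z. dist w (d n) < 1 / Suc m") (auto simp: Q_def)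
  qed
  then obtain z where z: "\<And>k. Q k (z k)" by metis
  have zZ: "z k \<in> Z" for k using z[of k] by (simp add: Q_def)
  have "x \<in> closure (range z)" if x: "x \<in> Z" for x
  proof (unfold closure_approachable, intro allI impI)
    fix \<epsilon> :: real assume "\<epsilon> > 0"
    then obtain m where m: "1 / Suc m < \<epsilon> / 2" using nat_approx_posE[of "\<epsilon> / 2"] by auto
    have "x \<in> closure (range d)" using C rd by auto
    then obtain n where n: "dist (d n) x < 1 / Suc m"
      unfolding closure_approachable by (metis divide_pos_pos of_nat_0_less_iff rangeE zero_less_Suc zero_less_one)
    then have "dist (z (prod_encode (n, m))) (d n) < 1 / Suc m"
      using z[of "prod_encode (n, m)"] x by (auto simp: Q_def dist_commute)
    then have "dist (z (prod_encode (n, m))) x < \<epsilon>"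
      using n m dist_triangle[of "z (prod_encode (n, m))" x "d n"] by linarith
    then show "\<exists>y\<in>range z. dist y x < \<epsilon>" by blast
  qed
  with zZ show ?thesis using that by blast
qed

lemma total_closure:
  assumes "total_set Z" "Z \<subseteq> closure S"
  shows "total_set S"
  unfolding total_set_def
proof (intro allI impI)
  fix y assume y: "\<forall>a\<in>S. cinner a y = 0"
  have "closure S \<subseteq> {x. cinner x y = 0}"
    by (rule closure_minimal) (use y in \<open>auto intro!: closed_Collect_eq cinner.continuous_on continuous_intros\<close>)
  then show "y = 0" using assms unfolding total_set_def by blast
qed

text \<open>The usual argument with three thirds. The filter is general because the lemma serves
  sequences of projections as well as the limit of a semigroup at 0 from the right.\<close>

lemma strong_limit_closed:
  fixes T :: "'a \<Rightarrow> 'h::complex_hilbert op"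
  assumes bd: "\<forall>\<^sub>F n in F. \<forall>x. norm (T n x) \<le> norm x"
    and f: "f \<longlonglongrightarrow> x" and lim: "\<And>k. ((\<lambda>n. T n (f k)) \<longlongrightarrow> f k) F"
  shows "((\<lambda>n. T n x) \<longlongrightarrow> x) F"
proof (rule tendstoI)
  fix r :: real assume r: "0 < r"
  obtain k where k: "dist (f k) x < r / 3" using metric_LIMSEQ_D[OF f, of "r / 3"] r by auto
  have "\<forall>\<^sub>F n in F. dist (T n (f k)) (f k) < r / 3" by (rule tendstoD[OF lim[of k]]) (use r in simp)
  with bd show "\<forall>\<^sub>F n in F. dist (T n x) x < r"
  proof eventually_elim
    case (elim n)
    have "dist (T n x) (T n (f k)) \<le> dist x (f k)"
      using elim(1)[rule_format, of "x - f k"] by (simp add: dist_norm blinfun.diff_right)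
    then show ?case
      using elim(2) k dist_triangle[of "T n x" x "T n (f k)"] dist_triangle[of "T n (f k)" x "f k"]
      by (simp add: dist_commute)
  qed
qed

text \<open>An inductive form, so that statements about \<open>\<alpha> t X\<close> can be proved
  one summand at a time. Orthogonality of the summands is supplied separately, by carrying the
  predicate \<open>projection\<close> along.\<close>

inductive_set atomic_sums :: "'h::complex_hilbert op set \<Rightarrow> 'h op \<Rightarrow> 'h op set" for M e where
  zero: "0 \<in> atomic_sums M e"
| step: "X \<in> atomic_sums M e \<Longrightarrow> v \<in> M \<Longrightarrow> v o\<^sub>L e = v \<Longrightarrow> X + (v o\<^sub>L adj v) \<in> atomic_sums M e"

lemma (in vn_algebra) atomic_sums_subset: "X \<in> atomic_sums M e \<Longrightarrow> X \<in> M"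
  by (induction rule: atomic_sums.induct) auto

lemma atom_nonzero:
  assumes "atom M e" obtains x where "e x \<noteq> 0"
  using assms by (metis atom_def blinfun_eqI zero_blinfun.rep_eq)

text \<open>\<open>W o\<^sub>L e = W\<close> puts \<open>adj W o\<^sub>L W\<close> into
  \<open>e M e\<close>, so it is a multiple of \<open>e\<close>; evaluation at a vector with
  \<open>e x\<close> nonzero shows that the scalar is a nonnegative real.\<close>

lemma atom_compress:
  assumes "vn_algebra M" "atom M e" "W \<in> M" "W o\<^sub>L e = W"
  obtains k where "0 \<le> k" "adj W o\<^sub>L W = k *\<^sub>R e"
proof -
  interpret vn_algebra M by fact
  have eM: "e \<in> M" and pe: "projection e" using assms(2) by (auto simp: atom_def)
  obtain c where "e o\<^sub>L (adj W o\<^sub>L W) o\<^sub>L e = scale_op c e"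
    using assms(2,3) unfolding atom_def by (metis in_adj in_compose)
  moreover have "e o\<^sub>L adj W = adj W"
    using arg_cong[OF assms(4), of adj] assms(3) eM pe by (simp add: adj_compose projection_adj)
  ultimately have c: "adj W o\<^sub>L W = scale_op c e"
    by (metis assms(4) compose_assoc)
  obtain x where x: "e x \<noteq> 0" using atom_nonzero[OF assms(2)] by blast
  have "cinner (adj W (W x)) x = of_real ((norm (W x))\<^sup>2)"
    using assms(3) by (simp add: cinner_adj_left cinner_self)
  moreover have "cinner (adj W (W x)) x = c * cinner (e x) x"
    using blinfun_apply_cong[OF c, of x] by (simp add: cinner_simps)
  moreover have "cinner (e x) x = of_real ((norm (e x))\<^sup>2)"
    using projection_cinner[OF pe, of "e x" x] pe by (simp add: cinner_self)
  ultimately have "c = of_real ((norm (W x))\<^sup>2 / (norm (e x))\<^sup>2)"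
    using x by (simp add: field_simps)
  then show ?thesis using that[of "(norm (W x))\<^sup>2 / (norm (e x))\<^sup>2"] c by (simp add: scaleR_eq_scale_op)
qed

text \<open>One Gram-Schmidt step: \<open>B\<close>, the part of \<open>A o\<^sub>L e\<close>
  outside the range of \<open>P\<close>, is by \<open>atom_compress\<close> a multiple of a partial
  isometry \<open>v\<close> with initial projection \<open>e\<close>, and the range projection of
  \<open>v\<close> is added to \<open>P\<close>.\<close>

lemma atomic_sums_extend:
  assumes "vn_algebra M" "atom M e" and P: "P \<in> atomic_sums M e" "projection P" and A: "A \<in> M"
  obtains Q where "Q \<in> atomic_sums M e" "projection Q" "Q o\<^sub>L P = P" "\<And>x. Q (A (e x)) = A (e x)"
proof -
  interpret vn_algebra M by fact
  have eM: "e \<in> M" and pe: "projection e" using assms(2) by (auto simp: atom_def)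
  have PM: "P \<in> M" using P(1) by (rule atomic_sums_subset)
  define B where "B = (A o\<^sub>L e) - (P o\<^sub>L (A o\<^sub>L e))"
  have BM: "B \<in> M" using A eM PM by (simp add: B_def)
  have Be: "B o\<^sub>L e = B" by (simp add: B_def compose_diff_left compose_assoc projection_idem pe)
  have PB: "P o\<^sub>L B = 0" by (rule blinfun_eqI) (simp add: B_def blinfun.diff_left blinfun.diff_right P)
  obtain k where k: "0 \<le> k" "adj B o\<^sub>L B = k *\<^sub>R e" using atom_compress[OF assms(1,2) BM Be] by blast
  show ?thesis
  proof (cases "k = 0")
    case True
    have "B x = 0" for x
    proof -
      have "cinner (B x) (B x) = cinner (adj B (B x)) x" using BM by (simp add: cinner_adj_left)
      also have "\<dots> = 0" using blinfun_apply_cong[OF k(2), of x] True by simp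
      finally show ?thesis by simp
    qed
    then have "P (A (e x)) = A (e x)" for x
      by (metis B_def blinfun.diff_left blinfun_apply_blinfun_compose eq_iff_diff_eq_0)
    then show ?thesis using that[of P] P by (simp add: projection_idem)
  next
    case False
    \<comment> \<open>The normalization that turns \<open>adj B o\<^sub>L B = k *\<^sub>R e\<close>
      into \<open>adj v o\<^sub>L v = e\<close>.\<close>
    define s where "s = 1 / sqrt k"
    have ss: "s * s * k = 1" using k(1) False by (simp add: s_def)
    define v where "v = s *\<^sub>R B"
    have vM: "v \<in> M" using BM by (simp add: v_def scaleR_eq_scale_op)
    have ve: "v o\<^sub>L e = v"
      using Be by (simp add: v_def scaleR_eq_scale_op scale_op_compose_left)
    have av: "adj v = s *\<^sub>R adj B" using BM by (simp add: v_def scaleR_eq_scale_op adj_scale)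
    have vx: "v x = s *\<^sub>R B x" and avx: "adj v x = s *\<^sub>R adj B x" for x
      by (simp_all add: v_def av[unfolded v_def] blinfun.scaleR_left)
    have BBx: "adj B (B x) = k *\<^sub>R e x" for x using blinfun_apply_cong[OF k(2), of x] by (simp add: blinfun.scaleR_left)
    have Bex: "B (e x) = B x" for x using blinfun_apply_cong[OF Be, of x] by simp
    have PBx: "P (B x) = 0" for x using blinfun_apply_cong[OF PB, of x] by simp
    have BPx: "adj B (P x) = 0" for x
    proof (rule cinner_ext)
      show "cinner (adj B (P x)) y = cinner 0 y" for y
        using BM P by (simp add: cinner_adj_left projection_cinner PBx)
    qed
    have vvx: "adj v (v x) = e x" for x using ss by (simp add: vx avx blinfun.scaleR_right BBx mult.assoc)
    define Q where "Q = P + (v o\<^sub>L adj v)"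
    have vev: "v (e x) = v x" for x using blinfun_apply_cong[OF ve, of x] by simp
    show ?thesis
    proof (rule that[of Q])
      show "Q \<in> atomic_sums M e" unfolding Q_def by (rule atomic_sums.step[OF P(1) vM ve])
      have Pv: "P (v x) = 0" and vP: "adj v (P x) = 0" for x
        by (simp_all add: vx avx blinfun.scaleR_right PBx BPx)
      have "adj Q = Q" using vM PM P by (simp add: Q_def adj_add adj_compose projection_adj)
      moreover have "Q o\<^sub>L Q = Q"
        by (rule blinfun_eqI) (simp add: Q_def blinfun.add_left blinfun.add_right P Pv vP vvx vev)
      moreover have "Q \<in> BH" using vM PM by (simp add: Q_def)
      ultimately show "projection Q" by (simp add: projection_def)
      show "Q o\<^sub>L P = P" by (rule blinfun_eqI) (simp add: Q_def blinfun.add_left P vP)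
      show "Q (A (e x)) = A (e x)" for x
      proof -
        have dec: "A (e x) = P (A (e x)) + B x" by (simp add: B_def blinfun.diff_left)
        have "v (adj v (B x)) = B x"
          using ss by (simp add: vx avx blinfun.scaleR_right BBx Bex mult_ac)
        moreover have "v (adj v (A (e x))) = v (adj v (B x))"
          by (subst dec) (simp add: blinfun.add_right vP)
        ultimately show ?thesis using dec by (simp add: Q_def blinfun.add_left)
      qed
    qed
  qed
qed

text \<open>Separability yields a total sequence of vectors \<open>A n (e (x n))\<close>. Absorbing
  them one after another makes \<open>P\<close> eventually constant on each of them, and
  contractivity extends the convergence to all vectors.\<close>

lemma atomic_approximate_unit:
  fixes M :: "'h::complex_hilbert op set"
  assumes sep: "separable_space (euclidean :: 'h topology)" and "factor M" "atom M e"
  obtains P where "\<And>n::nat. P n \<in> atomic_sums M e" "\<And>n x. norm (P n x) \<le> norm x"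
    "\<And>x. (\<lambda>n. P n x) \<longlonglongrightarrow> x"
proof -
  interpret vn_algebra M using assms(2) by (rule factor_vn)
  let ?Z = "{blinfun_apply A (e x) | A x. A \<in> M}"
  have "?Z \<noteq> {}" using in_id by blast
  then obtain z :: "nat \<Rightarrow> 'h" where z: "\<And>n. z n \<in> ?Z" "?Z \<subseteq> closure (range z)"
    by (rule separable_sequence[OF sep]) blast
  have tot: "total_set (range z)" using total_closure[OF factor_atom_total[OF assms(2,3)] z(2)] .
  have "\<exists>A x. A \<in> M \<and> z n = A (e x)" for n using z(1)[of n] by auto
  then obtain A x where Ax: "\<And>n. A n \<in> M" "\<And>n. z n = A n (e (x n))" by metis
  have "\<exists>P. \<forall>n. (P n \<in> atomic_sums M e \<and> projection (P n)) \<and>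
      (P (Suc n) o\<^sub>L P n = P n \<and> (\<forall>x. P (Suc n) (A n (e x)) = A n (e x)))"
  proof (rule dependent_nat_choice)
    show "\<exists>P. P \<in> atomic_sums M e \<and> projection P"
      by (rule exI[of _ 0]) (auto simp: projection_def intro: atomic_sums.zero)
    show "\<exists>Q. (Q \<in> atomic_sums M e \<and> projection Q) \<and>
      (Q o\<^sub>L P = P \<and> (\<forall>x. Q (A n (e x)) = A n (e x)))"
      if "P \<in> atomic_sums M e \<and> projection P" for P n
    proof -
      have "P \<in> atomic_sums M e" "projection P" using that by auto
      then obtain Q where "Q \<in> atomic_sums M e" "projection Q" "Q o\<^sub>L P = P"
        "\<And>x. Q (A n (e x)) = A n (e x)"
        by (rule atomic_sums_extend[OF factor_vn[OF assms(2)] assms(3) _ _ Ax(1)[of n]]) blast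
      then show ?thesis by blast
    qed
  qed
  then obtain P where P: "\<And>n. P n \<in> atomic_sums M e" "\<And>n. projection (P n)"
      "\<And>n. P (Suc n) o\<^sub>L P n = P n" "\<And>n x. P (Suc n) (A n (e x)) = A n (e x)" by metis
  have bd: "norm (P n y) \<le> norm y" for n y using P(2) by (rule projection_norm_le)
  have PP: "P (Suc n + k) (A n (e y)) = A n (e y)" for n k y
  proof (induction k)
    case (Suc k)
    have "P (Suc n + Suc k) (P (Suc n + k) (A n (e y))) = P (Suc n + k) (A n (e y))"
      using blinfun_apply_cong[OF P(3)[of "Suc n + k"]] by simp
    then show ?case using Suc by simp
  qed (simp add: P(4))
  have "(\<lambda>n. P n y) \<longlonglongrightarrow> y" for y using tot
  proof (induction y rule: total_induct)
    case (base a)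
    then obtain n where n: "a = A n (e (x n))" using Ax by auto
    have "\<forall>\<^sub>F m in sequentially. P m a = a"
      using PP[of n _ "x n"] eventually_ge_at_top[of "Suc n"]
      by (auto elim!: eventually_mono simp: n le_iff_add)
    then show ?case by (rule tendsto_eventually)
  next
    case (scale c x)
    have "P n \<in> BH" for n using P(2) by simp
    then show ?case using scaleC.tendsto[OF tendsto_const scale, of c] by (simp add: BH_apply)
  next
    case (limit f x)
    show ?case by (rule strong_limit_closed[OF always_eventually limit(2,1)]) (simp add: bd)
  qed (auto simp: blinfun.add_right intro: tendsto_add)
  then show ?thesis by (intro that[of P] P(1) bd)
qed

subsection \<open>Ultraweak convergence and normality\<close>

lemma topspace_ultraweak_top: "topspace (ultraweak_top :: 'h::complex_hilbert op topology) = BH"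
proof -
  have "BH \<in> {{T :: 'h op. T \<in> BH \<and> (\<Sum>n. cinner (T (\<xi> n)) (\<eta> n)) \<in> V} | \<xi> \<eta> V.
        summable (\<lambda>n::nat. (norm (\<xi> n))\<^sup>2) \<and> summable (\<lambda>n. (norm (\<eta> n))\<^sup>2) \<and> open V}"
    by (rule CollectI, rule exI[of _ "\<lambda>_. 0"], rule exI[of _ "\<lambda>_. 0"], rule exI[of _ UNIV]) auto
  then show ?thesis unfolding ultraweak_top_def topology_generated_by_topspace by blast
qed

lemma openin_ultraweak_coefficient:
  assumes "open V"
  shows "openin ultraweak_top {T :: 'h::complex_hilbert op. T \<in> BH \<and> cinner (T x) y \<in> V}"
proof -
  let ?\<xi> = "\<lambda>n::nat. if n = 0 then x else 0" and ?\<eta> = "\<lambda>n::nat. if n = 0 then y else 0"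
  have "(\<Sum>n. cinner (T (?\<xi> n)) (?\<eta> n)) = cinner (T x) y" for T :: "'h op"
    by (subst suminf_finite[of "{0}"]) auto
  moreover have "summable (\<lambda>n. (norm (?\<xi> n))\<^sup>2)" "summable (\<lambda>n. (norm (?\<eta> n))\<^sup>2)"
    by (rule summable_finite[of "{0}"]; simp)+
  ultimately show ?thesis unfolding ultraweak_top_def using assms
    by (intro topology_generated_by_Basis CollectI exI[of _ ?\<xi>] exI[of _ ?\<eta>] exI[of _ V]) simp
qed

lemma normal_coefficient:
  fixes M :: "'h::complex_hilbert op set"
  assumes "M \<subseteq> BH"
  shows "normal_functional M (\<lambda>A. cinner (A x) y)"
proof -
  have "openin (subtopology ultraweak_top M) {A \<in> topspace (subtopology ultraweak_top M). cinner (A x) y \<in> V}"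
    if "open V" for V
    unfolding openin_subtopology using openin_ultraweak_coefficient[OF that, of x y]
    by (intro exI conjI) (use assms in \<open>auto simp: topspace_ultraweak_top\<close>)
  then show ?thesis
    by (auto simp: normal_functional_def blinfun.add_left cinner_simps continuous_map_def)
qed

text \<open>For contractions, the series of coefficients is dominated by the summable series of
  squared norms, so limit and sum may be exchanged.\<close>

lemma ultraweak_tendsto_id:
  fixes T :: "nat \<Rightarrow> 'h::complex_hilbert op"
  assumes T: "\<And>n. T n \<in> BH" and bd: "\<And>n x. norm (T n x) \<le> norm x"
    and lim: "\<And>x. (\<lambda>n. T n x) \<longlonglongrightarrow> x"
  shows "limitin ultraweak_top T id_blinfun sequentially"
  unfolding limitin_def
proof (intro conjI allI impI)
  show "id_blinfun \<in> topspace ultraweak_top" by (simp add: topspace_ultraweak_top)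
  fix U :: "'h op set" assume "openin ultraweak_top U \<and> id_blinfun \<in> U"
  then have "generate_topology_on {{T :: 'h op. T \<in> BH \<and> (\<Sum>n. cinner (T (\<xi> n)) (\<eta> n)) \<in> V} | \<xi> \<eta> V.
        summable (\<lambda>n::nat. (norm (\<xi> n))\<^sup>2) \<and> summable (\<lambda>n. (norm (\<eta> n))\<^sup>2) \<and> open V} U"
      and "id_blinfun \<in> U"
    by (auto simp: ultraweak_top_def openin_topology_generated_by_iff)
  then show "\<forall>\<^sub>F n in sequentially. T n \<in> U"
  proof (induction rule: generate_topology_on.induct)
    case (Int a b)
    then show ?case by (auto intro: eventually_conj)
  next
    case (UN K)
    then obtain k where k: "k \<in> K" "id_blinfun \<in> k" by auto
    then have "\<forall>\<^sub>F n in sequentially. T n \<in> k" using UN by blast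
    then show ?case by (rule eventually_mono) (use k in blast)
  next
    case (Basis s)
    then obtain \<xi> \<eta> :: "nat \<Rightarrow> 'h" and V where s: "s = {T. T \<in> BH \<and> (\<Sum>n. cinner (T (\<xi> n)) (\<eta> n)) \<in> V}"
      "summable (\<lambda>n. (norm (\<xi> n))\<^sup>2)" "summable (\<lambda>n. (norm (\<eta> n))\<^sup>2)" "open V" by auto
    have "(\<lambda>n. \<Sum>k. cinner (T n (\<xi> k)) (\<eta> k)) \<longlonglongrightarrow> (\<Sum>k. cinner (\<xi> k) (\<eta> k))"
    proof (rule tannerys_theorem[THEN conjunct2, THEN conjunct2])
      show "(\<lambda>n. cinner (T n (\<xi> k)) (\<eta> k)) \<longlonglongrightarrow> cinner (\<xi> k) (\<eta> k)" for k
        by (intro cinner.tendsto lim tendsto_const)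
      show "\<forall>\<^sub>F (k, n) in sequentially \<times>\<^sub>F sequentially.
          norm (cinner (T n (\<xi> k)) (\<eta> k)) \<le> (norm (\<xi> k))\<^sup>2 + (norm (\<eta> k))\<^sup>2"
      proof (intro always_eventually allI, clarify)
        fix k n
        have "norm (cinner (T n (\<xi> k)) (\<eta> k)) \<le> norm (T n (\<xi> k)) * norm (\<eta> k)" by (rule norm_cinner_le)
        also have "\<dots> \<le> norm (\<xi> k) * norm (\<eta> k)" by (intro mult_right_mono bd) simp
        also have "\<dots> \<le> (norm (\<xi> k))\<^sup>2 + (norm (\<eta> k))\<^sup>2"
          using sum_squares_bound[of "norm (\<xi> k)" "norm (\<eta> k)"]
            mult_nonneg_nonneg[OF norm_ge_zero norm_ge_zero, of "\<xi> k" "\<eta> k"] by linarith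
        finally show "norm (cinner (T n (\<xi> k)) (\<eta> k)) \<le> (norm (\<xi> k))\<^sup>2 + (norm (\<eta> k))\<^sup>2" .
      qed
      show "summable (\<lambda>k. (norm (\<xi> k))\<^sup>2 + (norm (\<eta> k))\<^sup>2)" by (intro summable_add s)
    qed simp
    moreover have "(\<Sum>k. cinner (\<xi> k) (\<eta> k)) \<in> V" using Basis s by simp
    ultimately have "\<forall>\<^sub>F n in sequentially. (\<Sum>k. cinner (T n (\<xi> k)) (\<eta> k)) \<in> V"
      using topological_tendstoD[OF _ s(4)] by blast
    then show ?case by (simp add: s(1) T)
  qed auto
qed

lemma ultraweak_limit_coefficient:
  fixes T :: "nat \<Rightarrow> 'h::complex_hilbert op"
  assumes "limitin ultraweak_top T S sequentially"
  shows "(\<lambda>n. cinner (T n x) y) \<longlonglongrightarrow> cinner (S x) y"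
proof (rule topological_tendstoI)
  fix V assume V: "open V" "cinner (S x) y \<in> V"
  have "S \<in> BH" using limitin_topspace[OF assms] by (simp add: topspace_ultraweak_top)
  then have "S \<in> {T. T \<in> BH \<and> cinner (T x) y \<in> V}" using V(2) by simp
  then have "\<forall>\<^sub>F n in sequentially. T n \<in> {T. T \<in> BH \<and> cinner (T x) y \<in> V}"
    using assms openin_ultraweak_coefficient[OF V(1), of x y] unfolding limitin_def by blast
  then show "\<forall>\<^sub>F n in sequentially. cinner (T n x) y \<in> V" by (rule eventually_mono) simp
qed

text \<open>Expand the squared norm of \<open>f t - l\<close>; all three terms converge and the
  limits cancel.\<close>

lemma tendsto_of_weak_norm:
  fixes f :: "'a \<Rightarrow> 'h::complex_hilbert"
  assumes weak: "((\<lambda>t. cinner (f t) l) \<longlongrightarrow> cinner l l) F"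
    and norm: "((\<lambda>t. norm (f t)) \<longlongrightarrow> norm l) F"
  shows "(f \<longlongrightarrow> l) F"
proof -
  have "((\<lambda>t. (norm (f t))\<^sup>2 - 2 * Re (cinner (f t) l) + (norm l)\<^sup>2) \<longlongrightarrow>
      (norm l)\<^sup>2 - 2 * Re (cinner l l) + (norm l)\<^sup>2) F"
    by (intro tendsto_intros weak norm)
  moreover have "(norm (f t))\<^sup>2 - 2 * Re (cinner (f t) l) + (norm l)\<^sup>2 = (norm (f t - l))\<^sup>2" for t
    by (simp add: power2_norm_eq_inner inner_simps inner_commute flip: inner_eq_Re_cinner)
  moreover have "(norm l)\<^sup>2 - 2 * Re (cinner l l) + (norm l)\<^sup>2 = 0" by (simp add: cinner_self)
  ultimately have "((\<lambda>t. (norm (f t - l))\<^sup>2) \<longlongrightarrow> 0) F" by simp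
  then have "((\<lambda>t. sqrt ((norm (f t - l))\<^sup>2)) \<longlongrightarrow> sqrt 0) F" by (rule tendsto_real_sqrt)
  then show ?thesis by (simp add: tendsto_norm_zero_iff LIM_zero_iff)
qed

subsection \<open>Intertwiners of an \<open>E\<^sub>0\<close>-semigroup\<close>

lemma fibre_D:
  assumes "T \<in> fibre M \<alpha> t"
  shows "T \<in> M" "A \<in> M \<Longrightarrow> \<alpha> t A o\<^sub>L T = T o\<^sub>L A" "A \<in> M \<Longrightarrow> \<alpha> t A (T x) = T (A x)"
proof -
  show "T \<in> M" and c: "A \<in> M \<Longrightarrow> \<alpha> t A o\<^sub>L T = T o\<^sub>L A" using assms by (auto simp: fibre_def)
  show "\<alpha> t A (T x) = T (A x)" if "A \<in> M" using blinfun_apply_cong[OF c[OF that], of x] by simp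
qed

text \<open>A single algebra with its semigroup and a fixed atom, to be instantiated twice: for
  \<open>M\<close> with \<alpha> and for the commutant with \<beta>.\<close>

locale atomic_E0 = vn_algebra M for M :: "'h::complex_hilbert op set" +
  fixes e :: "'h op" and \<alpha> :: "real \<Rightarrow> 'h op \<Rightarrow> 'h op"
  assumes sep: "separable_space (euclidean :: 'h topology)"
    and factor: "factor M" and atom: "atom M e" and E0: "E0_semigroup M \<alpha>"
begin

lemma e_in [simp]: "e \<in> M" and e_proj [simp]: "projection e"
  using atom by (auto simp: atom_def)

lemma alpha_in [simp]: "0 \<le> t \<Longrightarrow> A \<in> M \<Longrightarrow> \<alpha> t A \<in> M"
  and alpha_add: "0 \<le> t \<Longrightarrow> A \<in> M \<Longrightarrow> B \<in> M \<Longrightarrow> \<alpha> t (A + B) = \<alpha> t A + \<alpha> t B"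
  and alpha_scale: "0 \<le> t \<Longrightarrow> A \<in> M \<Longrightarrow> \<alpha> t (scale_op c A) = scale_op c (\<alpha> t A)"
  and alpha_mult: "0 \<le> t \<Longrightarrow> A \<in> M \<Longrightarrow> B \<in> M \<Longrightarrow> \<alpha> t (A o\<^sub>L B) = \<alpha> t A o\<^sub>L \<alpha> t B"
  and alpha_adj: "0 \<le> t \<Longrightarrow> A \<in> M \<Longrightarrow> \<alpha> t (adj A) = adj (\<alpha> t A)"
  and alpha_id [simp]: "0 \<le> t \<Longrightarrow> \<alpha> t id_blinfun = id_blinfun"
  and alpha_0 [simp]: "A \<in> M \<Longrightarrow> \<alpha> 0 A = A"
  and alpha_plus: "0 \<le> s \<Longrightarrow> 0 \<le> t \<Longrightarrow> A \<in> M \<Longrightarrow> \<alpha> (s + t) A = \<alpha> s (\<alpha> t A)"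
  and alpha_normal: "0 \<le> t \<Longrightarrow> normal_map M (\<alpha> t)"
  using E0 by (auto simp: E0_semigroup_def star_endo_def clinear_on_def image_subset_iff)

lemma alpha_mult_apply: "0 \<le> t \<Longrightarrow> A \<in> M \<Longrightarrow> B \<in> M \<Longrightarrow> \<alpha> t A (\<alpha> t B x) = \<alpha> t (A o\<^sub>L B) x"
  by (simp add: alpha_mult)

lemma alpha_zero: "0 \<le> t \<Longrightarrow> \<alpha> t 0 = 0"
  using alpha_add[of t 0 0] by simp

lemma alpha_weakly_continuous: "A \<in> M \<Longrightarrow> continuous_on {0..} (\<lambda>t. cinner (\<alpha> t A x) y)"
  using E0 normal_coefficient[OF subset_BH] unfolding E0_semigroup_def by blast

text \<open>The squared norm of \<open>\<alpha> t A x\<close> is a coefficient of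
  \<open>\<alpha> t (adj A o\<^sub>L A)\<close>, hence continuous; combined with weak continuity
  this gives norm convergence.\<close>

lemma alpha_strongly_continuous:
  assumes A: "A \<in> M"
  shows "continuous_on {0..} (\<lambda>t. \<alpha> t A x)"
  unfolding continuous_on_def
proof
  fix s :: real assume s: "s \<in> {0..}"
  have w: "((\<lambda>t. cinner (\<alpha> t B x) y) \<longlongrightarrow> cinner (\<alpha> s B x) y) (at s within {0..})" if "B \<in> M" for B y
    using alpha_weakly_continuous[OF that, of x y] s by (auto simp: continuous_on_def)
  have n: "norm (\<alpha> t A x) = sqrt (Re (cinner (\<alpha> t (adj A o\<^sub>L A) x) x))" if "0 \<le> t" for t
    using that A by (simp add: alpha_mult alpha_adj cinner_adj_left cinner_self)
  have "((\<lambda>t. sqrt (Re (cinner (\<alpha> t (adj A o\<^sub>L A) x) x))) \<longlongrightarrow> sqrt (Re (cinner (\<alpha> s (adj A o\<^sub>L A) x) x)))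
      (at s within {0..})"
    by (intro tendsto_intros w) (use A in auto)
  then have "((\<lambda>t. norm (\<alpha> t A x)) \<longlongrightarrow> norm (\<alpha> s A x)) (at s within {0..})"
    using s by (subst n) (auto simp: n eventually_at_filter elim!: Lim_transform_eventually)
  then show "((\<lambda>t. \<alpha> t A x) \<longlongrightarrow> \<alpha> s A x) (at s within {0..})"
    using w[OF A, of "\<alpha> s A x"] by (rule tendsto_of_weak_norm[rotated])
qed

text \<open>This is where normality of \<open>\<alpha> t\<close> enters. One sequence
  \<open>P\<close> serves all \<open>t\<close>, as the limit of measurable functions of
  \<open>t\<close> will require.\<close>

lemma alpha_approximate_unit:
  obtains P where "\<And>n::nat. P n \<in> atomic_sums M e"
    "\<And>t x y. 0 \<le> t \<Longrightarrow> (\<lambda>n. cinner (\<alpha> t (P n) x) y) \<longlonglongrightarrow> cinner x y"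
proof -
  obtain P where P: "\<And>n::nat. P n \<in> atomic_sums M e" "\<And>n x. norm (P n x) \<le> norm x"
    "\<And>x. (\<lambda>n. P n x) \<longlonglongrightarrow> x"
    by (rule atomic_approximate_unit[OF sep factor atom]) blast
  have PM: "P n \<in> M" for n by (rule atomic_sums_subset[OF P(1)])
  have lim: "limitin (subtopology ultraweak_top M) P id_blinfun sequentially"
    using ultraweak_tendsto_id[of P] PM P(2,3) by (simp add: limitin_subtopology)
  have "(\<lambda>n. cinner (\<alpha> t (P n) x) y) \<longlonglongrightarrow> cinner x y" if t: "0 \<le> t" for t x y
  proof -
    have "limitin (subtopology ultraweak_top M) (\<alpha> t \<circ> P) (\<alpha> t id_blinfun) sequentially"
      by (rule continuous_map_limit[OF _ lim]) (use alpha_normal[OF t] in \<open>simp add: normal_map_def\<close>)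
    then have "limitin ultraweak_top (\<alpha> t \<circ> P) id_blinfun sequentially"
      using t by (simp add: limitin_subtopology)
    then show ?thesis using ultraweak_limit_coefficient[of "\<alpha> t \<circ> P" id_blinfun x y] by simp
  qed
  with P(1) show ?thesis using that by blast
qed

lemma atom_orbit_total: "total_set {blinfun_apply A (e x) | A x. A \<in> M}"
  by (rule factor_atom_total[OF factor atom])

text \<open>For \<open>v = v o\<^sub>L e\<close>, the vector
  \<open>\<alpha> t (v o\<^sub>L adj v) x\<close> has the form
  \<open>\<alpha> t (v o\<^sub>L e) w\<close>. So \<open>y\<close> is orthogonal to the ranges of
  all \<open>\<alpha> t (P n)\<close>, and these approximate 1 weakly.\<close>

lemma alpha_atom_orbit_total:
  assumes t: "0 \<le> t" and y: "\<And>A x. A \<in> M \<Longrightarrow> cinner (\<alpha> t (A o\<^sub>L e) x) y = 0"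
  shows "y = 0"
proof -
  obtain P where P: "\<And>n::nat. P n \<in> atomic_sums M e"
    "\<And>t x y. 0 \<le> t \<Longrightarrow> (\<lambda>n. cinner (\<alpha> t (P n) x) y) \<longlonglongrightarrow> cinner x y"
    by (rule alpha_approximate_unit) blast
  have z: "cinner (\<alpha> t X x) y = 0" if "X \<in> atomic_sums M e" for X x
    using that
  proof (induction rule: atomic_sums.induct)
    case (step X v)
    have "cinner (\<alpha> t (v o\<^sub>L adj v) x) y = 0"
      using y[OF step(2), of "\<alpha> t (adj v) x"] step(2,3) t by (simp add: alpha_mult)
    then show ?case
      using step t atomic_sums_subset[OF step(1)] by (simp add: alpha_add blinfun.add_left cinner_simps)
  qed (simp add: alpha_zero t)
  have "(\<lambda>n. 0) \<longlonglongrightarrow> cinner y y"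
    using P(2)[OF t, of y y] by (simp add: z[OF P(1)])
  then have "cinner y y = 0" using LIMSEQ_const_iff by metis
  then show ?thesis by simp
qed

text \<open>With \<open>W = \<alpha> t e o\<^sub>L B o\<^sub>L e\<close>, the prescription is
  \<open>A (e x)\<close> to \<open>\<alpha> t A (W x)\<close>, which visibly intertwines left
  multiplication by \<open>M\<close> with its image under \<open>\<alpha> t\<close>. It commutes
  with the commutant because all operators involved lie in \<open>M\<close>.\<close>

lemma intertwiner_exists:
  assumes t: "0 \<le> t" and B: "B \<in> M"
  obtains T where "T \<in> fibre M \<alpha> t" "\<And>A x. A \<in> M \<Longrightarrow> T (A (e x)) = \<alpha> t (A o\<^sub>L e) (B (e x))"
proof -
  define W where "W = \<alpha> t e o\<^sub>L B o\<^sub>L e"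
  have WM: "W \<in> M" and We: "W o\<^sub>L e = W"
    using t B by (auto simp: W_def compose_assoc projection_idem)
  obtain k where k: "0 \<le> k" "adj W o\<^sub>L W = k *\<^sub>R e"
    by (rule atom_compress[OF vn_algebra_axioms atom WM We]) blast
  have b: "\<alpha> t (A o\<^sub>L e) (B (e x)) = \<alpha> t A (W x)" if "A \<in> M" for A x
    using that t B by (simp add: W_def alpha_mult)
  have eW: "\<alpha> t e (W x) = W x" for x
    using t B by (simp add: W_def alpha_mult_apply projection_idem)
  define a :: "'h op \<times> 'h \<Rightarrow> 'h" where "a = (\<lambda>i. fst i (e (snd i)))"
  define b' :: "'h op \<times> 'h \<Rightarrow> 'h" where "b' = (\<lambda>i. \<alpha> t (fst i) (W (snd i)))"
  have tot: "total_set (a ` (M \<times> UNIV))"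
  proof -
    have "a ` (M \<times> UNIV) = {blinfun_apply A (e x) | A x. A \<in> M}" by (force simp: a_def)
    then show ?thesis using atom_orbit_total by simp
  qed
  \<comment> \<open>Both Gram matrices reduce to the scalar \<open>l\<close> of
    \<open>e (adj C) A e\<close>: on the right directly, on the left after applying
    \<open>\<alpha> t\<close>. What remains is
    \<open>adj W o\<^sub>L W = k *\<^sub>R e\<close>.\<close>
  have gram: "cinner (b' i) (b' j) = of_real k * cinner (a i) (a j)" if ij: "i \<in> M \<times> UNIV" "j \<in> M \<times> UNIV" for i j
  proof -
    obtain A x C y where i: "i = (A, x)" "A \<in> M" and j: "j = (C, y)" "C \<in> M" using ij by auto
    obtain l where l: "e o\<^sub>L (adj C o\<^sub>L A) o\<^sub>L e = scale_op l e"
      using atom i j unfolding atom_def by (metis in_adj in_compose)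
    have lx: "e (adj C (A (e z))) = l *\<^sub>C e z" for z using blinfun_apply_cong[OF l, of z] by simp
    have "cinner (a i) (a j) = cinner (adj C (A (e x))) (e y)"
      using i j by (simp add: a_def cinner_adj_left)
    also have "\<dots> = cinner (e (adj C (A (e x)))) y" by (simp add: projection_cinner)
    also have "\<dots> = l * cinner (e x) y" by (simp add: lx cinner_simps)
    finally have aij: "cinner (a i) (a j) = l * cinner (e x) y" .
    have ae: "adj (\<alpha> t e) = \<alpha> t e" using t alpha_adj[of t e] by (simp add: projection_adj)
    have "cinner (b' i) (b' j) = cinner (\<alpha> t (adj C o\<^sub>L A) (W x)) (\<alpha> t e (W y))"
      using i j t by (simp add: b'_def eW alpha_mult alpha_adj cinner_adj_left)
    also have "\<dots> = cinner (\<alpha> t e (\<alpha> t (adj C o\<^sub>L A) (\<alpha> t e (W x)))) (W y)"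
      using t cinner_adj[of "\<alpha> t e" "\<alpha> t (adj C o\<^sub>L A) (W x)" "W y"] by (simp add: ae eW)
    also have "\<alpha> t e (\<alpha> t (adj C o\<^sub>L A) (\<alpha> t e (W x))) = \<alpha> t (e o\<^sub>L (adj C o\<^sub>L A) o\<^sub>L e) (W x)"
      using i j t by (simp add: alpha_mult)
    also have "\<dots> = l *\<^sub>C W x" using t by (simp add: l alpha_scale eW)
    also have "cinner (l *\<^sub>C W x) (W y) = l * cinner (adj W (W x)) y"
      using WM by (simp add: cinner_simps cinner_adj_left)
    also have "adj W (W x) = k *\<^sub>R e x" using blinfun_apply_cong[OF k(2), of x] by (simp add: blinfun.scaleR_left)
    finally show ?thesis by (simp add: aij scaleR_eq_scaleC cinner_simps)
  qed
  obtain T where T: "T \<in> BH" "\<And>i. i \<in> M \<times> UNIV \<Longrightarrow> T (a i) = b' i"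
    by (rule gram_extension[OF tot k(1) gram]) auto
  have Ta: "T (A (e x)) = \<alpha> t A (W x)" if "A \<in> M" for A x
    using T(2)[of "(A, x)"] that by (simp add: a_def b'_def)
  have "T o\<^sub>L R = R o\<^sub>L T" if R: "R \<in> commutant M" for R
  proof (rule total_eqI[OF atom_orbit_total])
    fix z assume "z \<in> {blinfun_apply A (e x) | A x. A \<in> M}"
    then obtain A x where z: "z = blinfun_apply A (e x)" "A \<in> M" by auto
    have RA: "R (A' y) = A' (R y)" if "A' \<in> M" for A' y using commutant_apply[OF R that] .
    show "(T o\<^sub>L R) z = (R o\<^sub>L T) z" using z t WM by (simp add: RA Ta)
  qed (use T(1) commutant_BH[OF R] in auto)
  then have "T \<in> commutant (commutant M)" using T by (simp add: commutant_def)
  then have TM: "T \<in> M" by (simp add: bicommutant)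
  have "\<alpha> t A o\<^sub>L T = T o\<^sub>L A" if A: "A \<in> M" for A
  proof (rule total_eqI[OF atom_orbit_total])
    fix z assume "z \<in> {blinfun_apply A (e x) | A x. A \<in> M}"
    then obtain C x where z: "z = blinfun_apply C (e x)" "C \<in> M" by auto
    show "(\<alpha> t A o\<^sub>L T) z = (T o\<^sub>L A) z" 
      using z t A Ta[of C x] Ta[of "A o\<^sub>L C" x] by (simp add: alpha_mult)
  qed (use A T(1) t in auto)
  then have "T \<in> fibre M \<alpha> t" using TM by (simp add: fibre_def)
  then show ?thesis using that[of T] by (simp add: Ta b)
qed

text \<open>For fixed \<open>B\<close> this is a section of the product system. It is determined by
  its values on the total set of vectors \<open>A (e x)\<close>, where it is a continuous orbit of
  \<alpha>.\<close>

definition intertwiner :: "'h op \<Rightarrow> real \<Rightarrow> 'h op" where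
  "intertwiner B t = (SOME T. T \<in> fibre M \<alpha> t \<and>
     (\<forall>A\<in>M. \<forall>x. T (blinfun_apply A (e x)) = \<alpha> t (A o\<^sub>L e) (B (e x))))"

lemma
  assumes "0 \<le> t" "B \<in> M"
  shows intertwiner_fibre: "intertwiner B t \<in> fibre M \<alpha> t"
    and intertwiner_apply: "A \<in> M \<Longrightarrow> intertwiner B t (A (e x)) = \<alpha> t (A o\<^sub>L e) (B (e x))"
proof -
  have "\<exists>T. T \<in> fibre M \<alpha> t \<and> (\<forall>A\<in>M. \<forall>x. T (blinfun_apply A (e x)) = \<alpha> t (A o\<^sub>L e) (B (e x)))"
    by (rule intertwiner_exists[OF assms]) blast
  from someI_ex[OF this] show "intertwiner B t \<in> fibre M \<alpha> t"
    "A \<in> M \<Longrightarrow> intertwiner B t (A (e x)) = \<alpha> t (A o\<^sub>L e) (B (e x))"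
    by (auto simp: intertwiner_def)
qed

text \<open>The vector \<open>\<alpha> t (A o\<^sub>L e) (B (e x))\<close> lies in the range of an
  intertwiner. As the vectors \<open>B (e x)\<close> are total, orthogonality to all these ranges
  gives orthogonality to the range of \<open>\<alpha> t (A o\<^sub>L e)\<close>.\<close>

lemma fibre_total:
  assumes t: "0 \<le> t"
  shows "total_set {blinfun_apply T x | T x. T \<in> fibre M \<alpha> t}"
  unfolding total_set_def
proof (intro allI impI)
  fix y assume y: "\<forall>a\<in>{blinfun_apply T x | T x. T \<in> fibre M \<alpha> t}. cinner a y = 0"
  show "y = 0"
  proof (rule alpha_atom_orbit_total[OF t])
    fix A x assume A: "A \<in> M"
    have "cinner (\<alpha> t (A o\<^sub>L e) z) y = 0" if z: "z \<in> {blinfun_apply B (e x) | B x. B \<in> M}" for z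
    proof -
      obtain B x where B: "B \<in> M" "z = B (e x)" using z by auto
      then have "\<alpha> t (A o\<^sub>L e) z = intertwiner B t (A (e x))"
        using A t by (simp add: intertwiner_apply)
      then show ?thesis using y intertwiner_fibre[OF t B(1)] by blast
    qed
    then have "cinner z (adj (\<alpha> t (A o\<^sub>L e)) y) = 0" if "z \<in> {blinfun_apply B (e x) | B x. B \<in> M}" for z
      using that t A by (simp add: cinner_adj[symmetric])
    then have "adj (\<alpha> t (A o\<^sub>L e)) y = 0" using atom_orbit_total unfolding total_set_def by blast
    then show "cinner (\<alpha> t (A o\<^sub>L e) x) y = 0" using t A by (simp add: cinner_adj)
  qed
qed

lemma fibre_eqI:
  assumes "0 \<le> t" "R \<in> BH" "S \<in> BH" "\<And>T. T \<in> fibre M \<alpha> t \<Longrightarrow> R o\<^sub>L T = S o\<^sub>L T"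
  shows "R = S"
proof (rule total_eqI[OF fibre_total[OF assms(1)] assms(2,3)])
  fix z assume "z \<in> {blinfun_apply T x | T x. T \<in> fibre M \<alpha> t}"
  then obtain T x where "z = blinfun_apply T x" "T \<in> fibre M \<alpha> t" by blast
  then show "R z = S z" using blinfun_apply_cong[OF assms(4), of T x] by simp
qed

lemma fibre_compose:
  assumes "0 \<le> s" "0 \<le> t" and S: "S \<in> fibre M \<alpha> s" and T: "T \<in> fibre M \<alpha> t"
  shows "S o\<^sub>L T \<in> fibre M \<alpha> (s + t)"
proof -
  have "\<alpha> (s + t) A o\<^sub>L (S o\<^sub>L T) = (S o\<^sub>L T) o\<^sub>L A" if A: "A \<in> M" for A
    by (rule blinfun_eqI) (simp add: assms A alpha_plus fibre_D(3)[OF S] fibre_D(3)[OF T])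
  then show ?thesis using fibre_D(1)[OF S] fibre_D(1)[OF T] by (simp add: fibre_def)
qed

text \<open>\<open>adj T o\<^sub>L S\<close> lies in \<open>M\<close> and, by the intertwining
  relations, commutes with \<open>M\<close>, so it is scalar in a factor. This makes the description
  in \<open>fibre_inner\<close> well defined.\<close>

lemma fibre_gram:
  assumes t: "0 \<le> t" and S: "S \<in> fibre M \<alpha> t" and T: "T \<in> fibre M \<alpha> t"
  shows "adj T o\<^sub>L S = scale_op (fibre_inner S T) id_blinfun"
proof -
  note SM = fibre_D(1)[OF S] and TM = fibre_D(1)[OF T]
  have "adj T (S (A x)) = A (adj T (S x))" if A: "A \<in> M" for A x
  proof (rule cinner_ext)
    fix y
    have "cinner (adj T (S (A x))) y = cinner (\<alpha> t A (S x)) (T y)"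
      using TM by (simp add: cinner_adj_left fibre_D(3)[OF S A])
    also have "\<dots> = cinner (S x) (\<alpha> t (adj A) (T y))"
      using t A by (simp add: cinner_adj alpha_adj)
    also have "\<dots> = cinner (A (adj T (S x))) y"
      using A TM fibre_D(3)[OF T in_adj[OF A], of y] by (simp add: cinner_adj cinner_adj_left)
    finally show "cinner (adj T (S (A x))) y = cinner (A (adj T (S x))) y" .
  qed
  then have "adj T o\<^sub>L S \<in> commutant M" using SM TM by (auto simp: commutant_def intro!: blinfun_eqI)
  then obtain c where c: "adj T o\<^sub>L S = scale_op c id_blinfun"
    using factor SM TM unfolding factor_def by (metis IntI imageE in_adj in_compose)
  \<comment> \<open>Uniqueness of the scalar needs a nonzero vector in the space.\<close>
  obtain x where x: "e x \<noteq> 0" by (rule atom_nonzero[OF atom]) blast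
  have "fibre_inner S T = c"
    unfolding fibre_inner_def
  proof (rule the_equality)
    fix c' assume "adj T o\<^sub>L S = scale_op c' id_blinfun"
    then have "scale_op (c' - c) id_blinfun (e x) = 0"
      using c by (simp add: scaleC.diff_left) (metis blinfun_apply_id_blinfun scale_op_apply)
    then have "cmod (c' - c) * norm (e x) = 0" by (simp add: norm_scaleC[symmetric])
    then show "c' = c" using x by simp
  qed (rule c)
  then show ?thesis using c by simp
qed

lemma fibre_gram_cinner:
  assumes "0 \<le> t" "S \<in> fibre M \<alpha> t" "T \<in> fibre M \<alpha> t"
  shows "cinner (S x) (T y) = fibre_inner S T * cinner x y"
proof -
  have "cinner (adj T (S x)) y = fibre_inner S T * cinner x y"
    using blinfun_apply_cong[OF fibre_gram[OF assms], of x] by (simp add: cinner_simps)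
  then show ?thesis using fibre_D(1)[OF assms(3)] by (simp add: cinner_adj_left)
qed

end

subsection \<open>The Borel structure\<close>

lemma openin_weak_op_subset: "openin (weak_op_top :: 'h::complex_hilbert op topology) V \<Longrightarrow> V \<subseteq> BH"
proof -
  assume "openin (weak_op_top :: 'h op topology) V"
  then have "V \<subseteq> topspace weak_op_top" by (rule openin_subset)
  also have "\<dots> \<subseteq> BH" unfolding weak_op_top_def topology_generated_by_topspace by auto
  finally show ?thesis .
qed

lemma space_op_borel [simp]: "space (op_borel :: 'h::complex_hilbert op measure) = BH"
  unfolding op_borel_def by (rule space_measure_of) (use openin_weak_op_subset in auto)

lemma coefficient_measurable:
  "(\<lambda>T :: 'h::complex_hilbert op. cinner (T x) y) \<in> borel_measurable op_borel"
proof (rule borel_measurableI)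
  fix V :: "complex set" assume "open V"
  then have "{T :: 'h op. T \<in> BH \<and> cinner (T x) y \<in> V} \<in> {V. openin weak_op_top V}"
    unfolding weak_op_top_def by (auto intro!: topology_generated_by_Basis)
  then have "{T :: 'h op. T \<in> BH \<and> cinner (T x) y \<in> V} \<in> sets op_borel"
    unfolding op_borel_def by (rule in_measure_of[rotated]) (use openin_weak_op_subset in auto)
  also have "{T :: 'h op. T \<in> BH \<and> cinner (T x) y \<in> V} = (\<lambda>T :: 'h op. cinner (T x) y) -` V \<inter> space op_borel"
    by auto
  finally show "(\<lambda>T :: 'h op. cinner (T x) y) -` V \<inter> space op_borel \<in> sets op_borel" .
qed

text \<open>Weakly open sets are arbitrary unions of basic ones, so countably many coefficients generate the
  Borel structure only because the balls are second countable.\<close>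

lemma weak_open_on_ball:
  fixes d :: "nat \<Rightarrow> 'h::complex_hilbert"
  assumes d: "closure (range d) = UNIV" and V: "openin weak_op_top V"
  shows "\<exists>G. open G \<and> (\<forall>T\<in>BH. norm T \<le> r \<longrightarrow> (T \<in> V \<longleftrightarrow> (\<lambda>i. cinner (T (d (fst i))) (d (snd i))) \<in> G))"
proof -
  let ?\<Phi> = "\<lambda>(T::'h op) i. cinner (T (d (fst i))) (d (snd i))"
  have "generate_topology_on {{T :: 'h op. T \<in> BH \<and> cinner (T x) y \<in> V} | x y V. open V} V"
    using V by (simp add: weak_op_top_def openin_topology_generated_by_iff)
  then show ?thesis
  proof (induction rule: generate_topology_on.induct)
    case Empty
    show ?case by (rule exI[of _ "{}"]) auto
  next
    case (Int a b)
    obtain G where "open G" "\<forall>T\<in>BH. norm T \<le> r \<longrightarrow> (T \<in> a \<longleftrightarrow> ?\<Phi> T \<in> G)"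
      using Int.IH(1) by blast
    moreover obtain G' where "open G'" "\<forall>T\<in>BH. norm T \<le> r \<longrightarrow> (T \<in> b \<longleftrightarrow> ?\<Phi> T \<in> G')"
      using Int.IH(2) by blast
    ultimately show ?case by (intro exI[of _ "G \<inter> G'"]) auto
  next
    case (UN K)
    have "\<forall>k. \<exists>G. k \<in> K \<longrightarrow> open G \<and> (\<forall>T\<in>BH. norm T \<le> r \<longrightarrow> (T \<in> k \<longleftrightarrow> ?\<Phi> T \<in> G))"
      using UN.IH by blast
    then obtain G where G: "\<And>k. k \<in> K \<Longrightarrow> open (G k)"
      "\<And>k. k \<in> K \<Longrightarrow> \<forall>T\<in>BH. norm T \<le> r \<longrightarrow> (T \<in> k \<longleftrightarrow> ?\<Phi> T \<in> G k)"
      unfolding choice_iff by auto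
    then show ?case by (intro exI[of _ "\<Union>k\<in>K. G k"]) auto
  next
    case (Basis s)
    then obtain x y W where s: "s = {T. T \<in> BH \<and> cinner (T x) y \<in> W}" and W: "open W" by auto
    define r' where "r' = max r 0"
    have nb: "norm T \<le> r'" if "norm T \<le> r" for T :: "'h op" using that by (simp add: r'_def)
    have r'0: "0 \<le> r'" by (simp add: r'_def)
    have approx: "\<exists>i. \<forall>T\<in>BH. norm T \<le> r \<longrightarrow> dist (?\<Phi> T i) (cinner (T x) y) < \<epsilon>" if e: "\<epsilon> > 0" for \<epsilon>
    proof -
      \<comment> \<open>The bound 1 keeps \<open>norm (d m)\<close> below \<open>norm x + 1\<close>;
        the quotient absorbs the two error terms of the bilinear form, uniformly over the
        ball.\<close>
      define \<delta> where "\<delta> = min 1 (\<epsilon> / (2 * (r' + 1) * (norm x + norm y + 1)))"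
      have pos: "2 * (r' + 1) * (norm x + norm y + 1) > 0"
        using r'0 by (intro mult_pos_pos add_nonneg_pos) auto
      have \<delta>: "\<delta> > 0" using e pos by (simp add: \<delta>_def)
      have "\<exists>n. dist (d n) z < \<delta>" for z
        using d \<delta> closure_approachable[of z "range d"] by auto
      then obtain m n where m: "dist (d m) x < \<delta>" and n: "dist (d n) y < \<delta>" by metis
      have "dist (?\<Phi> T (m, n)) (cinner (T x) y) < \<epsilon>" if T: "norm T \<le> r" for T
      proof -
        have dm: "norm (d m) \<le> norm x + 1"
          using m norm_triangle_sub[of "d m" x] by (simp add: dist_norm \<delta>_def)
        have "cinner (T (d m)) (d n) - cinner (T x) y = cinner (T (d m - x)) y + cinner (T (d m)) (d n - y)"
          by (simp add: cinner_simps blinfun.diff_right)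
        then have "dist (?\<Phi> T (m, n)) (cinner (T x) y) \<le>
            cmod (cinner (T (d m - x)) y) + cmod (cinner (T (d m)) (d n - y))"
          by (simp add: dist_norm norm_triangle_ineq)
        also have "\<dots> \<le> (r' * \<delta>) * norm y + (r' * (norm x + 1)) * \<delta>"
        proof (rule add_mono)
          have "norm (T (d m - x)) \<le> r' * \<delta>"
            using norm_blinfun[of T "d m - x"] mult_mono[OF nb[OF T], of "norm (d m - x)" \<delta>] m r'0
            by (simp add: dist_norm)
          then show "cmod (cinner (T (d m - x)) y) \<le> (r' * \<delta>) * norm y"
            using norm_cinner_le[of "T (d m - x)" y] mult_right_mono[of _ _ "norm y"] by (meson norm_ge_zero order_trans)
          have "norm (T (d m)) \<le> r' * (norm x + 1)"
            using norm_blinfun[of T "d m"] mult_mono[OF nb[OF T] dm r'0] by simp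
          then show "cmod (cinner (T (d m)) (d n - y)) \<le> (r' * (norm x + 1)) * \<delta>"
            using norm_cinner_le[of "T (d m)" "d n - y"] n mult_mono[of "norm (T (d m))" "r' * (norm x + 1)" "norm (d n - y)" \<delta>] r'0
            by (simp add: dist_norm)
        qed
        also have "\<dots> = \<delta> * (r' * (norm x + norm y + 1))" by (simp add: algebra_simps)
        also have "\<dots> \<le> \<epsilon> / (2 * (r' + 1) * (norm x + norm y + 1)) * (r' * (norm x + norm y + 1))"
          using r'0 by (intro mult_right_mono) (auto simp: \<delta>_def)
        also have "\<dots> < \<epsilon>"
        proof -
          have "r' * (norm x + norm y + 1) < 2 * (r' + 1) * (norm x + norm y + 1)"
            using r'0 by (intro mult_strict_right_mono) (auto intro: add_nonneg_pos)
          from mult_strict_left_mono[OF this e] show ?thesis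
            by (simp only: times_divide_eq_left pos_divide_less_eq[OF pos])
        qed
        finally show ?thesis .
      qed
      then show ?thesis by blast
    qed
    \<comment> \<open>The union of all cylinders over a single dense pair \<open>i\<close> which,
      within the ball, force the coefficient at \<open>x\<close>, \<open>y\<close> into
      \<open>W\<close>. One inclusion holds by construction, the other by approximation.\<close>
    define G where "G = \<Union>{(\<lambda>f. f i) -` ball w \<epsilon> | i w \<epsilon>.
      \<epsilon> > 0 \<and> (\<forall>T\<in>BH. norm T \<le> r \<longrightarrow> dist (?\<Phi> T i) w < \<epsilon> \<longrightarrow> cinner (T x) y \<in> W)}"
    have "open G" unfolding G_def
      by (intro open_Union) (auto intro!: open_vimage continuous_on_product_coordinates)
    moreover have "T \<in> s \<longleftrightarrow> ?\<Phi> T \<in> G" if T: "T \<in> BH" "norm T \<le> r" for T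
    proof
      assume "?\<Phi> T \<in> G"
      then show "T \<in> s" using T by (auto simp: G_def s dist_commute)
    next
      assume "T \<in> s"
      then have "cinner (T x) y \<in> W" by (simp add: s)
      then obtain \<epsilon> where e: "\<epsilon> > 0" "ball (cinner (T x) y) \<epsilon> \<subseteq> W" using W open_contains_ball by blast
      obtain i where i: "\<And>S. S \<in> BH \<Longrightarrow> norm S \<le> r \<Longrightarrow> dist (?\<Phi> S i) (cinner (S x) y) < \<epsilon> / 3"
        using approx[of "\<epsilon> / 3"] e(1) by (meson divide_pos_pos zero_less_numeral)
      have "cinner (S x) y \<in> W" if S: "S \<in> BH" "norm S \<le> r" "dist (?\<Phi> S i) (?\<Phi> T i) < \<epsilon> / 3" for S
      proof -
        have "dist (cinner (T x) y) (cinner (S x) y) < \<epsilon>"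
          using i[OF T] i[OF S(1,2)] S(3) dist_triangle[of "cinner (T x) y" "cinner (S x) y" "?\<Phi> T i"]
            dist_triangle[of "?\<Phi> T i" "cinner (S x) y" "?\<Phi> S i"]
          by (simp add: dist_commute)
        then show ?thesis using e(2) by auto
      qed
      then show "?\<Phi> T \<in> G" unfolding G_def using e(1)
        by (intro UnionI[of "(\<lambda>f. f i) -` ball (?\<Phi> T i) (\<epsilon> / 3)"] CollectI exI[of _ i] exI[of _ "?\<Phi> T i"] exI[of _ "\<epsilon> / 3"]) auto
    qed
    ultimately show ?case by blast
  qed
qed

text \<open>Expresses a norm ball by countably many inequalities between coefficients, which makes
  the set of points mapped into it measurable.\<close>

lemma norm_le_iff_dense:
  fixes d :: "nat \<Rightarrow> 'h::complex_hilbert" and T :: "'h op"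
  assumes d: "closure (range d) = UNIV" and r: "0 \<le> r"
  shows "norm T \<le> r \<longleftrightarrow> (\<forall>m n. cmod (cinner (T (d m)) (d n)) \<le> r * norm (d m) * norm (d n))"
proof
  assume T: "norm T \<le> r"
  show "\<forall>m n. cmod (cinner (T (d m)) (d n)) \<le> r * norm (d m) * norm (d n)"
  proof (intro allI)
    fix m n
    have "cmod (cinner (T (d m)) (d n)) \<le> norm (T (d m)) * norm (d n)" by (rule norm_cinner_le)
    also have "\<dots> \<le> (r * norm (d m)) * norm (d n)"
      using norm_blinfun[of T "d m"] mult_right_mono[OF T, of "norm (d m)"]
      by (intro mult_right_mono) auto
    finally show "cmod (cinner (T (d m)) (d n)) \<le> r * norm (d m) * norm (d n)" .
  qed
next
  assume a: "\<forall>m n. cmod (cinner (T (d m)) (d n)) \<le> r * norm (d m) * norm (d n)"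
  have b: "cmod (cinner (T (d m)) y) \<le> r * norm (d m) * norm y" for m y
  proof -
    have "closure (range d) \<subseteq> {y. cmod (cinner (T (d m)) y) \<le> r * norm (d m) * norm y}"
      by (rule closure_minimal)
        (use a in \<open>auto intro!: closed_Collect_le cinner.continuous_on continuous_intros\<close>)
    then show ?thesis using d by auto
  qed
  have "cmod (cinner (T x) y) \<le> r * norm x * norm y" for x y
  proof -
    have "closure (range d) \<subseteq> {x. cmod (cinner (T x) y) \<le> r * norm x * norm y}"
      by (rule closure_minimal)
        (use b in \<open>auto intro!: closed_Collect_le cinner.continuous_on continuous_intros\<close>)
    then show ?thesis using d by auto
  qed
  then have "norm (T x) \<le> r * norm x" for x using r by (intro norm_le_of_cinner) auto
  then show "norm T \<le> r" using r by (intro norm_blinfun_bound) auto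
qed

text \<open>The balls of integer radius exhaust the operators, and on each of them a weakly open set
  is the preimage of an open set under the countable family of coefficients at a dense
  sequence.\<close>

lemma measurable_op_borelI:
  fixes f :: "'w \<Rightarrow> 'h::complex_hilbert op"
  assumes sep: "separable_space (euclidean :: 'h topology)"
    and f: "\<And>\<omega>. \<omega> \<in> space N \<Longrightarrow> f \<omega> \<in> BH"
    and m: "\<And>x y. (\<lambda>\<omega>. cinner (f \<omega> x) y) \<in> borel_measurable N"
  shows "f \<in> measurable N op_borel"
proof -
  obtain d :: "nat \<Rightarrow> 'h" where "UNIV \<subseteq> closure (range d)"
    by (rule separable_sequence[OF sep, of UNIV]) auto
  then have d: "closure (range d) = UNIV" by auto
  let ?\<Phi> = "\<lambda>(T::'h op) i. cinner (T (d (fst i))) (d (snd i))"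
  have mball: "{\<omega> \<in> space N. norm (f \<omega>) \<le> real k} \<in> sets N" for k
    unfolding norm_le_iff_dense[OF d of_nat_0_le_iff] using m by measurable
  have m\<Phi>: "(\<lambda>\<omega>. ?\<Phi> (f \<omega>)) \<in> borel_measurable N"
    by (rule measurable_coordinatewise_then_product) (rule m)
  show ?thesis
    unfolding op_borel_def
  proof (rule measurable_measure_of)
    show "{V. openin weak_op_top V} \<subseteq> Pow BH" using openin_weak_op_subset by auto
    show "f \<in> space N \<rightarrow> BH" using f by auto
    fix V :: "'h op set" assume "V \<in> {V. openin weak_op_top V}"
    then have "\<exists>G. open G \<and> (\<forall>T\<in>BH. norm T \<le> real k \<longrightarrow> (T \<in> V \<longleftrightarrow> ?\<Phi> T \<in> G))" for k
      using weak_open_on_ball[OF d] by auto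
    then obtain G where G: "\<And>k. open (G k)"
        "\<And>k T. T \<in> BH \<Longrightarrow> norm T \<le> real k \<Longrightarrow> (T \<in> V \<longleftrightarrow> ?\<Phi> T \<in> G k)" by metis
    have "f -` V \<inter> space N = (\<Union>k. {\<omega> \<in> space N. norm (f \<omega>) \<le> real k} \<inter> ((\<lambda>\<omega>. ?\<Phi> (f \<omega>)) -` G k \<inter> space N))"
      (is "_ = ?R")
    proof (rule set_eqI)
      fix \<omega>
      obtain k where k: "norm (f \<omega>) \<le> real k" using real_arch_simple by blast
      show "\<omega> \<in> f -` V \<inter> space N \<longleftrightarrow> \<omega> \<in> ?R"
        using k G(2)[OF f] by auto
    qed
    also have "\<dots> \<in> sets N"
      using mball measurable_sets[OF m\<Phi> borel_open[OF G(1)]] by (intro sets.countable_UN) auto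
    finally show "f -` V \<inter> space N \<in> sets N" .
  qed
qed

text \<open>Measurable in one variable and continuous in the other gives measurability after
  substitution. It is needed when the vector inserted into a measurable family of operators itself
  moves with \<open>t\<close>.\<close>

lemma caratheodory_measurable:
  fixes h :: "'w \<Rightarrow> 'a::metric_space \<Rightarrow> complex" and g :: "real \<Rightarrow> 'a"
  assumes t: "\<tau> \<in> borel_measurable N" "\<And>\<omega>. \<omega> \<in> space N \<Longrightarrow> 0 < \<tau> \<omega>"
    and g: "continuous_on {0<..} g"
    and h: "\<And>w. (\<lambda>\<omega>. h \<omega> w) \<in> borel_measurable N" "\<And>\<omega>. \<omega> \<in> space N \<Longrightarrow> continuous_on UNIV (h \<omega>)"
  shows "(\<lambda>\<omega>. h \<omega> (g (\<tau> \<omega>))) \<in> borel_measurable N"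
proof (rule borel_measurable_LIMSEQ_metric)
  \<comment> \<open>Step functions approximating from above: the summand 1 keeps them strictly above
    \<open>\<tau> \<omega>\<close>, hence inside the domain where \<open>g\<close> is
    continuous.\<close>
  define s where "s n u = (real_of_int \<lfloor>real (Suc n) * u\<rfloor> + 1) / real (Suc n)" for n u
  show "(\<lambda>\<omega>. h \<omega> (g (s n (\<tau> \<omega>)))) \<in> borel_measurable N" for n
    unfolding s_def
    by (rule measurable_compose_countable[where f="\<lambda>i \<omega>. h \<omega> (g ((real_of_int i + 1) / real (Suc n)))"
        and g="\<lambda>\<omega>. \<lfloor>real (Suc n) * \<tau> \<omega>\<rfloor>"]) (use t h in measurable)
  fix \<omega> assume \<omega>: "\<omega> \<in> space N"
  have b: "\<tau> \<omega> < s n (\<tau> \<omega>) \<and> s n (\<tau> \<omega>) \<le> \<tau> \<omega> + 1 / real (Suc n)" for n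
  proof -
    have "real (Suc n) * \<tau> \<omega> < real_of_int \<lfloor>real (Suc n) * \<tau> \<omega>\<rfloor> + 1"
      "real_of_int \<lfloor>real (Suc n) * \<tau> \<omega>\<rfloor> \<le> real (Suc n) * \<tau> \<omega>" by linarith+
    then show ?thesis unfolding s_def by (auto simp: field_simps simp del: of_nat_Suc)
  qed
  have "(\<lambda>n. s n (\<tau> \<omega>)) \<longlonglongrightarrow> \<tau> \<omega>"
  proof (rule tendsto_sandwich)
    show "\<forall>\<^sub>F n in sequentially. \<tau> \<omega> \<le> s n (\<tau> \<omega>)"
      by (intro always_eventually allI less_imp_le conjunct1[OF b])
    show "\<forall>\<^sub>F n in sequentially. s n (\<tau> \<omega>) \<le> \<tau> \<omega> + 1 / real (Suc n)"
      by (intro always_eventually allI conjunct2[OF b])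
    show "(\<lambda>n. \<tau> \<omega> + 1 / real (Suc n)) \<longlonglongrightarrow> \<tau> \<omega>"
      using tendsto_add[OF tendsto_const LIMSEQ_Suc[OF lim_1_over_n], of "\<tau> \<omega>"] by simp
  qed simp
  then have "(\<lambda>n. g (s n (\<tau> \<omega>))) \<longlonglongrightarrow> g (\<tau> \<omega>)"
    using t(2)[OF \<omega>] less_trans[OF t(2)[OF \<omega>] conjunct1[OF b]]
    by (intro continuous_on_tendsto_compose[OF g] always_eventually) auto
  then show "(\<lambda>n. h \<omega> (g (s n (\<tau> \<omega>)))) \<longlonglongrightarrow> h \<omega> (g (\<tau> \<omega>))"
    by (intro continuous_on_tendsto_compose[OF h(2)[OF \<omega>]]) auto
qed

lemma space_ps_borel:
  assumes "M \<subseteq> BH" shows "space (ps_borel M \<alpha>) = product_system M \<alpha>"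
  using assms by (auto simp: ps_borel_def space_restrict_space space_pair_measure product_system_def fibre_def)

lemma ps_borel_fst: "fst \<in> borel_measurable (ps_borel M \<alpha>)"
  unfolding ps_borel_def by (rule measurable_restrict_space1) measurable

lemma ps_borel_coefficient: "(\<lambda>p. cinner (blinfun_apply (snd p) x) y) \<in> borel_measurable (ps_borel M \<alpha>)"
  unfolding ps_borel_def
  by (rule measurable_restrict_space1) (rule measurable_compose[OF measurable_snd coefficient_measurable])

lemma measurable_ps_borelI:
  fixes f :: "'w \<Rightarrow> real \<times> 'h::complex_hilbert op"
  assumes sep: "separable_space (euclidean :: 'h topology)" and M: "M \<subseteq> BH"
    and f: "\<And>\<omega>. \<omega> \<in> space N \<Longrightarrow> f \<omega> \<in> product_system M \<alpha>"
    and m: "(\<lambda>\<omega>. fst (f \<omega>)) \<in> borel_measurable N"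
      "\<And>x y. (\<lambda>\<omega>. cinner (snd (f \<omega>) x) y) \<in> borel_measurable N"
  shows "f \<in> measurable N (ps_borel M \<alpha>)"
  unfolding ps_borel_def
proof (rule measurable_restrict_space2)
  show "f \<in> space N \<rightarrow> product_system M \<alpha>" using f by auto
  have "(\<lambda>\<omega>. snd (f \<omega>)) \<in> measurable N op_borel"
  proof (rule measurable_op_borelI[OF sep _ m(2)])
    fix \<omega> assume "\<omega> \<in> space N"
    from f[OF this] show "snd (f \<omega>) \<in> BH" using M by (auto simp: product_system_def fibre_def)
  qed
  with m(1) show "f \<in> measurable N (borel \<Otimes>\<^sub>M op_borel)" by (simp add: measurable_pair_iff comp_def)
qed

context atomic_E0 begin

text \<open>On vectors \<open>A (e x)\<close> the coefficient is one of \<alpha> and so continuous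
  in \<open>t\<close>; measurability survives the linear combinations and pointwise limits that
  reach all vectors.\<close>

lemma intertwiner_measurable:
  assumes B: "B \<in> M"
  shows "(\<lambda>t. cinner (intertwiner B t x) y) \<in> borel_measurable (restrict_space borel {0<..})"
  using atom_orbit_total
proof (induction x rule: total_induct)
  case (base a)
  then obtain A x where a: "a = blinfun_apply A (e x)" "A \<in> M" by auto
  have "continuous_on {0<..} (\<lambda>t. cinner (\<alpha> t (A o\<^sub>L e) (B (e x))) y)"
    by (rule continuous_on_subset[OF alpha_weakly_continuous]) (use a in auto)
  then have "continuous_on {0<..} (\<lambda>t. cinner (intertwiner B t a) y)"
    by (rule continuous_on_cong[THEN iffD1, rotated 2]) (use a B in \<open>auto simp: intertwiner_apply\<close>)
  then show ?case by (rule borel_measurable_continuous_on_restrict)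
next
  case (scale c x)
  have "cinner (intertwiner B t (c *\<^sub>C x)) y = c * cinner (intertwiner B t x) y" if "0 < t" for t
    using intertwiner_fibre[of t B] B that by (simp add: fibre_D(1) BH_apply cinner_simps)
  then show ?case using borel_measurable_times[OF borel_measurable_const scale, of c]
    by (subst measurable_cong[where g="\<lambda>t. c * cinner (intertwiner B t x) y"])
      (auto simp: space_restrict_space)
next
  case (limit f x)
  show ?case
    by (rule borel_measurable_LIMSEQ_metric[where f="\<lambda>n t. cinner (intertwiner B t (f n)) y", OF limit(1)])
      (intro cinner.tendsto blinfun.tendsto tendsto_const limit(2))
qed (auto simp: blinfun.add_right cinner_simps)

end

subsection \<open>The unitary family of an anti-isomorphism\<close>

locale e0_pair = A: atomic_E0 M e \<alpha> + B: atomic_E0 "commutant M" f \<beta>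
  for M :: "'h::complex_hilbert op set" and e f and \<alpha> \<beta> :: "real \<Rightarrow> 'h op \<Rightarrow> 'h op"

locale e0_anti_isomorphism = e0_pair +
  fixes \<theta> :: "real \<times> 'a op \<Rightarrow> real \<times> 'a op"
  assumes anti: "anti_isomorphism M \<alpha> (commutant M) \<beta> \<theta>"
begin

definition \<phi> :: "real \<Rightarrow> 'a op \<Rightarrow> 'a op" where "\<phi> t T = snd (\<theta> (t, T))"

lemma
  assumes t: "0 < t"
  shows theta_eq: "T \<in> fibre M \<alpha> t \<Longrightarrow> \<theta> (t, T) = (t, \<phi> t T)"
    and phi_bij: "bij_betw (\<phi> t) (fibre M \<alpha> t) (fibre (commutant M) \<beta> t)"
    and phi_inner: "S \<in> fibre M \<alpha> t \<Longrightarrow> T \<in> fibre M \<alpha> t \<Longrightarrow> fibre_inner (\<phi> t S) (\<phi> t T) = fibre_inner S T"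
proof -
  obtain g where g: "fibre_unitary (fibre M \<alpha> t) (fibre (commutant M) \<beta> t) g"
    and \<theta>g: "\<And>T. T \<in> fibre M \<alpha> t \<Longrightarrow> \<theta> (t, T) = (t, g T)"
    using anti t unfolding anti_isomorphism_def by blast
  have eq: "\<phi> t T = g T" if "T \<in> fibre M \<alpha> t" for T using \<theta>g[OF that] by (simp add: \<phi>_def)
  show "T \<in> fibre M \<alpha> t \<Longrightarrow> \<theta> (t, T) = (t, \<phi> t T)" by (simp add: \<theta>g eq)
  show "bij_betw (\<phi> t) (fibre M \<alpha> t) (fibre (commutant M) \<beta> t)"
    using g bij_betw_cong[of "fibre M \<alpha> t" "\<phi> t" g] eq by (auto simp: fibre_unitary_def)
  show "S \<in> fibre M \<alpha> t \<Longrightarrow> T \<in> fibre M \<alpha> t \<Longrightarrow> fibre_inner (\<phi> t S) (\<phi> t T) = fibre_inner S T"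
    using g by (auto simp: fibre_unitary_def eq)
qed

lemma phi_in: "0 < t \<Longrightarrow> T \<in> fibre M \<alpha> t \<Longrightarrow> \<phi> t T \<in> fibre (commutant M) \<beta> t"
  using phi_bij[of t] by (auto simp: bij_betw_def)

lemma phi_mult:
  assumes "0 < s" "0 < t" "S \<in> fibre M \<alpha> s" "T \<in> fibre M \<alpha> t"
  shows "\<phi> (s + t) (S o\<^sub>L T) = \<phi> t T o\<^sub>L \<phi> s S"
proof -
  have "\<theta> (ps_mult (s, S) (t, T)) = ps_mult (\<theta> (t, T)) (\<theta> (s, S))"
    using anti assms by (auto simp: anti_isomorphism_def product_system_def)
  then show ?thesis using assms by (simp add: ps_mult_def \<phi>_def[of "s + t"] theta_eq)
qed

text \<open>The families \<open>T x\<close> and \<open>\<phi> t T x\<close> have equal Gram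
  matrices, because \<phi> preserves the inner products of the fibres, and both are total. The
  unitary obtained between them is the adjoint of the wanted one.\<close>

lemma unitary_exists:
  assumes t: "0 < t"
  obtains V where "unitary V" "\<And>T. T \<in> fibre M \<alpha> t \<Longrightarrow> \<phi> t T = adj V o\<^sub>L T"
proof -
  define I where "I = fibre M \<alpha> t \<times> (UNIV :: 'a set)"
  define a :: "'a op \<times> 'a \<Rightarrow> 'a" where "a = (\<lambda>i. fst i (snd i))"
  define b :: "'a op \<times> 'a \<Rightarrow> 'a" where "b = (\<lambda>i. \<phi> t (fst i) (snd i))"
  have "a ` I = {blinfun_apply T x | T x. T \<in> fibre M \<alpha> t}" by (force simp: a_def I_def)
  then have ta: "total_set (a ` I)" using A.fibre_total[of t] t by simp
  have "b ` I = {blinfun_apply T x | T x. T \<in> \<phi> t ` fibre M \<alpha> t}" by (force simp: b_def I_def)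
  then have "b ` I = {blinfun_apply T x | T x. T \<in> fibre (commutant M) \<beta> t}"
    using phi_bij[OF t] by (simp add: bij_betw_def)
  then have tb: "total_set (b ` I)" using B.fibre_total[of t] t by simp
  have "cinner (b i) (b j) = cinner (a i) (a j)" if "i \<in> I" "j \<in> I" for i j
    using that t A.fibre_gram_cinner[of t "fst i" "fst j" "snd i" "snd j"]
      B.fibre_gram_cinner[of t "\<phi> t (fst i)" "\<phi> t (fst j)" "snd i" "snd j"]
    by (auto simp: a_def b_def I_def phi_in phi_inner)
  then obtain W where W: "unitary W" "\<And>i. i \<in> I \<Longrightarrow> W (a i) = b i"
    by (rule total_image_unitary[OF ta tb]) auto
  have "\<phi> t T = adj (adj W) o\<^sub>L T" if "T \<in> fibre M \<alpha> t" for T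
    using W(2)[of "(T, _)"] that W(1) by (intro blinfun_eqI) (simp add: a_def b_def I_def)
  then show ?thesis using that[of "adj W"] W(1) by simp
qed

text \<open>Only positive times carry information; the values at \<open>t \<le> 0\<close> are left
  unspecified.\<close>

definition U :: "real \<Rightarrow> 'a op" where
  "U t = (SOME V. unitary V \<and> (\<forall>T\<in>fibre M \<alpha> t. \<phi> t T = adj V o\<^sub>L T))"

lemma
  assumes t: "0 < t"
  shows U_unitary [simp]: "unitary (U t)"
    and U_phi: "T \<in> fibre M \<alpha> t \<Longrightarrow> \<phi> t T = adj (U t) o\<^sub>L T"
proof -
  have "\<exists>V. unitary V \<and> (\<forall>T\<in>fibre M \<alpha> t. \<phi> t T = adj V o\<^sub>L T)"
    by (rule unitary_exists[OF t]) blast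
  from someI_ex[OF this] show "unitary (U t)" "T \<in> fibre M \<alpha> t \<Longrightarrow> \<phi> t T = adj (U t) o\<^sub>L T"
    by (auto simp: U_def)
qed

lemma U_phi_apply: "0 < t \<Longrightarrow> T \<in> fibre M \<alpha> t \<Longrightarrow> \<phi> t T x = adj (U t) (T x)"
  by (simp add: U_phi)

lemma U_has_form: "has_form M \<alpha> \<theta> U"
  by (auto simp: has_form_def theta_eq U_phi)

lemma U_unique:
  assumes "\<forall>t>0. unitary (V t)" "has_form M \<alpha> \<theta> V" "0 < t"
  shows "V t = U t"
proof -
  have "adj (V t) = adj (U t)"
  proof (rule A.fibre_eqI)
    fix T assume "T \<in> fibre M \<alpha> t"
    then show "adj (V t) o\<^sub>L T = adj (U t) o\<^sub>L T"
      using assms by (auto simp: has_form_def theta_eq U_phi[symmetric])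
  qed (use assms in auto)
  then have "adj (adj (V t)) = adj (adj (U t))" by simp
  moreover have "V t \<in> BH" "U t \<in> BH" using assms by auto
  ultimately show ?thesis by simp
qed

text \<open>By totality used twice, first over the fibre at \<open>t\<close> and then over that at
  \<open>s\<close>, it suffices to compare on products of \<open>S\<close> and \<open>T\<close>.
  There anti-multiplicativity reverses the order, and moving \<open>\<phi> s S\<close>, which lies
  in the commutant, past \<open>T\<close> in \<open>M\<close> restores it.\<close>

lemma U_semigroup:
  assumes s: "0 < s" and t: "0 < t"
  shows "U (s + t) = U s o\<^sub>L U t"
proof -
  have eq: "adj (U (s + t)) o\<^sub>L S = (adj (U t) o\<^sub>L adj (U s)) o\<^sub>L S" if S: "S \<in> fibre M \<alpha> s" for S
  proof (rule A.fibre_eqI[of t])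
    have "S \<in> BH" using fibre_D(1)[OF S] by simp
    then show "adj (U (s + t)) o\<^sub>L S \<in> BH" "(adj (U t) o\<^sub>L adj (U s)) o\<^sub>L S \<in> BH"
      using s t by simp_all
    show "0 \<le> t" using t by simp
    fix T assume T: "T \<in> fibre M \<alpha> t"
    have "S o\<^sub>L T \<in> fibre M \<alpha> (s + t)" using s t S T by (simp add: A.fibre_compose)
    then have "adj (U (s + t)) o\<^sub>L (S o\<^sub>L T) = \<phi> t T o\<^sub>L \<phi> s S"
      using s t S T by (simp add: phi_mult flip: U_phi)
    also have "\<dots> = (adj (U t) o\<^sub>L adj (U s)) o\<^sub>L (S o\<^sub>L T)"
    proof (rule blinfun_eqI)
      fix x
      have "\<phi> s S (T x) = T (\<phi> s S x)"
        by (rule commutant_apply[OF fibre_D(1)[OF phi_in[OF s S]] fibre_D(1)[OF T]])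
      then show "(\<phi> t T o\<^sub>L \<phi> s S) x = ((adj (U t) o\<^sub>L adj (U s)) o\<^sub>L (S o\<^sub>L T)) x"
        using s t S T by (simp add: U_phi_apply)
    qed
    finally show "(adj (U (s + t)) o\<^sub>L S) o\<^sub>L T = ((adj (U t) o\<^sub>L adj (U s)) o\<^sub>L S) o\<^sub>L T"
      by (simp add: compose_assoc)
  qed
  have "adj (U (s + t)) = adj (U t) o\<^sub>L adj (U s)"
  proof (rule A.fibre_eqI[OF _ _ _ eq])
    show "0 \<le> s" "adj (U (s + t)) \<in> BH" "(adj (U t) o\<^sub>L adj (U s)) \<in> BH"
      using s t by simp_all
  qed
  then have "adj (adj (U (s + t))) = adj (adj (U t) o\<^sub>L adj (U s))" by simp
  then show ?thesis using s t by (simp add: adj_compose)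
qed

text \<open>\<open>\<phi> t T\<close> lies in the commutant and so commutes with \<open>A\<close>;
  applying \<open>U t\<close> turns this into the intertwining relation of \<open>T\<close> for
  \<alpha>. The second claim uses in the same way that \<open>B\<close> commutes with
  \<open>T\<close>.\<close>

lemma U_implements:
  assumes t: "0 < t"
  shows "A \<in> M \<Longrightarrow> conj_by (U t) A = \<alpha> t A"
    and "B \<in> commutant M \<Longrightarrow> conj_by (adj (U t)) B = \<beta> t B"
proof -
  assume A: "A \<in> M"
  show "conj_by (U t) A = \<alpha> t A"
  proof (rule A.fibre_eqI)
    fix T assume T: "T \<in> fibre M \<alpha> t"
    have "U t (A (adj (U t) (T x))) = \<alpha> t A (T x)" for x
    proof -
      have "A (\<phi> t T x) = \<phi> t T (A x)"
        by (rule commutant_apply[OF fibre_D(1)[OF phi_in[OF t T]] A, symmetric])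
      then show ?thesis using t T A by (simp add: U_phi_apply fibre_D(3))
    qed
    then show "conj_by (U t) A o\<^sub>L T = \<alpha> t A o\<^sub>L T"
      by (intro blinfun_eqI) (simp add: conj_by_def)
  qed (use t A in \<open>auto simp: conj_by_def\<close>)
next
  assume B: "B \<in> commutant M"
  show "conj_by (adj (U t)) B = \<beta> t B"
  proof (rule B.fibre_eqI)
    fix S assume "S \<in> fibre (commutant M) \<beta> t"
    then obtain T where T: "T \<in> fibre M \<alpha> t" and S: "S = \<phi> t T"
      using phi_bij[OF t] by (auto simp: bij_betw_def)
    have "adj (U t) (B (U t (S x))) = \<beta> t B (S x)" for x
    proof -
      have "adj (U t) (B (U t (S x))) = adj (U t) (B (T x))"
        using t T by (simp add: S U_phi_apply)
      also have "B (T x) = T (B x)" by (rule commutant_apply[OF B fibre_D(1)[OF T]])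
      also have "adj (U t) (T (B x)) = S (B x)" using t T by (simp add: S U_phi_apply)
      also have "\<dots> = \<beta> t B (S x)" using phi_in[OF t T] B by (simp add: S fibre_D(3))
      finally show ?thesis .
    qed
    then show "conj_by (adj (U t)) B o\<^sub>L S = \<beta> t B o\<^sub>L S"
      using t by (intro blinfun_eqI) (simp add: conj_by_def)
  qed (use t B commutant_BH in \<open>auto simp: conj_by_def\<close>)
qed

section \<open>Weak measurability of the unitary family\<close>

lemma phi_intertwiner_measurable:
  assumes B: "B \<in> M"
  shows "(\<lambda>t. cinner (\<phi> t (A.intertwiner B t) x) y) \<in> borel_measurable (restrict_space borel {0<..})"
proof -
  have "(\<lambda>t. (t, A.intertwiner B t)) \<in> measurable (restrict_space borel {0<..}) (ps_borel M \<alpha>)"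
    using A.sep A.subset_BH
  proof (rule measurable_ps_borelI)
    fix t :: real assume "t \<in> space (restrict_space borel {0<..})"
    then show "(t, A.intertwiner B t) \<in> product_system M \<alpha>"
      using B A.intertwiner_fibre[of t B] by (auto simp: product_system_def space_restrict_space)
  next
    show "(\<lambda>t. cinner (snd (t, A.intertwiner B t) x) y) \<in> borel_measurable (restrict_space borel {0<..})" for x y
      using A.intertwiner_measurable[OF B] by simp
  qed (auto intro: measurable_restrict_space1)
  \<comment> \<open>Here the Borel property of \<theta> enters; the remaining arguments use its
    algebraic and metric properties.\<close>
  moreover have "\<theta> \<in> measurable (ps_borel M \<alpha>) (ps_borel (commutant M) \<beta>)"
    using anti by (simp add: anti_isomorphism_def borel_isomorphism_def)
  ultimately have "(\<lambda>t. \<theta> (t, A.intertwiner B t)) \<in>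
      measurable (restrict_space borel {0<..}) (ps_borel (commutant M) \<beta>)"
    by (rule measurable_compose)
  from measurable_compose[OF this ps_borel_coefficient[of x y]] show ?thesis by (simp add: \<phi>_def)
qed

text \<open>For \<open>w = B (e x)\<close> the vector \<open>\<alpha> t v w\<close> is the section
  of \<open>B\<close> applied to the fixed vector \<open>v (e x)\<close>, so
  \<open>adj (U t)\<close> turns it into the image of that section under \<theta>.\<close>

lemma U_alpha_atom_measurable:
  assumes v: "v \<in> M" "v o\<^sub>L e = v"
  shows "(\<lambda>t. cinner (adj (U t) (\<alpha> t v w)) z) \<in> borel_measurable (restrict_space borel {0<..})"
  using A.atom_orbit_total
proof (induction w rule: total_induct)
  case (base a)
  then obtain B x where a: "a = blinfun_apply B (e x)" "B \<in> M" by auto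
  have "cinner (adj (U t) (\<alpha> t v a)) z = cinner (\<phi> t (A.intertwiner B t) (v (e x))) z" if "0 < t" for t
    using that v a A.intertwiner_apply[of t B v x] A.intertwiner_fibre[of t B]
    by (simp add: U_phi_apply)
  then show ?case using phi_intertwiner_measurable[OF a(2), of "v (e x)" z]
    by (subst measurable_cong[where g="\<lambda>t. cinner (\<phi> t (A.intertwiner B t) (v (e x))) z"])
      (auto simp: space_restrict_space)
next
  case (scale c x)
  have "cinner (adj (U t) (\<alpha> t v (c *\<^sub>C x))) z = c * cinner (adj (U t) (\<alpha> t v x)) z" if "0 < t" for t
    using that v by (simp add: BH_apply cinner_simps)
  then show ?case using borel_measurable_times[OF borel_measurable_const scale, of c]
    by (subst measurable_cong[where g="\<lambda>t. c * cinner (adj (U t) (\<alpha> t v x)) z"])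
      (auto simp: space_restrict_space)
next
  case (limit g x)
  show ?case
    by (rule borel_measurable_LIMSEQ_metric[where f="\<lambda>n t. cinner (adj (U t) (\<alpha> t v (g n))) z", OF limit(1)])
      (intro cinner.tendsto blinfun.tendsto tendsto_const limit(2))
qed (auto simp: blinfun.add_right cinner_simps)

text \<open>In a summand \<open>v o\<^sub>L adj v\<close> the factor
  \<open>\<alpha> t (adj v) y\<close> varies with \<open>t\<close>, but continuously, so it can be
  substituted into the preceding family.\<close>

lemma U_alpha_atomic_sums_measurable:
  assumes X: "X \<in> atomic_sums M e"
  shows "(\<lambda>t. cinner (adj (U t) (\<alpha> t X y)) z) \<in> borel_measurable (restrict_space borel {0<..})"
  using X
proof (induction rule: atomic_sums.induct)
  case zero
  have "cinner (adj (U t) (\<alpha> t 0 y)) z = 0" if "0 < t" for t using that by (simp add: A.alpha_zero)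
  then show ?case by (subst measurable_cong[where g="\<lambda>t. 0"]) (auto simp: space_restrict_space)
next
  case (step X v)
  have XM: "X \<in> M" by (rule A.atomic_sums_subset[OF step(1)])
  have "(\<lambda>t. cinner (adj (U t) (\<alpha> t v (\<alpha> t (adj v) y))) z) \<in> borel_measurable (restrict_space borel {0<..})"
  proof (rule caratheodory_measurable[where h="\<lambda>t w. cinner (adj (U t) (\<alpha> t v w)) z" and \<tau>="\<lambda>t. t"])
    show "continuous_on {0<..} (\<lambda>t. \<alpha> t (adj v) y)"
      by (rule continuous_on_subset[OF A.alpha_strongly_continuous]) (use step in auto)
    show "continuous_on UNIV (\<lambda>w. cinner (adj (U t) (\<alpha> t v w)) z)" for t
      by (intro cinner.continuous_on continuous_intros)
  qed (use U_alpha_atom_measurable[OF step(2,3)] in \<open>auto simp: space_restrict_space intro: measurable_restrict_space1\<close>)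
  from borel_measurable_add[OF step.IH this] show ?case
    using XM step(2)
    by (subst measurable_cong[where g="\<lambda>t. cinner (adj (U t) (\<alpha> t X y)) z +
        cinner (adj (U t) (\<alpha> t v (\<alpha> t (adj v) y))) z"])
      (auto simp: space_restrict_space A.alpha_add A.alpha_mult blinfun.add_left blinfun.add_right cinner_simps)
qed

lemma U_measurable: "(\<lambda>t. cinner (U t x) y) \<in> borel_measurable (restrict_space borel {0<..})"
proof -
  obtain P where P: "\<And>n::nat. P n \<in> atomic_sums M e"
    "\<And>t x y. 0 \<le> t \<Longrightarrow> (\<lambda>n. cinner (\<alpha> t (P n) x) y) \<longlonglongrightarrow> cinner x y"
    by (rule A.alpha_approximate_unit) blast
  have "(\<lambda>t. cinner y (U t x)) \<in> borel_measurable (restrict_space borel {0<..})"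
  proof (rule borel_measurable_LIMSEQ_metric)
    show "(\<lambda>t. cinner (adj (U t) (\<alpha> t (P n) y)) x) \<in> borel_measurable (restrict_space borel {0<..})" for n
      by (rule U_alpha_atomic_sums_measurable[OF P(1)])
    fix t :: real assume "t \<in> space (restrict_space borel {0<..})"
    then have "0 < t" by (simp add: space_restrict_space)
    then show "(\<lambda>n. cinner (adj (U t) (\<alpha> t (P n) y)) x) \<longlonglongrightarrow> cinner y (U t x)"
      using P(2)[of t y "U t x"] by (simp add: cinner_adj_left)
  qed
  then have "(\<lambda>t. cnj (cinner y (U t x))) \<in> borel_measurable (restrict_space borel {0<..})"
    by (rule borel_measurable_continuous_on[rotated]) (intro continuous_intros)
  then show ?thesis by (simp flip: cinner_commute)
qed

end

subsection \<open>Measurable unitary semigroups are continuous\<close>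

text \<open>The positive and the negative part of \<open>f\<close> are densities of two finite
  measures that agree on all rays, hence coincide.\<close>

lemma AE_zero_if_ray_integrals_zero:
  fixes f :: "real \<Rightarrow> real"
  assumes f: "integrable lborel f"
    and z: "\<And>a. (LINT t|lborel. indicator {a<..} t * f t) = 0"
  shows "AE t in lborel. f t = 0"
proof -
  have [measurable]: "f \<in> borel_measurable borel" using f by (auto dest: borel_measurable_integrable)
  define p where "p t = max 0 (f t)" for t
  define n where "n t = max 0 (- f t)" for t
  have ip: "integrable lborel p" and inn: "integrable lborel n"
    unfolding p_def n_def using f by (auto intro!: integrable_max)
  have ii: "integrable lborel (\<lambda>t. indicator {a<..} t * g t)"
    if g: "integrable lborel g" for a :: real and g :: "real \<Rightarrow> real"
  proof -
    have "{a<..} \<in> sets (lborel :: real measure)" by simp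
    from integrable_mult_indicator[OF this g] show ?thesis by simp
  qed
  have e: "emeasure (density lborel g) {a<..} = ennreal (LINT t|lborel. indicator {a<..} t * g t)"
    if g: "integrable lborel g" "\<And>t. 0 \<le> g t" for a :: real and g :: "real \<Rightarrow> real"
  proof -
    have "emeasure (density lborel g) {a<..} = (\<integral>\<^sup>+t. ennreal (g t) * indicator {a<..} t \<partial>lborel)"
      using g(1) by (intro emeasure_density) auto
    also have "\<dots> = (\<integral>\<^sup>+t. ennreal (indicator {a<..} t * g t) \<partial>lborel)"
      by (intro nn_integral_cong) (auto simp: indicator_def)
    also have "\<dots> = ennreal (LINT t|lborel. indicator {a<..} t * g t)"
      by (rule nn_integral_eq_integral[OF ii[OF g(1)]]) (use g(2) in auto)
    finally show ?thesis .
  qed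
  have "density lborel p = density lborel n"
  proof (rule measure_eqI_lessThan)
    show "emeasure (density lborel p) {a<..} < \<infinity>" for a
      by (subst e[OF ip]) (auto simp: p_def)
    show "emeasure (density lborel p) {a<..} = emeasure (density lborel n) {a<..}" for a
    proof -
      have "(LINT t|lborel. indicator {a<..} t * p t) - (LINT t|lborel. indicator {a<..} t * n t) =
          (LINT t|lborel. indicator {a<..} t * f t)"
        unfolding Bochner_Integration.integral_diff[OF ii[OF ip] ii[OF inn], symmetric]
        by (intro Bochner_Integration.integral_cong) (auto simp: p_def n_def max_def indicator_def)
      then have "(LINT t|lborel. indicator {a<..} t * p t) = (LINT t|lborel. indicator {a<..} t * n t)"
        using z[of a] by simp
      moreover have "0 \<le> p t" "0 \<le> n t" for t by (auto simp: p_def n_def)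
      ultimately show ?thesis by (simp add: e ip inn)
    qed
  qed auto
  then have "AE t in lborel. ennreal (p t) = ennreal (n t)"
    by (intro sigma_finite_measure.density_unique[OF sigma_finite_lborel]) (auto simp: p_def n_def)
  then show ?thesis by eventually_elim (auto simp: p_def n_def max_def split: if_splits)
qed

definition unitary_semigroup :: "(real \<Rightarrow> 'h::complex_hilbert op) \<Rightarrow> bool" where
  "unitary_semigroup U \<longleftrightarrow> (\<forall>t>0. unitary (U t)) \<and> (\<forall>s>0. \<forall>t>0. U (s + t) = U s o\<^sub>L U t)"

locale measurable_unitary_semigroup =
  fixes U :: "real \<Rightarrow> 'h::complex_hilbert op"
  assumes sep: "separable_space (euclidean :: 'h topology)"
    and sg: "unitary_semigroup U"
    and meas: "\<And>x y. (\<lambda>t. cinner (U t x) y) \<in> borel_measurable (restrict_space borel {0<..})"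
begin

lemma unitary_U [simp]: "0 < t \<Longrightarrow> unitary (U t)"
  and U_plus: "0 < s \<Longrightarrow> 0 < t \<Longrightarrow> U (s + t) = U s o\<^sub>L U t"
  using sg by (auto simp: unitary_semigroup_def)

text \<open>The moving vector stands in the second slot to make this linear in \<open>y\<close>, as
  the Riesz representation needs; the cut-off removes the times at which \<open>U\<close> is
  unspecified.\<close>

definition coeff :: "'h \<Rightarrow> 'h \<Rightarrow> real \<Rightarrow> complex" where
  "coeff x y t = indicator {0<..} t *\<^sub>R cinner y (U t x)"

lemma coeff_measurable [measurable]: "coeff x y \<in> borel_measurable borel"
proof -
  have "(\<lambda>t. indicator {0<..} t *\<^sub>R cinner (U t x) y) \<in> borel_measurable borel"
    using meas by (subst (asm) borel_measurable_restrict_space_iff) auto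
  then have "(\<lambda>t. cnj (indicator {0<..} t *\<^sub>R cinner (U t x) y)) \<in> borel_measurable borel"
    by (rule borel_measurable_continuous_on[rotated]) (intro continuous_intros)
  moreover have "coeff x y = (\<lambda>t. cnj (indicator {0<..} t *\<^sub>R cinner (U t x) y))"
    by (auto simp: coeff_def cinner_commute[of y] indicator_def)
  ultimately show ?thesis by simp
qed

lemma coeff_bound: "cmod (coeff x y t) \<le> norm x * norm y"
  using norm_cinner_le[of y "U t x"] by (auto simp: coeff_def indicator_def mult.commute)

lemma coeff_integrable: "integrable lborel (\<lambda>t. indicator {a<..b} t *\<^sub>R coeff x y t)"
  by (rule integrableI_bounded_set_indicator[where B="norm x * norm y"])
    (auto simp: coeff_bound intro!: emeasure_bounded_finite[unfolded infinity_ennreal_def])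

definition avg :: "real \<Rightarrow> 'h \<Rightarrow> 'h \<Rightarrow> complex" where
  "avg b x y = (LINT t|lborel. indicator {0<..b} t *\<^sub>R coeff x y t)"

text \<open>The vector \<open>z\<close> is the weak integral of \<open>U t x\<close> over
  \<open>t\<close> from 0 to \<open>b\<close>, obtained from its coefficients by Riesz
  representation.\<close>

lemma avg_vector:
  assumes b: "0 < b"
  obtains z where "\<And>y. avg b x y = cinner y z"
proof (rule riesz_representation[of "avg b x" "b * norm x"])
  show "avg b x (y + y') = avg b x y + avg b x y'" for y y'
  proof -
    have "coeff x (y + y') t = coeff x y t + coeff x y' t" for t
      by (simp add: coeff_def cinner_simps scaleR_add_right)
    then show ?thesis by (simp add: avg_def scaleR_add_right coeff_integrable)
  qed
  show "avg b x (c *\<^sub>C y) = c * avg b x y" for c y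
    unfolding avg_def
    by (subst integral_mult_right_zero[symmetric])
      (auto intro!: Bochner_Integration.integral_cong simp: coeff_def cinner_simps)
  show "cmod (avg b x y) \<le> norm y * (b * norm x)" for y
  proof -
    have "cmod (avg b x y) \<le> (LINT t|lborel. norm (indicator {0<..b} t *\<^sub>R coeff x y t))"
      unfolding avg_def by (rule integral_norm_bound)
    also have "\<dots> \<le> (LINT t|lborel. indicator {0<..b} t * (norm x * norm y))"
    proof (rule integral_mono)
      show "integrable lborel (\<lambda>t. indicator {0<..b} t * (norm x * norm y))"
        by (intro integrable_mult_left integrable_real_indicator)
          (auto intro: emeasure_bounded_finite[unfolded infinity_ennreal_def])
      show "integrable lborel (\<lambda>t. norm (indicator {0<..b} t *\<^sub>R coeff x y t))"
        by (intro integrable_norm coeff_integrable)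
    qed (auto simp: indicator_def coeff_bound)
    also have "\<dots> = norm y * (b * norm x)" using b by simp
    finally show ?thesis .
  qed
qed auto

lemma has_integral_indicator_Ioc:
  fixes a b c :: real
  assumes "a \<le> b"
  shows "has_bochner_integral lborel (\<lambda>t. indicator {a<..b} t * c) ((b - a) * c)"
proof -
  have "has_bochner_integral lborel (indicator {a<..b}) (measure lborel {a<..b})"
    by (rule has_bochner_integral_real_indicator) (simp_all add: assms)
  then show ?thesis using assms by (intro has_bochner_integral_mult_left) simp
qed

text \<open>The semigroup law turns the action of \<open>U s\<close> into a translation of the
  interval of integration by \<open>s\<close>; the two intervals differ only within two pieces of
  length \<open>s\<close>.\<close>

lemma avg_shift:
  assumes b: "0 < b" and s: "0 < s"
  shows "cmod (avg b x (adj (U s) y) - avg b x y) \<le> 2 * s * norm x * norm y"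
proof -
  let ?F = "coeff x y"
  have ind: "has_bochner_integral lborel
      (\<lambda>t. indicator {0<..s} t * (norm x * norm y) + indicator {b<..b + s} t * (norm x * norm y))
      ((s - 0) * (norm x * norm y) + ((b + s) - b) * (norm x * norm y))"
    using s by (intro has_bochner_integral_add has_integral_indicator_Ioc) auto
  have "avg b x (adj (U s) y) = (LINT t|lborel. indicator {s<..b + s} (s + t) *\<^sub>R ?F (s + t))"
    unfolding avg_def
  proof (rule Bochner_Integration.integral_cong[OF refl])
    fix t
    show "indicator {0<..b} t *\<^sub>R coeff x (adj (U s) y) t = indicator {s<..b + s} (s + t) *\<^sub>R ?F (s + t)"
    proof (cases "0 < t \<and> t \<le> b")
      case True
      then show ?thesis using s U_plus[OF s, of t] by (simp add: coeff_def cinner_adj_left)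
    qed (use s in auto)
  qed
  also have "\<dots> = (LINT t|lborel. indicator {s<..b + s} t *\<^sub>R ?F t)"
    using lborel_integral_real_affine[of 1 "\<lambda>t. indicator {s<..b + s} t *\<^sub>R ?F t" s] by simp
  finally have eq: "avg b x (adj (U s) y) - avg b x y =
      (LINT t|lborel. indicator {s<..b + s} t *\<^sub>R ?F t - indicator {0<..b} t *\<^sub>R ?F t)"
    by (subst Bochner_Integration.integral_diff) (auto simp: avg_def coeff_integrable)
  have "cmod (avg b x (adj (U s) y) - avg b x y) \<le> (LINT t|lborel. norm (indicator {s<..b + s} t *\<^sub>R ?F t - indicator {0<..b} t *\<^sub>R ?F t))"
    unfolding eq by (rule integral_norm_bound)
  also have "\<dots> \<le> (LINT t|lborel. indicator {0<..s} t * (norm x * norm y) + indicator {b<..b + s} t * (norm x * norm y))"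
  proof (rule integral_mono)
    show "integrable lborel (\<lambda>t. norm (indicator {s<..b + s} t *\<^sub>R ?F t - indicator {0<..b} t *\<^sub>R ?F t))"
      by (rule integrable_norm[OF Bochner_Integration.integrable_diff[OF
            coeff_integrable[of s "b + s" x y] coeff_integrable[of 0 b x y]]])
    show "integrable lborel (\<lambda>t. indicator {0<..s} t * (norm x * norm y) + indicator {b<..b + s} t * (norm x * norm y))"
      by (rule integrable.intros[OF ind])
    fix t
    show "norm (indicator {s<..b + s} t *\<^sub>R ?F t - indicator {0<..b} t *\<^sub>R ?F t) \<le>
        indicator {0<..s} t * (norm x * norm y) + indicator {b<..b + s} t * (norm x * norm y)"
      using b s coeff_bound[of x y t] by (auto simp: indicator_def)
  qed
  also have "\<dots> = 2 * s * norm x * norm y"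
    by (subst has_bochner_integral_integral_eq[OF ind]) (simp add: algebra_simps)
  finally show ?thesis .
qed

lemma avg_vector_continuous:
  assumes b: "0 < b" and z: "\<And>y. avg b x y = cinner y z"
  shows "((\<lambda>s. U s z) \<longlongrightarrow> z) (at_right 0)"
proof -
  have "norm (U s z - z) \<le> s * (2 * norm x)" if s: "0 < s" for s
  proof (rule norm_le_of_cinner)
    fix y
    have "cinner y (U s z) = avg b x (adj (U s) y)" using s by (simp add: z cinner_adj_left)
    then have "cmod (cinner y (U s z - z)) \<le> 2 * s * norm x * norm y"
      using avg_shift[OF b s, of x y] by (simp add: cinner_simps z)
    moreover have "cmod (cinner (U s z - z) y) = cmod (cinner y (U s z - z))"
      by (subst cinner_commute) simp
    ultimately show "cmod (cinner (U s z - z) y) \<le> s * (2 * norm x) * norm y" by (simp add: mult_ac)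
  qed (use s in auto)
  then have "\<forall>\<^sub>F s in at_right 0. norm (U s z - z) \<le> s * (2 * norm x)"
    by (auto simp: eventually_at_filter)
  moreover have "((\<lambda>s. s * (2 * norm x)) \<longlongrightarrow> 0) (at_right 0)"
    by (rule tendsto_mult_left_zero) (rule tendsto_ident_at)
  ultimately have "((\<lambda>s. U s z - z) \<longlongrightarrow> 0) (at_right 0)" by (rule Lim_null_comparison)
  then show ?thesis by (simp add: LIM_zero_iff)
qed

text \<open>Vanishing averages make each coefficient zero almost everywhere on the unit interval.
  Separability leaves countably many exceptional null sets, so some single \<open>t\<close> makes
  \<open>y\<close> orthogonal to a dense part of the range of \<open>U t\<close>, and
  \<open>U t\<close> is onto.\<close>

lemma avg_zero:
  assumes y: "\<And>b x. 0 < b \<Longrightarrow> avg b x y = 0"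
  shows "y = 0"
proof -
  obtain d :: "nat \<Rightarrow> 'h" where "UNIV \<subseteq> closure (range d)"
    by (rule separable_sequence[OF sep, of UNIV]) auto
  then have d: "closure (range d) = UNIV" by auto
  have "AE t in lborel. indicator {0<..1} t *\<^sub>R coeff x y t = 0" for x
  proof -
    let ?g = "\<lambda>t. indicator {0<..1} t *\<^sub>R coeff x y t"
    \<comment> \<open>Within the unit interval, a ray integral is a difference of two
      averages.\<close>
    have rays: "(LINT t|lborel. indicator {a<..} t *\<^sub>R ?g t) = 0" for a
    proof -
      consider "a \<le> 0" | "0 < a" "a < 1" | "1 \<le> a" by linarith
      then show ?thesis
      proof cases
        case 1
        then have "(\<lambda>t. indicator {a<..} t *\<^sub>R ?g t) = ?g" by (auto simp: indicator_def fun_eq_iff)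
        then show ?thesis using y[of 1 x] by (simp add: avg_def)
      next
        case 2
        have "(LINT t|lborel. indicator {a<..} t *\<^sub>R ?g t) =
            (LINT t|lborel. ?g t - indicator {0<..a} t *\<^sub>R coeff x y t)"
          using 2 by (intro Bochner_Integration.integral_cong) (auto simp: indicator_def)
        also have "\<dots> = avg 1 x y - avg a x y"
          unfolding avg_def by (intro Bochner_Integration.integral_diff coeff_integrable)
        finally show ?thesis using y 2 by simp
      next
        case 3
        then have "(\<lambda>t. indicator {a<..} t *\<^sub>R ?g t) = (\<lambda>t. 0)" by (auto simp: indicator_def fun_eq_iff)
        then show ?thesis by simp
      qed
    qed
    have ig: "integrable lborel (\<lambda>t. indicator {a<..} t *\<^sub>R ?g t)" for a
      by (rule integrable_mult_indicator[OF _ coeff_integrable]) auto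
    have "AE t in lborel. Re (?g t) = 0"
    proof (rule AE_zero_if_ray_integrals_zero)
      show "integrable lborel (\<lambda>t. Re (?g t))" by (rule integrable_Re[OF coeff_integrable])
      show "(LINT t|lborel. indicator {a<..} t * Re (?g t)) = 0" for a
        using integral_Re[OF ig, of a] rays[of a] by (simp add: mult.assoc)
    qed
    moreover have "AE t in lborel. Im (?g t) = 0"
    proof (rule AE_zero_if_ray_integrals_zero)
      show "integrable lborel (\<lambda>t. Im (?g t))" by (rule integrable_Im[OF coeff_integrable])
      show "(LINT t|lborel. indicator {a<..} t * Im (?g t)) = 0" for a
        using integral_Im[OF ig, of a] rays[of a] by (simp add: mult.assoc)
    qed
    ultimately show ?thesis by eventually_elim (auto simp: complex_eq_iff)
  qed
  then have ae: "AE t in lborel. \<forall>n. indicator {0<..1} t *\<^sub>R coeff (d n) y t = 0"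
    unfolding AE_all_countable by blast
  have nae: "\<not> (AE t in lborel. t \<notin> {0<..1::real})"
  proof
    assume "AE t in lborel. t \<notin> {0<..1::real}"
    then have "emeasure lborel {0<..1::real} = 0" by (subst (asm) AE_iff_measurable[of "{0<..1}"]) auto
    then show False by simp
  qed
  have "\<exists>t\<in>{0<..1}. \<forall>n. indicator {0<..1} t *\<^sub>R coeff (d n) y t = 0"
  proof (rule ccontr)
    assume n: "\<not> ?thesis"
    have "AE t in lborel. t \<notin> {0<..1::real}" using ae by (rule eventually_mono) (use n in blast)
    with nae show False by blast
  qed
  then obtain t where t: "t \<in> {0<..1}" "\<And>n. indicator {0<..1} t *\<^sub>R coeff (d n) y t = 0" by blast
  then have z: "cinner y (U t (d n)) = 0" for n by (simp add: coeff_def)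
  have "closure (range d) \<subseteq> {x. cinner y (U t x) = 0}"
    by (rule closure_minimal)
      (use z in \<open>auto intro!: closed_Collect_eq cinner.continuous_on continuous_intros\<close>)
  then have "cinner y (U t (adj (U t) y)) = 0" using d by auto
  then show ?thesis using t by simp
qed

lemma right_continuous: "((\<lambda>s. U s x) \<longlongrightarrow> x) (at_right 0)"
proof -
  define Z where "Z = {z. \<exists>b x. 0 < b \<and> (\<forall>y. avg b x y = cinner y z)}"
  have "total_set Z"
    unfolding total_set_def
  proof (intro allI impI)
    fix y assume y: "\<forall>a\<in>Z. cinner a y = 0"
    show "y = 0"
    proof (rule avg_zero)
      fix b x assume b: "0 < (b::real)"
      obtain z where z: "\<And>y. avg b x y = cinner y z" by (rule avg_vector[OF b, of x]) auto
      then have "cinner z y = 0" using y b by (auto simp: Z_def)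
      then show "avg b x y = 0" unfolding z by (subst cinner_commute) simp
    qed
  qed
  then show ?thesis
  proof (induction x rule: total_induct)
    case (base a)
    then show ?case using avg_vector_continuous by (auto simp: Z_def)
  next
    case (scale c x)
    have "\<forall>\<^sub>F s in at_right 0. c *\<^sub>C U s x = U s (c *\<^sub>C x)"
      by (auto simp: eventually_at_filter BH_apply)
    with scaleC.tendsto[OF tendsto_const scale, of c] show ?case by (rule Lim_transform_eventually)
  next
    case (limit f x)
    show ?case
      by (rule strong_limit_closed[OF _ limit(2,1)]) (auto simp: eventually_at_filter)
  qed (auto simp: blinfun.add_right intro: tendsto_add)
qed

end

subsection \<open>Extension of unitary semigroups to groups\<close>

locale continuous_unitary_semigroup =
  fixes U :: "real \<Rightarrow> 'h::complex_hilbert op"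
  assumes sg: "unitary_semigroup U"
    and right_cont: "\<And>x. ((\<lambda>s. U s x) \<longlongrightarrow> x) (at_right 0)"
begin

lemma unitary_U [simp]: "0 < t \<Longrightarrow> unitary (U t)"
  and U_plus: "0 < s \<Longrightarrow> 0 < t \<Longrightarrow> U (s + t) = U s o\<^sub>L U t"
  using sg by (auto simp: unitary_semigroup_def)

lemma U_commute: "0 < s \<Longrightarrow> 0 < t \<Longrightarrow> U s (U t x) = U t (U s x)"
  using U_plus[of s t] U_plus[of t s] by (metis add.commute blinfun_apply_blinfun_compose)

lemma adj_U_commute:
  assumes "0 < s" "0 < t" shows "adj (U s) (U t x) = U t (adj (U s) x)"
proof -
  have "U t x = U s (U t (adj (U s) x))" using U_commute[of s t "adj (U s) x"] assms by simp
  then show ?thesis using assms by (metis unitary_U unitary_adj_apply)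
qed

definition W :: "real \<Rightarrow> 'h op" where
  "W t = (if 0 < t then U t else if t = 0 then id_blinfun else adj (U (- t)))"

lemma unitary_W [simp]: "unitary (W t)"
  by (auto simp: W_def)

text \<open>Any real time is a difference of positive ones, and the value of \<open>W\<close> does
  not depend on the representation. This frees \<open>W_plus\<close> from a case distinction on
  signs.\<close>

lemma W_diff:
  assumes a: "0 < a" and b: "0 < b"
  shows "W (a - b) x = U a (adj (U b) x)"
proof -
  consider "a > b" | "a = b" | "a < b" by linarith
  then show ?thesis
  proof cases
    case 1
    have "U a y = U (a - b) (U b y)" for y using U_plus[of "a - b" b] 1 b by simp
    then show ?thesis using 1 b by (simp add: W_def)
  next
    case 2
    then show ?thesis using b by (simp add: W_def)
  next
    case 3
    have "U b = U (b - a) o\<^sub>L U a" using U_plus[of "b - a" a] 3 a by simp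
    then have "adj (U b) = adj (U a) o\<^sub>L adj (U (b - a))" using 3 a by (simp add: adj_compose)
    then show ?thesis using 3 a by (simp add: W_def)
  qed
qed

lemma W_plus: "W (s + t) = W s o\<^sub>L W t"
proof (rule blinfun_eqI)
  fix x
  \<comment> \<open>Adding 1 to the absolute values makes all four times strictly positive.\<close>
  define a b c d where "a = \<bar>s\<bar> + 1" and "b = a - s" and "c = \<bar>t\<bar> + 1" and "d = c - t"
  note defs = a_def b_def c_def d_def
  have pos: "0 < a" "0 < b" "0 < c" "0 < d" by (auto simp: defs)
  have adj: "adj (U (d + b)) = adj (U b) o\<^sub>L adj (U d)"
    using pos by (simp add: U_plus adj_compose)
  have "W (s + t) x = W ((a + c) - (d + b)) x" by (simp add: defs)
  also have "\<dots> = U a (U c (adj (U b) (adj (U d) x)))"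
    using pos W_diff[of "a + c" "d + b" x] adj U_plus[of a c] by simp
  also have "\<dots> = U a (adj (U b) (U c (adj (U d) x)))" using pos by (simp add: adj_U_commute)
  also have "\<dots> = W s (W t x)" using W_diff[of a b] W_diff[of c d] pos by (simp add: defs)
  finally show "W (s + t) x = (W s o\<^sub>L W t) x" by simp
qed

lemma W_dist: "dist (W s x) (W t x) = dist (W \<bar>s - t\<bar> x) x"
proof -
  have *: "dist (W s x) (W t x) = dist (W (s - t) x) x" for s t
  proof -
    have "W s x = W t (W (s - t) x)" using W_plus[of t "s - t"] by simp
    then show ?thesis using unitary_norm[OF unitary_W, of t "W (s - t) x - x"]
      by (simp add: dist_norm blinfun.diff_right)
  qed
  show ?thesis using *[of s t] *[of t s] by (cases "s \<ge> t") (auto simp: dist_commute abs_if)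
qed

lemma W_continuous: "continuous_on UNIV (\<lambda>t. W t x)"
  unfolding continuous_on_iff
proof (intro ballI allI impI)
  fix t \<epsilon> :: real assume e: "0 < \<epsilon>"
  obtain \<delta> where \<delta>: "\<delta> > 0" "\<And>s. 0 < s \<Longrightarrow> s < \<delta> \<Longrightarrow> dist (U s x) x < \<epsilon>"
    using tendstoD[OF right_cont e, of x] unfolding eventually_at_right_field by auto
  have "dist (W t' x) (W t x) < \<epsilon>" if "dist t' t < \<delta>" for t'
    unfolding W_dist using \<delta>(2)[of "\<bar>t' - t\<bar>"] that e by (auto simp: W_def dist_real_def)
  then show "\<exists>d>0. \<forall>t'\<in>UNIV. dist t' t < d \<longrightarrow> dist (W t' x) (W t x) < \<epsilon>" using \<delta>(1) by blast
qed

lemma W_group: "unitary_group W"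
  by (auto simp: unitary_group_def W_plus W_continuous) (simp add: W_def)

lemma U_continuous: "continuous_on {0<..} (\<lambda>t. U t x)"
proof -
  have "continuous_on {0<..} (\<lambda>t. W t x)" by (rule continuous_on_subset[OF W_continuous]) auto
  then show ?thesis by (rule continuous_on_cong[THEN iffD1, rotated 2]) (auto simp: W_def)
qed

end

lemma unitary_group_minus:
  assumes "unitary_group V" shows "V (- t) = adj (V t)"
proof (rule blinfun_eqI)
  fix x
  have u: "unitary (V s)" for s using assms by (simp add: unitary_group_def)
  have "V (t + - t) = V t o\<^sub>L V (- t)" "V 0 = id_blinfun" using assms unfolding unitary_group_def by blast+
  then have "V t o\<^sub>L V (- t) = id_blinfun" by simp
  from blinfun_apply_cong[OF this, of x] have "adj (V t) (V t (V (- t) x)) = adj (V t) x" by simp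
  then show "V (- t) x = adj (V t) x" using u[of t] by simp
qed

lemma unitary_group_unique:
  assumes V: "unitary_group V" and W: "unitary_group W" and eq: "\<And>t. 0 < t \<Longrightarrow> V t = W t"
  shows "V = W"
proof
  fix t :: real
  consider "t > 0" | "t = 0" | "- t > 0" by linarith
  then show "V t = W t"
  proof cases
    case 2
    then show ?thesis using V W by (simp add: unitary_group_def)
  next
    case 3
    then show ?thesis using unitary_group_minus[OF V, of "- t"] unitary_group_minus[OF W, of "- t"] eq[of "- t"] by simp
  qed (rule eq)
qed

subsection \<open>Rank one operators\<close>

definition rank_one :: "'h::complex_hilbert \<Rightarrow> 'h \<Rightarrow> 'h op" where
  "rank_one x z = Blinfun (\<lambda>y. cinner y z *\<^sub>C x)"

lemma rank_one_apply [simp]: "rank_one x z y = cinner y z *\<^sub>C x"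
proof -
  have "bounded_linear (\<lambda>y. cinner y z *\<^sub>C x)"
    by (rule bounded_linear_compose[OF scaleC.bounded_linear_left cinner.bounded_linear_left])
  then show ?thesis by (simp add: rank_one_def bounded_linear_Blinfun_apply)
qed

lemma rank_one_BH [simp]: "rank_one x z \<in> BH"
  by (simp add: BH_def cinner_simps scaleC_scaleC)

lemma adj_rank_one: "adj (rank_one x z) = rank_one z x"
  by (rule adj_unique) (simp add: cinner_simps mult.commute flip: cinner_commute)

lemma compose_rank_one: "A \<in> BH \<Longrightarrow> A o\<^sub>L rank_one x z = rank_one (A x) z"
  by (rule blinfun_eqI) (simp add: BH_apply)

lemma rank_one_add: "rank_one (x + y) z = rank_one x z + rank_one y z"
  and rank_one_scale: "rank_one (c *\<^sub>C x) z = scale_op c (rank_one x z)"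
  by (rule blinfun_eqI; simp add: blinfun.add_left scaleC.add_right scaleC_scaleC mult.commute)+

text \<open>Compare both sides of the commutation with the rank one operator from \<open>z\<close>
  to \<open>x\<close>, evaluated at \<open>z\<close>.\<close>

lemma commuting_with_BH_scalar:
  assumes T: "T \<in> BH" and comm: "\<And>A. A \<in> BH \<Longrightarrow> T o\<^sub>L A = A o\<^sub>L T" and z: "norm z = 1"
  shows "T x = cinner (T z) z *\<^sub>C x"
proof -
  have "cinner z z = 1" using z by (simp add: cinner_self)
  then show ?thesis using blinfun_apply_cong[OF comm[of "rank_one x z"], of z] by (simp add: BH_apply T)
qed

lemma conj_by_compose:
  assumes "V \<in> BH" "W \<in> BH" shows "conj_by (V o\<^sub>L W) A = conj_by V (conj_by W A)"
  using assms by (auto intro!: blinfun_eqI simp: conj_by_def adj_compose)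

lemma conj_by_adj: "unitary V \<Longrightarrow> conj_by (adj V) (conj_by V A) = A"
  by (auto intro!: blinfun_eqI simp: conj_by_def)

text \<open>\<open>adj V o\<^sub>L W\<close> commutes with all of \<open>BH\<close>, so it is a
  scalar; the unit vector \<open>z\<close> reads it off and shows that it has modulus 1.\<close>

lemma implementers_proportional:
  assumes V: "unitary V" and W: "unitary W" and eq: "\<And>A. A \<in> BH \<Longrightarrow> conj_by V A = conj_by W A"
    and z: "norm z = 1"
  shows "W x = cinner (W z) (V z) *\<^sub>C V x" and "cmod (cinner (W z) (V z)) = 1"
proof -
  let ?T = "adj V o\<^sub>L W"
  have "?T o\<^sub>L A = A o\<^sub>L ?T" if A: "A \<in> BH" for A
  proof (rule blinfun_eqI)
    fix x
    have "V (A (adj V (W x))) = W (A (adj W (W x)))"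
      using blinfun_apply_cong[OF eq[OF A], of "W x"] by (simp add: conj_by_def)
    then have "adj V (V (A (adj V (W x)))) = adj V (W (A x))" using W by simp
    then show "(?T o\<^sub>L A) x = (A o\<^sub>L ?T) x" using V by simp
  qed
  then have T: "?T x = cinner (?T z) z *\<^sub>C x" for x
    by (rule commuting_with_BH_scalar[OF _ _ z, rotated]) (use V W in auto)
  have W': "W x = cinner (W z) (V z) *\<^sub>C V x" for x
  proof -
    have "cinner (?T z) z = cinner (W z) (V z)" using V by (simp add: cinner_adj_left)
    with T[of x] have "?T x = cinner (W z) (V z) *\<^sub>C x" by (simp only:)
    then have "V (?T x) = cinner (W z) (V z) *\<^sub>C V x" using V by (simp only: BH_apply unitary_BH)
    then show ?thesis using V by simp
  qed
  then show "W x = cinner (W z) (V z) *\<^sub>C V x" .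
  have "norm (W z) = norm (cinner (W z) (V z) *\<^sub>C V z)" by (rule arg_cong[OF W'])
  then show "cmod (cinner (W z) (V z)) = 1"
    using V W z by (simp add: norm_scaleC)
qed

subsection \<open>Automorphism groups are implemented by unitary groups\<close>

text \<open>Locally, \<open>x \<mapsto> \<gamma>\<^sub>t(x \<otimes> \<xi>\<^sup>*)\<xi>\<close> is a multiple of a unitary implementing \<open>\<gamma>\<^sub>t\<close>. Repeating such a family
  on \<open>[0, \<delta>]\<close> with period \<open>\<delta>\<close> yields a projective semigroup whose multiplier is \<open>\<delta>\<close>-periodic and
  close to \<open>1\<close>; averaging the logarithm of the multiplier over a period trivializes it.\<close>

locale aut_group =
  fixes \<gamma> :: "real \<Rightarrow> 'h::complex_hilbert op \<Rightarrow> 'h op" and \<xi> :: 'h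
  assumes ag: "automorphism_group \<gamma>" and \<xi>: "norm \<xi> = 1"
begin

lemma gamma_BH [simp]: "A \<in> BH \<Longrightarrow> \<gamma> t A \<in> BH"
  and gamma_add: "A \<in> BH \<Longrightarrow> B \<in> BH \<Longrightarrow> \<gamma> t (A + B) = \<gamma> t A + \<gamma> t B"
  and gamma_scale: "A \<in> BH \<Longrightarrow> \<gamma> t (scale_op c A) = scale_op c (\<gamma> t A)"
  and gamma_mult: "A \<in> BH \<Longrightarrow> B \<in> BH \<Longrightarrow> \<gamma> t (A o\<^sub>L B) = \<gamma> t A o\<^sub>L \<gamma> t B"
  and gamma_adj: "A \<in> BH \<Longrightarrow> \<gamma> t (adj A) = adj (\<gamma> t A)"
  and gamma_0: "A \<in> BH \<Longrightarrow> \<gamma> 0 A = A"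
  and gamma_plus: "A \<in> BH \<Longrightarrow> \<gamma> (s + t) A = \<gamma> s (\<gamma> t A)"
  and gamma_continuous: "A \<in> BH \<Longrightarrow> continuous_on UNIV (\<lambda>t. cinner (\<gamma> t A x) y)"
  using ag by (auto simp: automorphism_group_def star_endo_def clinear_on_def image_subset_iff)

lemma gamma_surj: "B \<in> BH \<Longrightarrow> \<exists>A\<in>BH. \<gamma> t A = B"
proof -
  assume "B \<in> BH"
  then have "B \<in> \<gamma> t ` BH" using ag by (simp add: automorphism_group_def bij_betw_def)
  then show ?thesis by auto
qed

lemma \<xi>\<xi>: "cinner \<xi> \<xi> = 1"
  using \<xi> by (simp add: cinner_self)

definition N :: "real \<Rightarrow> real" where "N t = Re (cinner (\<gamma> t (rank_one \<xi> \<xi>) \<xi>) \<xi>)"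

text \<open>The product of \<open>adj (rank_one y \<xi>)\<close> and \<open>rank_one x \<xi>\<close>
  is a multiple of the projection onto \<xi>, which leaves a single number to compute.\<close>

lemma gamma_rank_one_cinner:
  "cinner (\<gamma> t (rank_one x \<xi>) \<xi>) (\<gamma> t (rank_one y \<xi>) \<xi>) = of_real (N t) * cinner x y"
proof -
  have rr: "adj (rank_one y \<xi>) o\<^sub>L rank_one x \<xi> = scale_op (cinner x y) (rank_one \<xi> \<xi>)" for x y
    by (rule blinfun_eqI) (simp add: adj_rank_one cinner_simps scaleC_scaleC mult.commute)
  have gen: "cinner (\<gamma> t (rank_one x \<xi>) \<xi>) (\<gamma> t (rank_one y \<xi>) \<xi>) =
      cinner x y * cinner (\<gamma> t (rank_one \<xi> \<xi>) \<xi>) \<xi>" for x y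
  proof -
    have "cinner (\<gamma> t (rank_one x \<xi>) \<xi>) (\<gamma> t (rank_one y \<xi>) \<xi>) =
        cinner (\<gamma> t (adj (rank_one y \<xi>) o\<^sub>L rank_one x \<xi>) \<xi>) \<xi>"
      by (simp add: gamma_mult gamma_adj cinner_adj_left)
    also have "\<dots> = cinner x y * cinner (\<gamma> t (rank_one \<xi> \<xi>) \<xi>) \<xi>"
      by (simp add: rr gamma_scale cinner_simps)
    finally show ?thesis .
  qed
  \<comment> \<open>Taking \<open>x\<close> and \<open>y\<close> to be \<xi> exhibits this number as
    a squared norm; in particular it is real, hence equal to \<open>N t\<close>.\<close>
  have "cinner (\<gamma> t (rank_one \<xi> \<xi>) \<xi>) \<xi> =
      cinner (\<gamma> t (rank_one \<xi> \<xi>) \<xi>) (\<gamma> t (rank_one \<xi> \<xi>) \<xi>)"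
    using gen[of \<xi> \<xi>] by (simp only: \<xi>\<xi> mult_1)
  then have "cinner (\<gamma> t (rank_one \<xi> \<xi>) \<xi>) \<xi> = of_real (N t)"
    unfolding N_def cinner_self by simp
  then show ?thesis by (simp add: gen)
qed

lemma N_continuous: "continuous_on UNIV N"
  unfolding N_def by (intro continuous_intros gamma_continuous) auto

lemma N_0: "N 0 = 1"
  by (simp add: N_def gamma_0 \<xi>\<xi>)

definition L :: "real \<Rightarrow> 'h op" where
  "L t = Blinfun (\<lambda>x. (1 / sqrt (N t)) *\<^sub>R \<gamma> t (rank_one x \<xi>) \<xi>)"

text \<open>After normalization by \<open>N t\<close> the map is isometric, and it intertwines
  \<open>A\<close> with \<open>\<gamma> t A\<close> because
  \<open>A o\<^sub>L rank_one x \<xi>\<close> is \<open>rank_one (A x) \<xi>\<close>. It is onto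
  because \<open>\<gamma> t\<close> is: some \<open>A\<close> is mapped to the rank one operator
  that sends \<open>L t \<xi>\<close> to a given \<open>y\<close>.\<close>

lemma
  assumes t: "0 < N t"
  shows L_apply: "L t x = (1 / sqrt (N t)) *\<^sub>R \<gamma> t (rank_one x \<xi>) \<xi>"
    and L_unitary: "unitary (L t)"
    and L_implements: "A \<in> BH \<Longrightarrow> \<gamma> t A = conj_by (L t) A"
proof -
  let ?l = "\<lambda>x. (1 / sqrt (N t)) *\<^sub>R \<gamma> t (rank_one x \<xi>) \<xi>"
  have inn: "cinner (?l x) (?l y) = cinner x y" for x y
  proof -
    have "cinner (?l x) (?l y) = of_real ((1 / sqrt (N t)) * (1 / sqrt (N t)) * N t) * cinner x y"
      unfolding cinner.scaleR_left cinner.scaleR_right gamma_rank_one_cinner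
      by (simp only: scaleR_conv_of_real of_real_mult mult.assoc)
    also have "(1 / sqrt (N t)) * (1 / sqrt (N t)) * N t = 1" using t by simp
    finally show ?thesis by simp
  qed
  have nl: "norm (?l x) = norm x" for x by (rule norm_eq_of_cinner) (rule inn)
  have sc: "?l (c *\<^sub>C x) = c *\<^sub>C ?l x" for c x
    by (simp add: rank_one_scale gamma_scale scaleR_eq_scaleC scaleC_scaleC mult.commute)
  have "bounded_linear ?l"
  proof (rule bounded_linear_intro[where K=1])
    show "?l (x + y) = ?l x + ?l y" for x y
      by (simp add: rank_one_add gamma_add blinfun.add_left scaleR_add_right)
    show "?l (r *\<^sub>R x) = r *\<^sub>R ?l x" for r x using sc[of "of_real r" x] by (simp add: scaleC_of_real)
    show "norm (?l x) \<le> norm x * 1" for x using nl[of x] by simp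
  qed
  then show ap: "L t x = ?l x" for x by (simp add: L_def bounded_linear_Blinfun_apply)
  have LA: "L t (A x) = \<gamma> t A (L t x)" if "A \<in> BH" for A x
    using that by (simp add: ap gamma_mult blinfun.scaleR_right flip: compose_rank_one)
  show u: "unitary (L t)"
  proof (rule unitaryI)
    show "L t \<in> BH" by (simp add: BH_def ap sc)
    show "norm (L t x) = norm x" for x unfolding ap by (rule nl)
    fix y
    obtain A where A: "A \<in> BH" "\<gamma> t A = rank_one y (L t \<xi>)" using gamma_surj[of "rank_one y (L t \<xi>)"] by auto
    have "cinner (L t \<xi>) (L t \<xi>) = 1" using inn[of \<xi> \<xi>] by (simp add: ap \<xi>\<xi>)
    then have "L t (A \<xi>) = y" by (simp add: LA A)
    then show "\<exists>x. L t x = y" by blast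
  qed
  show "\<gamma> t A = conj_by (L t) A" if "A \<in> BH"
    using that u by (intro blinfun_eqI) (simp add: conj_by_def LA)
qed

lemma L_0: "L 0 = id_blinfun"
  by (rule blinfun_eqI) (simp add: L_apply N_0 gamma_0 \<xi>\<xi>)

text \<open>Weak continuity comes from that of \<gamma>; the norms are constant in \<open>t\<close>
  by unitarity.\<close>

lemma L_continuous:
  assumes S: "\<And>t. t \<in> S \<Longrightarrow> 0 < N t"
  shows "continuous_on S (\<lambda>t. L t x)"
  unfolding continuous_on_def
proof
  fix s assume s: "s \<in> S"
  show "((\<lambda>t. L t x) \<longlongrightarrow> L s x) (at s within S)"
  proof (rule tendsto_of_weak_norm)
    have "continuous_on S (\<lambda>t. cinner ((1 / sqrt (N t)) *\<^sub>R \<gamma> t (rank_one x \<xi>) \<xi>) (L s x))"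
      unfolding cinner.scaleR_left using S
      by (intro continuous_intros continuous_on_subset[OF N_continuous]
          continuous_on_subset[OF gamma_continuous]) force+
    then have "continuous_on S (\<lambda>t. cinner (L t x) (L s x))"
      by (rule continuous_on_cong[THEN iffD1, rotated 2]) (auto simp: L_apply S)
    then show "((\<lambda>t. cinner (L t x) (L s x)) \<longlongrightarrow> cinner (L s x) (L s x)) (at s within S)"
      using s by (auto simp: continuous_on_def)
    show "((\<lambda>t. norm (L t x)) \<longlongrightarrow> norm (L s x)) (at s within S)"
    proof (rule tendsto_eventually)
      have "norm (L t x) = norm (L s x)" if "t \<in> S" for t using that s S by (simp add: L_unitary)
      then show "\<forall>\<^sub>F t in at s within S. norm (L t x) = norm (L s x)"
        by (auto simp: eventually_at_filter)
    qed
  qed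
qed

text \<open>The bound \<open>1 / 4\<close> is dictated by \<open>\<omega>_near_1_small\<close>,
  where such deviations add up to less than 1. Positivity of \<open>N\<close> near 0 comes from
  \<open>N 0 = 1\<close>.\<close>

lemma local_radius_exists:
  obtains \<delta> where "0 < \<delta>" "\<And>t. 0 \<le> t \<Longrightarrow> t \<le> \<delta> \<Longrightarrow> 0 < N t \<and> norm (L t \<xi> - \<xi>) < 1 / 4"
proof -
  have "\<forall>\<^sub>F t in at 0. dist (N t) (N 0) < 1"
    using N_continuous by (intro tendstoD) (auto simp: continuous_on_def)
  then obtain d where d: "d > 0" "\<And>t. t \<noteq> 0 \<Longrightarrow> dist t 0 < d \<Longrightarrow> dist (N t) 1 < 1"
    by (auto simp: eventually_at N_0)
  have pos: "0 < N t" if "\<bar>t\<bar> < d" for t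
    using d(2)[of t] that by (cases "t = 0") (auto simp: N_0 dist_real_def)
  have "continuous_on {-d<..<d} (\<lambda>t. L t \<xi>)" by (rule L_continuous) (auto intro: pos)
  then have "((\<lambda>t. L t \<xi>) \<longlongrightarrow> L 0 \<xi>) (at 0)"
    using d(1) by (auto simp: continuous_on_def at_within_open[of 0 "{-d<..<d}"] dest!: bspec[of _ _ 0])
  then have "\<forall>\<^sub>F t in at 0. dist (L t \<xi>) \<xi> < 1 / 4" by (intro tendstoD) (auto simp: L_0)
  then obtain d' where d': "d' > 0" "\<And>t. t \<noteq> 0 \<Longrightarrow> dist t 0 < d' \<Longrightarrow> dist (L t \<xi>) \<xi> < 1 / 4"
    by (auto simp: eventually_at)
  have "0 < N t \<and> norm (L t \<xi> - \<xi>) < 1 / 4" if "0 \<le> t" "t \<le> min d d' / 2" for t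
    using pos[of t] d'(2)[of t] that d d'(1) by (cases "t = 0") (auto simp: L_0 dist_norm N_0)
  then show ?thesis using that[of "min d d' / 2"] d(1) d'(1) by auto
qed

definition \<delta> :: real where
  "\<delta> = (SOME d. 0 < d \<and> (\<forall>t. 0 \<le> t \<longrightarrow> t \<le> d \<longrightarrow> 0 < N t \<and> norm (L t \<xi> - \<xi>) < 1 / 4))"

lemma \<delta>_pos: "0 < \<delta>"
  and N_pos: "0 \<le> t \<Longrightarrow> t \<le> \<delta> \<Longrightarrow> 0 < N t"
  and L_near: "0 \<le> t \<Longrightarrow> t \<le> \<delta> \<Longrightarrow> norm (L t \<xi> - \<xi>) < 1 / 4"
proof -
  have "\<exists>d. 0 < d \<and> (\<forall>t. 0 \<le> t \<longrightarrow> t \<le> d \<longrightarrow> 0 < N t \<and> norm (L t \<xi> - \<xi>) < 1 / 4)"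
    by (rule local_radius_exists) blast
  then have d: "0 < \<delta> \<and> (\<forall>t. 0 \<le> t \<longrightarrow> t \<le> \<delta> \<longrightarrow> 0 < N t \<and> norm (L t \<xi> - \<xi>) < 1 / 4)"
    unfolding \<delta>_def by (rule someI_ex)
  then show "0 < \<delta>" by blast
  show "0 \<le> t \<Longrightarrow> t \<le> \<delta> \<Longrightarrow> 0 < N t" "0 \<le> t \<Longrightarrow> t \<le> \<delta> \<Longrightarrow> norm (L t \<xi> - \<xi>) < 1 / 4"
    using d by blast+
qed

end

section \<open>Extending the local implementers periodically\<close>

fun opow :: "'h::complex_hilbert op \<Rightarrow> nat \<Rightarrow> 'h op" where
  "opow T 0 = id_blinfun"
| "opow T (Suc n) = T o\<^sub>L opow T n"

lemma opow_add: "opow T (m + n) = opow T m o\<^sub>L opow T n"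
  by (induction m) (simp_all add: compose_assoc)

lemma unitary_opow: "unitary T \<Longrightarrow> unitary (opow T n)"
  by (induction n) auto

lemma opow_commute: "opow T m (opow T n x) = opow T n (opow T m x)"
  using opow_add[of T m n] opow_add[of T n m] by (metis add.commute blinfun_apply_blinfun_compose)

context aut_group begin

definition impl :: "real \<Rightarrow> 'h op \<Rightarrow> bool" where
  "impl t W \<longleftrightarrow> unitary W \<and> (\<forall>A\<in>BH. \<gamma> t A = conj_by W A)"

lemma impl_unitary: "impl t W \<Longrightarrow> unitary W"
  by (simp add: impl_def)

lemma impl_compose: "impl s V \<Longrightarrow> impl t W \<Longrightarrow> impl (s + t) (V o\<^sub>L W)"
  unfolding impl_def
proof (elim conjE, intro conjI ballI)
  fix A assume V: "unitary V" "\<forall>A\<in>BH. \<gamma> s A = conj_by V A" and W: "unitary W" "\<forall>A\<in>BH. \<gamma> t A = conj_by W A"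
    and A: "A \<in> (BH :: 'h op set)"
  have "conj_by W A \<in> BH" using W(1) A by (simp add: conj_by_def)
  then show "\<gamma> (s + t) A = conj_by (V o\<^sub>L W) A"
    using V W A by (simp add: gamma_plus conj_by_compose)
qed auto

lemma impl_unique:
  assumes "impl t V" "impl t W"
  shows "W x = cinner (W \<xi>) (V \<xi>) *\<^sub>C V x" "cmod (cinner (W \<xi>) (V \<xi>)) = 1"
proof -
  have eq: "conj_by V A = conj_by W A" if "A \<in> BH" for A using assms that by (simp add: impl_def)
  show "W x = cinner (W \<xi>) (V \<xi>) *\<^sub>C V x" "cmod (cinner (W \<xi>) (V \<xi>)) = 1"
    by (rule implementers_proportional[OF impl_unitary[OF assms(1)] impl_unitary[OF assms(2)] eq \<xi>]; assumption)+
qed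

definition D :: "'h op" where "D = L \<delta>"

definition V :: "real \<Rightarrow> 'h op" where
  "V t = opow D (nat \<lfloor>t / \<delta>\<rfloor>) o\<^sub>L L (t - \<delta> * real (nat \<lfloor>t / \<delta>\<rfloor>))"

lemma impl_L: "0 \<le> t \<Longrightarrow> t \<le> \<delta> \<Longrightarrow> impl t (L t)"
  by (simp add: impl_def L_unitary L_implements N_pos)

text \<open>Allowing the right endpoint \<open>r = \<delta>\<close> means that the formulas of
  consecutive periods agree where they meet, since \<open>L \<delta>\<close> is \<open>D\<close> and
  \<open>L 0\<close> is the identity. This gives continuity of \<open>V\<close> at the
  breakpoints.\<close>

lemma V_eq:
  assumes r: "0 \<le> r" "r \<le> \<delta>"
  shows "V (\<delta> * real n + r) = opow D n o\<^sub>L L r"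
proof (cases "r = \<delta>")
  case False
  then have "\<lfloor>(\<delta> * real n + r) / \<delta>\<rfloor> = int n"
    using r \<delta>_pos by (intro floor_unique) (auto simp: field_simps)
  then show ?thesis by (simp add: V_def)
next
  case True
  then have "\<lfloor>(\<delta> * real n + r) / \<delta>\<rfloor> = int (Suc n)"
    using \<delta>_pos by (intro floor_unique) (auto simp: field_simps)
  then have "nat \<lfloor>(\<delta> * real n + r) / \<delta>\<rfloor> = Suc n" by simp
  then have "V (\<delta> * real n + r) = opow D (Suc n) o\<^sub>L L (\<delta> * real n + r - \<delta> * real (Suc n))"
    unfolding V_def by (simp only:)
  also have "\<delta> * real n + r - \<delta> * real (Suc n) = 0" using True by (simp add: algebra_simps)
  also have "opow D (Suc n) = opow D n o\<^sub>L D" using opow_add[of D n 1] by simp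
  finally show ?thesis using True by (simp add: L_0 D_def)
qed

lemma time_decomposition:
  assumes "0 \<le> t"
  obtains n r where "0 \<le> r" "r < \<delta>" "t = \<delta> * real n + r"
proof -
  let ?n = "nat \<lfloor>t / \<delta>\<rfloor>"
  have n: "real ?n = of_int \<lfloor>t / \<delta>\<rfloor>" using assms \<delta>_pos by simp
  have "of_int \<lfloor>t / \<delta>\<rfloor> \<le> t / \<delta>" "t / \<delta> < of_int \<lfloor>t / \<delta>\<rfloor> + 1" by linarith+
  then have "\<delta> * real ?n \<le> t" "t < \<delta> * (real ?n + 1)"
    unfolding n using \<delta>_pos by (simp_all only: pos_le_divide_eq pos_divide_less_eq mult.commute)
  then have "\<delta> * real ?n \<le> t" "t < \<delta> * real ?n + \<delta>" by (simp_all add: distrib_left)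
  then show ?thesis using that[of "t - \<delta> * real ?n" ?n] by auto
qed

lemma V_small: "0 \<le> t \<Longrightarrow> t \<le> \<delta> \<Longrightarrow> V t = L t"
  using V_eq[of t 0] by simp

lemma V_0: "V 0 = id_blinfun"
  using V_small[of 0] \<delta>_pos by (simp add: L_0)

lemma V_shift: "0 \<le> t \<Longrightarrow> V (t + \<delta>) = D o\<^sub>L V t"
proof -
  assume "0 \<le> t"
  then obtain n r where r: "0 \<le> r" "r < \<delta>" "t = \<delta> * real n + r" by (rule time_decomposition) auto
  have "V (t + \<delta>) = V (\<delta> * real (Suc n) + r)" using r by (simp add: algebra_simps)
  also have "\<dots> = D o\<^sub>L V t" using r V_eq[of r "Suc n"] V_eq[of r n] by (simp add: compose_assoc)
  finally show ?thesis .
qed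

lemma impl_D: "impl \<delta> D"
  using impl_L[of \<delta>] \<delta>_pos by (simp add: D_def)

lemma impl_opow: "impl t W \<Longrightarrow> impl (t * real n) (opow W n)"
proof (induction n)
  case 0
  show ?case by (auto simp: impl_def gamma_0 conj_by_def)
next
  case (Suc n)
  then show ?case using impl_compose[of t W "t * real n" "opow W n"] by (simp add: algebra_simps)
qed

lemma impl_V: "0 \<le> t \<Longrightarrow> impl t (V t)"
proof -
  assume "0 \<le> t"
  then obtain n r where r: "0 \<le> r" "r < \<delta>" "t = \<delta> * real n + r" by (rule time_decomposition) auto
  then show ?thesis using impl_compose[OF impl_opow[OF impl_D, of n] impl_L[of r]] V_eq[of r n] by simp
qed

lemma V_unitary [simp]: "0 \<le> t \<Longrightarrow> unitary (V t)"
  using impl_V impl_unitary by blast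

lemma V_continuous: "continuous_on {0..} (\<lambda>t. V t x)"
proof -
  have piece: "continuous_on {\<delta> * real n..\<delta> * real n + \<delta>} (\<lambda>t. V t x)" for n
  proof -
    have "continuous_on {0..\<delta>} (\<lambda>r. L r x)" by (rule L_continuous) (auto intro: N_pos)
    then have "continuous_on {\<delta> * real n..\<delta> * real n + \<delta>} (\<lambda>t. L (t - \<delta> * real n) x)"
      by (rule continuous_on_compose2) (auto intro!: continuous_intros)
    then have "continuous_on {\<delta> * real n..\<delta> * real n + \<delta>} (\<lambda>t. opow D n (L (t - \<delta> * real n) x))"
      by (rule blinfun.continuous_on[OF continuous_on_const])
    moreover have "opow D n (L (t - \<delta> * real n) x) = V t x" if "t \<in> {\<delta> * real n..\<delta> * real n + \<delta>}" for t
      using V_eq[of "t - \<delta> * real n" n] that by simp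
    ultimately show ?thesis by (rule continuous_on_eq)
  qed
  have fin: "continuous_on {0..\<delta> * real n} (\<lambda>t. V t x)" for n
  proof (induction n)
    case (Suc n)
    have "{0..\<delta> * real n} \<union> {\<delta> * real n..\<delta> * real n + \<delta>} = {0..\<delta> * real n + \<delta>}"
      using \<delta>_pos by (intro ivl_disj_un_two_touch) auto
    moreover have "\<delta> * real (Suc n) = \<delta> * real n + \<delta>" by (simp add: algebra_simps)
    ultimately show ?case using continuous_on_closed_Un[OF _ _ Suc piece[of n]] by simp
  qed simp
  show ?thesis
    unfolding continuous_on_def
  proof
    fix s :: real assume s: "s \<in> {0..}"
    obtain n where n: "s < real n * \<delta>" using reals_Archimedean3[OF \<delta>_pos] by blast
    have "at s within {0..} = at s within {0..\<delta> * real n}"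
      by (rule at_within_nhd[of s "{..<\<delta> * real n}"]) (use n in \<open>auto simp: mult.commute\<close>)
    then show "((\<lambda>t. V t x) \<longlongrightarrow> V s x) (at s within {0..})"
      using fin[of n] s n by (auto simp: continuous_on_def mult.commute)
  qed
qed

lemma V_proportional:
  assumes "0 \<le> s" "0 \<le> t"
  shows "V s (V t x) = cinner (V s (V t \<xi>)) (V (s + t) \<xi>) *\<^sub>C V (s + t) x"
    "cmod (cinner (V s (V t \<xi>)) (V (s + t) \<xi>)) = 1"
proof -
  have st: "0 \<le> s + t" using assms by simp
  note u = impl_unique[OF impl_V[OF st] impl_compose[OF impl_V[OF assms(1)] impl_V[OF assms(2)]]]
  show "V s (V t x) = cinner (V s (V t \<xi>)) (V (s + t) \<xi>) *\<^sub>C V (s + t) x"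
    using u(1)[of x] unfolding blinfun_apply_blinfun_compose .
  show "cmod (cinner (V s (V t \<xi>)) (V (s + t) \<xi>)) = 1"
    using u(2) unfolding blinfun_apply_blinfun_compose .
qed

text \<open>At \<open>s = \<delta> * m / n\<close> both \<open>D\<close> and \<open>V s\<close> are
  scalar multiples of powers of the single operator \<open>V (\<delta> / n)\<close>, so they
  commute; strong continuity of \<open>V\<close> carries this to all \<open>s\<close>.\<close>

lemma D_commute:
  assumes s: "0 \<le> s"
  shows "D (V s x) = V s (D x)"
proof -
  have rat: "D (V (\<delta> * real m / real n) x) = V (\<delta> * real m / real n) (D x)" if n: "0 < n" for m n
  proof -
    define r where "r = \<delta> / real n"
    have r: "0 \<le> r" using \<delta>_pos by (simp add: r_def)
    have p: "\<exists>c. \<forall>y. V (r * real k) y = c *\<^sub>C opow (V r) k y" for k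
    proof -
      have "0 \<le> r * real k" using r by simp
      from impl_unique(1)[OF impl_opow[OF impl_V[OF r], of k] impl_V[OF this]] show ?thesis by blast
    qed
    obtain c where c: "\<And>y. V (r * real m) y = c *\<^sub>C opow (V r) m y" using p by blast
    obtain d where d: "\<And>y. V (r * real n) y = d *\<^sub>C opow (V r) n y" using p by blast
    have "r * real n = \<delta>" using n by (simp add: r_def)
    then have D: "D y = d *\<^sub>C opow (V r) n y" for y
      using d[of y] V_small[of \<delta>] \<delta>_pos by (simp add: D_def)
    have m: "\<delta> * real m / real n = r * real m" by (simp add: r_def)
    have BH: "opow (V r) k \<in> BH" for k using unitary_opow[OF V_unitary[OF r]] by simp
    show ?thesis
      unfolding m c D using opow_commute[of "V r" n m x]
      by (simp add: BH_apply[OF BH] scaleC_scaleC mult.commute)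
  qed
  \<comment> \<open>Rational multiples of \<delta>, nonnegative and at most
    \<open>\<delta> / Suc n\<close> below \<open>s\<close>.\<close>
  define q where "q n = \<delta> * real (nat \<lfloor>real (Suc n) * (s / \<delta>)\<rfloor>) / real (Suc n)" for n
  have q0: "0 \<le> q n" for n using \<delta>_pos by (simp add: q_def)
  have qb: "s - \<delta> / real (Suc n) \<le> q n \<and> q n \<le> s" for n
  proof -
    let ?k = "real (Suc n)"
    have nn: "real (nat \<lfloor>?k * (s / \<delta>)\<rfloor>) = of_int \<lfloor>?k * (s / \<delta>)\<rfloor>" using s \<delta>_pos by simp
    have k: "0 \<le> \<delta> / ?k" using \<delta>_pos by simp
    have "of_int \<lfloor>?k * (s / \<delta>)\<rfloor> \<le> ?k * (s / \<delta>)" "?k * (s / \<delta>) - 1 \<le> of_int \<lfloor>?k * (s / \<delta>)\<rfloor>" by linarith+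
    from this[THEN mult_left_mono, OF k]
    have "\<delta> / ?k * of_int \<lfloor>?k * (s / \<delta>)\<rfloor> \<le> \<delta> / ?k * (?k * (s / \<delta>))"
      "\<delta> / ?k * (?k * (s / \<delta>) - 1) \<le> \<delta> / ?k * of_int \<lfloor>?k * (s / \<delta>)\<rfloor>" .
    moreover have "\<delta> / ?k * (?k * (s / \<delta>)) = s" "\<delta> / ?k * (?k * (s / \<delta>) - 1) = s - \<delta> / ?k"
      using \<delta>_pos by (simp_all add: field_simps del: of_nat_Suc)
    ultimately show ?thesis unfolding q_def nn by (simp del: of_nat_Suc)
  qed
  have "q \<longlonglongrightarrow> s"
  proof (rule tendsto_sandwich)
    show "\<forall>\<^sub>F n in sequentially. s - \<delta> / real (Suc n) \<le> q n"
      by (intro always_eventually allI conjunct1[OF qb])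
    show "\<forall>\<^sub>F n in sequentially. q n \<le> s" by (intro always_eventually allI conjunct2[OF qb])
    have "(\<lambda>n. s - \<delta> * (1 / real (Suc n))) \<longlonglongrightarrow> s - \<delta> * 0"
      by (intro tendsto_intros LIMSEQ_Suc[OF lim_1_over_n])
    then show "(\<lambda>n. s - \<delta> / real (Suc n)) \<longlonglongrightarrow> s" by simp
  qed simp
  then have lim: "(\<lambda>n. V (q n) y) \<longlonglongrightarrow> V s y" for y
    by (intro continuous_on_tendsto_compose[OF V_continuous]) (use s q0 in auto)
  have "D (V (q n) x) = V (q n) (D x)" for n unfolding q_def by (rule rat) simp
  then show ?thesis
    using LIMSEQ_unique[OF blinfun.tendsto[OF tendsto_const lim[of x], of D]] lim[of "D x"] by simp
qed

section \<open>The multiplier of the projective semigroup\<close>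

definition \<omega> :: "real \<Rightarrow> real \<Rightarrow> complex" where "\<omega> s t = cinner (V s (V t \<xi>)) (V (s + t) \<xi>)"

lemma V_mult: "0 \<le> s \<Longrightarrow> 0 \<le> t \<Longrightarrow> V s (V t x) = \<omega> s t *\<^sub>C V (s + t) x"
  unfolding \<omega>_def by (rule V_proportional)

lemma \<omega>_eqI:
  assumes "0 \<le> s" "0 \<le> t" "\<And>x. V s (V t x) = c *\<^sub>C V (s + t) x"
  shows "\<omega> s t = c"
proof -
  have "cinner (V (s + t) \<xi>) (V (s + t) \<xi>) = 1" using assms(1,2) by (simp add: \<xi>\<xi>)
  then show ?thesis unfolding \<omega>_def assms(3) by (simp add: cinner_simps)
qed

lemma \<omega>_shift_left: "0 \<le> s \<Longrightarrow> 0 \<le> t \<Longrightarrow> \<omega> (s + \<delta>) t = \<omega> s t"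
proof (rule \<omega>_eqI)
  assume st: "0 \<le> s" "0 \<le> t"
  fix x
  have "s + \<delta> + t = s + t + \<delta>" by simp
  then have "V (s + \<delta> + t) x = D (V (s + t) x)" using V_shift[of "s + t"] st by (simp only:) simp
  moreover have "D \<in> BH" using impl_unitary[OF impl_D] by simp
  ultimately show "V (s + \<delta>) (V t x) = \<omega> s t *\<^sub>C V (s + \<delta> + t) x"
    using st by (simp add: V_shift V_mult BH_apply)
qed (use \<delta>_pos in auto)

text \<open>In contrast to the shift on the left, \<open>D\<close> now stands between
  \<open>V s\<close> and \<open>V t\<close> and must be pulled out by
  \<open>D_commute\<close>.\<close>

lemma \<omega>_shift_right: "0 \<le> s \<Longrightarrow> 0 \<le> t \<Longrightarrow> \<omega> s (t + \<delta>) = \<omega> s t"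
proof (rule \<omega>_eqI)
  assume st: "0 \<le> s" "0 \<le> t"
  fix x
  have "s + (t + \<delta>) = s + t + \<delta>" by simp
  then have "V (s + (t + \<delta>)) x = D (V (s + t) x)" using V_shift[of "s + t"] st by (simp only:) simp
  moreover have "D \<in> BH" using impl_unitary[OF impl_D] by simp
  ultimately have "D (V s (V t x)) = \<omega> s t *\<^sub>C V (s + (t + \<delta>)) x"
    using st by (simp only: V_mult BH_apply)
  then show "V s (V (t + \<delta>) x) = \<omega> s t *\<^sub>C V (s + (t + \<delta>)) x"
    using V_shift[OF st(2)] D_commute[OF st(1), of "V t x"] by simp
qed (use \<delta>_pos in auto)

text \<open>The deviation from 1 splits into three displacements of \<xi>, by \<open>V t\<close>,
  \<open>V s\<close> and \<open>V (s + t)\<close>. They are below \<open>1 / 4\<close>,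
  \<open>1 / 4\<close> and \<open>1 / 2\<close>; the last is larger because \<open>s + t\<close> may
  pass \<delta>, which costs one more factor \<open>D\<close>.\<close>

lemma \<omega>_near_1_small:
  assumes "0 \<le> s" "s \<le> \<delta>" "0 \<le> t" "t \<le> \<delta>"
  shows "cmod (\<omega> s t - 1) < 1"
proof -
  have near: "norm (V r \<xi> - \<xi>) < 1 / 4" if "0 \<le> r" "r \<le> \<delta>" for r
    using L_near that by (simp add: V_small)
  have near2: "norm (V (s + t) \<xi> - \<xi>) < 1 / 2"
  proof (cases "s + t \<le> \<delta>")
    case True
    then show ?thesis using near[of "s + t"] assms by simp
  next
    case False
    define r where "r = s + t - \<delta>"
    have r: "0 \<le> r" "r \<le> \<delta>" using False assms by (auto simp: r_def)
    have D: "D = V \<delta>" using V_small[of \<delta>] \<delta>_pos by (simp add: D_def)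
    have eq: "V (s + t) \<xi> - \<xi> = D (V r \<xi> - \<xi>) + (V \<delta> \<xi> - \<xi>)"
      using V_shift[OF r(1)] by (simp add: r_def blinfun.diff_right D)
    have "norm (D (V r \<xi> - \<xi>)) = norm (V r \<xi> - \<xi>)" using impl_unitary[OF impl_D] by simp
    moreover have "norm (V \<delta> \<xi> - \<xi>) < 1 / 4" using near[of \<delta>] \<delta>_pos by simp
    ultimately show ?thesis
      using near[OF r] norm_triangle_ineq[of "D (V r \<xi> - \<xi>)" "V \<delta> \<xi> - \<xi>"] unfolding eq by linarith
  qed
  have eq: "(\<omega> s t - 1) *\<^sub>C V (s + t) \<xi> = V s (V t \<xi> - \<xi>) + (V s \<xi> - \<xi>) - (V (s + t) \<xi> - \<xi>)"
    using V_mult[of s t \<xi>] assms by (simp add: scaleC.diff_left blinfun.diff_right)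
  have "cmod (\<omega> s t - 1) = norm ((\<omega> s t - 1) *\<^sub>C V (s + t) \<xi>)"
    using assms \<xi> by (simp add: norm_scaleC)
  moreover have "norm (V s (V t \<xi> - \<xi>)) = norm (V t \<xi> - \<xi>)" using assms by simp
  ultimately show ?thesis
    using near[OF assms(1,2)] near[OF assms(3,4)] near2
      norm_triangle_ineq[of "V s (V t \<xi> - \<xi>)" "V s \<xi> - \<xi>"]
      norm_triangle_ineq4[of "V s (V t \<xi> - \<xi>) + (V s \<xi> - \<xi>)" "V (s + t) \<xi> - \<xi>"]
    unfolding eq by linarith
qed

lemma \<omega>_periodic:
  assumes "0 \<le> s" "0 \<le> t"
  shows "\<omega> (\<delta> * real m + s) (\<delta> * real n + t) = \<omega> s t"
proof -
  have l: "\<omega> (\<delta> * real m + s) t = \<omega> s t" if "0 \<le> t" for t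
  proof (induction m)
    case (Suc m)
    have "\<omega> (\<delta> * real (Suc m) + s) t = \<omega> (\<delta> * real m + s + \<delta>) t" by (simp add: algebra_simps)
    also have "\<dots> = \<omega> (\<delta> * real m + s) t" using assms that \<delta>_pos by (intro \<omega>_shift_left) auto
    finally show ?case using Suc by simp
  qed simp
  have "\<omega> s (\<delta> * real n + t) = \<omega> s t"
  proof (induction n)
    case (Suc n)
    have "\<omega> s (\<delta> * real (Suc n) + t) = \<omega> s (\<delta> * real n + t + \<delta>)" by (simp add: algebra_simps)
    also have "\<dots> = \<omega> s (\<delta> * real n + t)" using assms \<delta>_pos by (intro \<omega>_shift_right) auto
    finally show ?case using Suc by simp
  qed simp
  then show ?thesis using l[of "\<delta> * real n + t"] assms \<delta>_pos by simp
qed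

lemma \<omega>_near_1: "0 \<le> s \<Longrightarrow> 0 \<le> t \<Longrightarrow> cmod (\<omega> s t - 1) < 1"
proof -
  assume st: "0 \<le> s" "0 \<le> t"
  obtain m r where r: "0 \<le> r" "r < \<delta>" "s = \<delta> * real m + r" using st(1) by (rule time_decomposition) auto
  obtain n u where u: "0 \<le> u" "u < \<delta>" "t = \<delta> * real n + u" using st(2) by (rule time_decomposition) auto
  show ?thesis using \<omega>_periodic[of r u m n] \<omega>_near_1_small[of r u] r u by simp
qed

text \<open>Isometry makes the strong continuity of \<open>V\<close> uniform enough to let the
  vector move with the parameter.\<close>

lemma V_jointly_continuous:
  fixes \<sigma> :: "'p::topological_space \<Rightarrow> real" and g :: "'p \<Rightarrow> 'h"
  assumes \<sigma>: "continuous_on S \<sigma>" "\<And>p. p \<in> S \<Longrightarrow> 0 \<le> \<sigma> p" and g: "continuous_on S g"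
  shows "continuous_on S (\<lambda>p. V (\<sigma> p) (g p))"
  unfolding continuous_on_def
proof
  fix q assume q: "q \<in> S"
  have "continuous_on S (\<lambda>p. V (\<sigma> p) (g q))"
    by (rule continuous_on_compose2[OF V_continuous \<sigma>(1)]) (use \<sigma>(2) in auto)
  then have a: "((\<lambda>p. V (\<sigma> p) (g q)) \<longlongrightarrow> V (\<sigma> q) (g q)) (at q within S)"
    using q by (auto simp: continuous_on_def)
  have gq: "((\<lambda>p. norm (g p - g q)) \<longlongrightarrow> 0) (at q within S)"
    using g q by (auto simp: continuous_on_def tendsto_norm_zero_iff LIM_zero_iff)
  have "((\<lambda>p. V (\<sigma> p) (g p - g q)) \<longlongrightarrow> 0) (at q within S)"
  proof (rule Lim_null_comparison[OF _ gq])
    have "norm (V (\<sigma> p) (g p - g q)) \<le> norm (g p - g q)" if "p \<in> S" for p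
      using \<sigma>(2)[OF that] by simp
    then show "\<forall>\<^sub>F p in at q within S. norm (V (\<sigma> p) (g p - g q)) \<le> norm (g p - g q)"
      by (auto simp: eventually_at_filter)
  qed
  from tendsto_add[OF this a] show "((\<lambda>p. V (\<sigma> p) (g p)) \<longlongrightarrow> V (\<sigma> q) (g q)) (at q within S)"
    by (simp add: blinfun.diff_right)
qed

lemma \<omega>_continuous: "continuous_on ({0..} \<times> {0..}) (\<lambda>(s, t). \<omega> s t)"
  unfolding \<omega>_def split_def
  by (intro cinner.continuous_on V_jointly_continuous continuous_intros) auto

section \<open>The logarithm of the multiplier is a coboundary\<close>

definition phase :: "real \<Rightarrow> real \<Rightarrow> real" where "phase s t = Im (Ln (\<omega> s t))"

lemma \<omega>_Re: "0 \<le> s \<Longrightarrow> 0 \<le> t \<Longrightarrow> 0 < Re (\<omega> s t)"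
  using \<omega>_near_1[of s t] abs_Re_le_cmod[of "\<omega> s t - 1"] by simp

lemma phase_bound: "0 \<le> s \<Longrightarrow> 0 \<le> t \<Longrightarrow> \<bar>phase s t\<bar> < pi / 2"
  unfolding phase_def by (intro Re_Ln_pos_lt_imp \<omega>_Re)

lemma \<omega>_phase: "0 \<le> s \<Longrightarrow> 0 \<le> t \<Longrightarrow> \<omega> s t = exp (\<i> * of_real (phase s t))"
proof -
  assume st: "0 \<le> s" "0 \<le> t"
  have n0: "\<omega> s t \<noteq> 0" using \<omega>_Re[OF st] by auto
  have "cmod (\<omega> s t) = 1" unfolding \<omega>_def by (rule V_proportional(2)[OF st])
  then have "Re (Ln (\<omega> s t)) = 0" using n0 by simp
  then have "Ln (\<omega> s t) = \<i> * of_real (phase s t)" by (simp add: complex_eq_iff phase_def)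
  then show ?thesis using exp_Ln[OF n0] by simp
qed

text \<open>Associativity of \<open>V\<close> gives the identity for \<omega>, hence for the phases
  modulo \<open>2 * pi\<close>. Each of the four phases is below \<open>pi / 2\<close> in modulus,
  so their combination \<open>d\<close> is a multiple of \<open>2 * pi\<close> smaller than
  \<open>2 * pi\<close>, that is, 0.\<close>

lemma phase_cocycle:
  assumes "0 \<le> s" "0 \<le> t" "0 \<le> r"
  shows "phase s t + phase (s + t) r = phase t r + phase s (t + r)"
proof -
  have "(\<omega> s t * \<omega> (s + t) r) *\<^sub>C V (s + t + r) \<xi> = V s (V t (V r \<xi>))"
    using assms V_mult[of s t "V r \<xi>"] V_mult[of "s + t" r \<xi>] by (simp add: scaleC_scaleC)
  also have "\<dots> = (\<omega> t r * \<omega> s (t + r)) *\<^sub>C V (s + t + r) \<xi>"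
    using assms by (simp add: V_mult BH_apply scaleC_scaleC add.assoc)
  finally have "(\<omega> s t * \<omega> (s + t) r - \<omega> t r * \<omega> s (t + r)) *\<^sub>C V (s + t + r) \<xi> = 0"
    by (simp add: scaleC.diff_left)
  then have "cmod (\<omega> s t * \<omega> (s + t) r - \<omega> t r * \<omega> s (t + r)) * norm (V (s + t + r) \<xi>) = 0"
    by (simp flip: norm_scaleC)
  then have eq: "\<omega> s t * \<omega> (s + t) r = \<omega> t r * \<omega> s (t + r)" using assms \<xi> by simp
  define d where "d = phase s t + phase (s + t) r - phase t r - phase s (t + r)"
  have "exp (\<i> * of_real d) = (\<omega> s t * \<omega> (s + t) r) / (\<omega> t r * \<omega> s (t + r))"
    using assms by (simp add: d_def \<omega>_phase exp_add exp_diff algebra_simps flip: exp_add)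
  also have "\<dots> = 1" using eq assms \<omega>_phase[of t r] \<omega>_phase[of s "t + r"] by simp
  finally have "exp (\<i> * of_real d) = 1" .
  then obtain n :: int where n: "d = of_int (2 * n) * pi" unfolding exp_eq_1 by auto
  have "\<bar>d\<bar> < 2 * pi"
    using phase_bound[of s t] phase_bound[of "s + t" r] phase_bound[of t r] phase_bound[of s "t + r"] assms
    unfolding d_def by linarith
  then have "\<bar>2 * real_of_int n\<bar> * pi < 2 * pi" by (simp add: n abs_mult)
  then have "\<bar>2 * real_of_int n\<bar> < 2" using pi_gt_zero by (simp add: mult_less_cancel_right)
  then have "n = 0" by linarith
  then show ?thesis using n by (simp add: d_def)
qed

lemma phase_continuous: "continuous_on ({0..} \<times> {0..}) (\<lambda>(s, t). phase s t)"
proof -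
  have "\<omega> s t \<notin> \<real>\<^sub>\<le>\<^sub>0" if "0 \<le> s" "0 \<le> t" for s t
    using \<omega>_Re[OF that] by (auto simp: complex_nonpos_Reals_iff)
  then show ?thesis
    unfolding phase_def split_def
    by (intro continuous_intros \<omega>_continuous[unfolded split_def]) auto
qed

lemma phase_continuous_right: "0 \<le> s \<Longrightarrow> continuous_on {0..} (phase s)"
proof -
  assume "0 \<le> s"
  then have "continuous_on {0..} (\<lambda>t. case (s, t) of (s, t) \<Rightarrow> phase s t)"
    by (intro continuous_on_compose2[OF phase_continuous]) (auto intro!: continuous_intros)
  then show ?thesis by simp
qed

lemma phase_periodic: "0 \<le> s \<Longrightarrow> 0 \<le> t \<Longrightarrow> phase s (t + \<delta>) = phase s t"
  by (simp add: phase_def \<omega>_shift_right)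

lemma phase_0: "0 \<le> t \<Longrightarrow> phase 0 t = 0"
  using \<omega>_eqI[of 0 t 1] by (simp add: phase_def V_0)

lemma phase_integrable: "0 \<le> s \<Longrightarrow> 0 \<le> a \<Longrightarrow> phase s integrable_on {a..b}"
  by (rule integrable_continuous_interval[OF continuous_on_subset[OF phase_continuous_right]]) auto

text \<open>The integral of a periodic function over a full period does not depend on the starting
  point.\<close>

lemma phase_integral_shift:
  assumes s: "0 \<le> s" and t: "0 \<le> t"
  shows "integral {0..\<delta>} (\<lambda>r. phase s (t + r)) = integral {0..\<delta>} (phase s)"
proof -
  have sh: "integral {a..b} (\<lambda>r. phase s (c + r)) = integral {a + c..b + c} (phase s)" if "0 \<le> a" "a \<le> b" "0 \<le> c" for a b c
    using integral_shift_Icc_real[of a b "phase s" c] by (simp add: comp_def)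
  have "integral {0..\<delta>} (\<lambda>r. phase s (t + r)) = integral {t..t + \<delta>} (phase s)"
    using sh[of 0 \<delta> t] t \<delta>_pos by (simp add: add.commute)
  moreover have "integral {0..t} (phase s) + integral {t..t + \<delta>} (phase s) = integral {0..t + \<delta>} (phase s)"
    using s t \<delta>_pos by (intro Henstock_Kurzweil_Integration.integral_combine phase_integrable) auto
  moreover have "integral {0..\<delta>} (phase s) + integral {\<delta>..t + \<delta>} (phase s) = integral {0..t + \<delta>} (phase s)"
    using s t \<delta>_pos by (intro Henstock_Kurzweil_Integration.integral_combine phase_integrable) auto
  moreover have "integral {\<delta>..t + \<delta>} (phase s) = integral {0..t} (phase s)"
  proof -
    have "integral {0..t} (\<lambda>r. phase s (\<delta> + r)) = integral {0..t} (phase s)"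
      by (rule integral_cong) (use s phase_periodic in \<open>simp add: add.commute\<close>)
    then show ?thesis using sh[of 0 t \<delta>] t \<delta>_pos by simp
  qed
  ultimately show ?thesis by simp
qed

definition F :: "real \<Rightarrow> real" where "F s = integral {0..\<delta>} (phase s) / \<delta>"

text \<open>Integrate the cocycle identity over \<open>r\<close> in one period: the term
  \<open>phase s t\<close> does not involve \<open>r\<close>, and the translate by \<open>t\<close>
  in the last term disappears by periodicity.\<close>

lemma phase_coboundary:
  assumes s: "0 \<le> s" and t: "0 \<le> t"
  shows "phase s t + F (s + t) = F t + F s"
proof -
  have "integral {0..\<delta>} (\<lambda>r. phase s t + phase (s + t) r) = integral {0..\<delta>} (\<lambda>r. phase t r + phase s (t + r))"
    by (rule integral_cong) (use phase_cocycle s t in auto)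
  moreover have "integral {0..\<delta>} (\<lambda>r. phase s t + phase (s + t) r) = \<delta> * phase s t + integral {0..\<delta>} (phase (s + t))"
    using s t \<delta>_pos phase_integrable[of "s + t" 0 \<delta>]
    by (subst Henstock_Kurzweil_Integration.integral_add) auto
  moreover have "(\<lambda>r. phase s (t + r)) integrable_on {0..\<delta>}"
    by (rule integrable_continuous_interval[OF continuous_on_compose2[OF phase_continuous_right[OF s]]])
      (use t in \<open>auto intro!: continuous_intros\<close>)
  then have "integral {0..\<delta>} (\<lambda>r. phase t r + phase s (t + r)) = integral {0..\<delta>} (phase t) + integral {0..\<delta>} (phase s)"
    using s t phase_integrable[of t 0 \<delta>]
    by (subst Henstock_Kurzweil_Integration.integral_add) (auto simp: phase_integral_shift)
  ultimately have "\<delta> * phase s t + integral {0..\<delta>} (phase (s + t)) = integral {0..\<delta>} (phase t) + integral {0..\<delta>} (phase s)"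
    by simp
  then show ?thesis using \<delta>_pos by (simp add: F_def field_simps)
qed

lemma F_0: "F 0 = 0"
proof -
  have "integral {0..\<delta>} (phase 0) = integral {0..\<delta>} (\<lambda>_. 0)" by (rule integral_cong) (simp add: phase_0)
  then show ?thesis by (simp add: F_def)
qed

lemma F_right: "(F \<longlongrightarrow> 0) (at_right 0)"
proof -
  have "continuous_on ({0..} \<times> {0..\<delta>}) (\<lambda>(s, t). phase s t)"
    by (rule continuous_on_subset[OF phase_continuous]) auto
  then have "continuous_on {0..} (\<lambda>s. integral (cbox 0 \<delta>) (phase s))"
    by (intro integral_continuous_on_param) simp
  then have "continuous_on {0..} F" unfolding F_def using \<delta>_pos by (intro continuous_intros) auto
  then have "(F \<longlongrightarrow> F 0) (at 0 within {0..})" by (auto simp: continuous_on_def)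
  then show ?thesis unfolding F_0 by (rule tendsto_within_subset) auto
qed

definition U :: "real \<Rightarrow> 'h op" where "U t = scale_op (exp (- (\<i> * of_real (F t)))) (V t)"

lemma U_semigroup: "continuous_unitary_semigroup U"
proof
  show "unitary_semigroup U"
    unfolding unitary_semigroup_def
  proof (intro conjI allI impI)
    show "unitary (U t)" if "0 < t" for t
      using that by (auto simp: U_def norm_exp_eq_Re intro!: unitary_scale)
    fix s t :: real assume st: "0 < s" "0 < t"
    have "exp (- (\<i> * of_real (F s))) * exp (- (\<i> * of_real (F t))) * \<omega> s t =
        exp (- (\<i> * of_real (F t + F s)) + \<i> * of_real (phase s t))"
      using st by (simp add: \<omega>_phase exp_add[symmetric] algebra_simps)
    also have "- (\<i> * of_real (F t + F s)) + \<i> * of_real (phase s t) = - (\<i> * complex_of_real (F (s + t)))"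
      using phase_coboundary[of s t] st by (simp add: complex_eq_iff)
    finally show "U (s + t) = U s o\<^sub>L U t"
      using st by (intro blinfun_eqI) (simp add: U_def BH_apply V_mult scaleC_scaleC flip: mult.assoc)
  qed
  fix x
  have "((\<lambda>t. V t x) \<longlongrightarrow> V 0 x) (at 0 within {0..})" using V_continuous by (auto simp: continuous_on_def)
  then have "((\<lambda>t. V t x) \<longlongrightarrow> x) (at_right 0)" unfolding V_0 id_blinfun.rep_eq by (rule tendsto_within_subset) auto
  moreover have "((\<lambda>t. exp (- (\<i> * complex_of_real (F t)))) \<longlongrightarrow> exp (- (\<i> * complex_of_real 0))) (at_right 0)"
    by (intro tendsto_intros F_right)
  ultimately show "((\<lambda>t. U t x) \<longlongrightarrow> x) (at_right 0)"
    using scaleC.tendsto[of "\<lambda>t. exp (- (\<i> * complex_of_real (F t)))" 1 "at_right 0" "\<lambda>t. V t x" x]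
    by (simp add: U_def)
qed

lemma U_implements:
  assumes "0 < t" "A \<in> BH"
  shows "conj_by (U t) A = \<gamma> t A"
proof -
  have "exp (- (\<i> * of_real (F t))) * cnj (exp (- (\<i> * of_real (F t)))) = 1"
    by (simp add: complex_norm_square[symmetric] norm_exp_eq_Re del: exp_cnj)
  then have "conj_by (U t) A = conj_by (V t) A"
    using assms
    by (intro blinfun_eqI)
      (simp add: conj_by_def U_def adj_scale BH_apply scaleC_scaleC mult.commute del: exp_cnj)
  then show ?thesis using impl_V[of t] assms by (simp add: impl_def)
qed

lemma implemented:
  obtains W where "unitary_group W" "\<And>t A. A \<in> BH \<Longrightarrow> \<gamma> t A = conj_by (W t) A"
proof -
  interpret S: continuous_unitary_semigroup U by (rule U_semigroup)
  have "\<gamma> t A = conj_by (S.W t) A" if A: "A \<in> BH" for t A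
  proof -
    consider "0 < t" | "t = 0" | "0 < - t" by linarith
    then show ?thesis
    proof cases
      case 1
      then show ?thesis using A by (simp add: S.W_def U_implements)
    next
      case 2
      then show ?thesis using A by (auto simp: S.W_def gamma_0 conj_by_def)
    next
      case 3
      have "\<gamma> (- t) (\<gamma> t A) = A" using A gamma_plus[of A "- t" t] by (simp add: gamma_0)
      then have "conj_by (U (- t)) (\<gamma> t A) = A" using A 3 by (simp add: U_implements)
      then have "conj_by (adj (U (- t))) (conj_by (U (- t)) (\<gamma> t A)) = conj_by (adj (U (- t))) A" by simp
      then show ?thesis using 3 by (simp add: conj_by_adj S.W_def)
    qed
  qed
  then show ?thesis using that S.W_group by blast
qed

end

subsection \<open>Implementing groups and anti-isomorphisms\<close>

lemma unitary_group_automorphism_group: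
  assumes W: "unitary_group W"
  shows "automorphism_group (\<lambda>t. conj_by (W t))"
  unfolding automorphism_group_def
proof (intro conjI allI ballI)
  have u [simp]: "unitary (W t)" for t using W by (simp add: unitary_group_def)
  have BH: "conj_by (W t) A \<in> BH" if "A \<in> BH" for t A using that by (simp add: conj_by_def)
  have plus: "conj_by (W (s + t)) A = conj_by (W s) (conj_by (W t) A)" for s t A
    using W by (simp add: unitary_group_def conj_by_compose)
  have zero: "conj_by (W 0) A = A" for A using W by (auto simp: unitary_group_def conj_by_def)
  show "conj_by (W 0) A = A" for A by (rule zero)
  show "conj_by (W (s + t)) A = conj_by (W s) (conj_by (W t) A)" for s t A by (rule plus)
  show "star_endo BH (conj_by (W t))" for t
    unfolding star_endo_def clinear_on_def
  proof (intro conjI ballI allI)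
    show "conj_by (W t) ` BH \<subseteq> BH" using BH by auto
    show "conj_by (W t) (A + B) = conj_by (W t) A + conj_by (W t) B" for A B
      by (simp add: conj_by_def compose_add_left compose_add_right)
    show "conj_by (W t) (scale_op c A) = scale_op c (conj_by (W t) A)" if "A \<in> BH" for c A
      by (simp add: conj_by_def scale_op_compose_left scale_op_compose_right)
    show "conj_by (W t) (A o\<^sub>L B) = conj_by (W t) A o\<^sub>L conj_by (W t) B" if "A \<in> BH" for A B
      by (rule blinfun_eqI) (simp add: conj_by_def)
    show "conj_by (W t) (adj A) = adj (conj_by (W t) A)" if "A \<in> BH" for A
      using that by (simp add: conj_by_def adj_compose compose_assoc)
  qed
  show "bij_betw (conj_by (W t)) BH BH" for t
    by (rule bij_betw_byWitness[where f'="conj_by (W (- t))"])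
      (use BH zero plus[of "- t" t] plus[of t "- t"] in auto)
  fix A :: "'a op" and x y assume A: "A \<in> BH"
  have c: "continuous_on UNIV (\<lambda>t. W t z)" for z using W by (simp add: unitary_group_def)
  have c': "continuous_on UNIV (\<lambda>t. W (- t) z)" for z
    by (rule continuous_on_compose2[OF c]) (auto intro!: continuous_intros)
  \<comment> \<open>Moving the outer unitary to the other slot reduces weak continuity to strong
    continuity of the orbits of \<open>x\<close> and \<open>y\<close>.\<close>
  have "cinner (conj_by (W t) A x) y = cinner (A (W (- t) x)) (W (- t) y)" for t
    by (simp add: conj_by_def unitary_group_minus[OF W] cinner_adj)
  then show "continuous_on UNIV (\<lambda>t. cinner (conj_by (W t) A x) y)"
    by (simp add: cinner.continuous_on[OF blinfun.continuous_on[OF continuous_on_const c'] c'])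
qed

locale implementing_group = e0_pair +
  fixes U :: "real \<Rightarrow> 'a op"
  assumes ug: "unitary_group U" and imp: "implements M \<alpha> \<beta> (\<lambda>t. conj_by (U t))"
begin

lemma unitary_U [simp]: "unitary (U t)"
  using ug by (simp add: unitary_group_def)

lemma alpha_U: "0 < t \<Longrightarrow> A \<in> M \<Longrightarrow> \<alpha> t A (U t x) = U t (A x)"
proof -
  assume "0 < t" "A \<in> M"
  then have "conj_by (U t) A = \<alpha> t A" using imp by (simp add: implements_def)
  from blinfun_apply_cong[OF this, of "U t x"] show ?thesis by (simp add: conj_by_def)
qed

lemma beta_U: "0 < t \<Longrightarrow> B \<in> commutant M \<Longrightarrow> \<beta> t B (adj (U t) x) = adj (U t) (B x)"
proof -
  assume "0 < t" "B \<in> commutant M"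
  then have "conj_by (adj (U t)) B = \<beta> t B"
    using imp by (simp add: implements_def unitary_group_minus[OF ug])
  from blinfun_apply_cong[OF this, of "adj (U t) x"] show ?thesis by (simp add: conj_by_def)
qed

lemma adj_U_fibre:
  assumes t: "0 < t" and T: "T \<in> fibre M \<alpha> t"
  shows "adj (U t) o\<^sub>L T \<in> fibre (commutant M) \<beta> t"
proof -
  note TM = fibre_D(1)[OF T]
  have "adj (U t) (T (A x)) = A (adj (U t) (T x))" if A: "A \<in> M" for A x
  proof -
    have "T (A x) = \<alpha> t A (T x)" using fibre_D(3)[OF T A] by simp
    also have "\<dots> = U t (A (adj (U t) (T x)))" using alpha_U[OF t A, of "adj (U t) (T x)"] by simp
    finally show ?thesis by simp
  qed
  then have "(adj (U t) o\<^sub>L T) o\<^sub>L A = A o\<^sub>L (adj (U t) o\<^sub>L T)" if "A \<in> M" for A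
    using that by (intro blinfun_eqI) simp
  then have "adj (U t) o\<^sub>L T \<in> commutant M"
    by (intro commutantI BH_compose adj_BH unitary_BH unitary_U A.in_BH[OF TM])
  moreover have "\<beta> t B o\<^sub>L (adj (U t) o\<^sub>L T) = (adj (U t) o\<^sub>L T) o\<^sub>L B" if B: "B \<in> commutant M" for B
    by (rule blinfun_eqI) (simp add: beta_U[OF t B] commutant_apply[OF B TM])
  ultimately show ?thesis by (simp add: fibre_def)
qed

lemma U_fibre:
  assumes t: "0 < t" and S: "S \<in> fibre (commutant M) \<beta> t"
  shows "U t o\<^sub>L S \<in> fibre M \<alpha> t"
proof -
  note SM = fibre_D(1)[OF S]
  have "U t (S (B x)) = B (U t (S x))" if B: "B \<in> commutant M" for B x
  proof -
    have "S (B x) = \<beta> t B (S x)" using fibre_D(3)[OF S B] by simp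
    also have "\<dots> = adj (U t) (B (U t (S x)))" using beta_U[OF t B, of "U t (S x)"] by simp
    finally show ?thesis by simp
  qed
  then have "(U t o\<^sub>L S) o\<^sub>L B = B o\<^sub>L (U t o\<^sub>L S)" if "B \<in> commutant M" for B
    using that by (intro blinfun_eqI) simp
  then have "U t o\<^sub>L S \<in> commutant (commutant M)"
    by (intro commutantI BH_compose unitary_BH unitary_U commutant_BH[OF SM])
  then have "U t o\<^sub>L S \<in> M" by (simp add: A.bicommutant)
  moreover have "\<alpha> t A o\<^sub>L (U t o\<^sub>L S) = (U t o\<^sub>L S) o\<^sub>L A" if A: "A \<in> M" for A
    by (rule blinfun_eqI) (simp add: alpha_U[OF t A] commutant_apply[OF SM A])
  ultimately show ?thesis by (simp add: fibre_def)
qed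

lemma adj_U_U: "adj (U t) o\<^sub>L (U t o\<^sub>L S) = S" and U_adj_U: "U t o\<^sub>L (adj (U t) o\<^sub>L T) = T"
  by (auto intro!: blinfun_eqI)

lemma fibre_bij:
  assumes t: "0 < t"
  shows "bij_betw (\<lambda>T. adj (U t) o\<^sub>L T) (fibre M \<alpha> t) (fibre (commutant M) \<beta> t)"
  by (rule bij_betw_byWitness[where f'="\<lambda>S. U t o\<^sub>L S"])
    (use adj_U_fibre[OF t] U_fibre[OF t] in \<open>auto simp: adj_U_U U_adj_U\<close>)

lemma fibre_image: "0 < t \<Longrightarrow> (\<lambda>T. adj (U t) o\<^sub>L T) ` fibre M \<alpha> t = fibre (commutant M) \<beta> t"
  using fibre_bij by (auto simp: bij_betw_def)

lemma U_continuous: "continuous_on S (\<lambda>t. U t x)"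
  using ug continuous_on_subset unfolding unitary_group_def by blast

lemma adj_U_continuous: "continuous_on S (\<lambda>t. adj (U t) x)"
  unfolding unitary_group_minus[OF ug, symmetric]
  by (rule continuous_on_compose2[OF U_continuous[of UNIV]]) (auto intro!: continuous_intros)

lemma anti_isomorphism_of_form:
  assumes form: "has_form M \<alpha> \<theta> U"
  shows "anti_isomorphism M \<alpha> (commutant M) \<beta> \<theta>"
  unfolding anti_isomorphism_def
proof (intro conjI allI impI ballI)
  \<comment> \<open>The explicit inverse of \<theta>; its measurability stands in for that of
    \<open>the_inv_into\<close>, with which it agrees on the product system of \<beta>.\<close>
  define \<eta> :: "real \<times> 'a op \<Rightarrow> real \<times> 'a op" where "\<eta> = (\<lambda>p. (fst p, U (fst p) o\<^sub>L snd p))"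
  have \<theta>: "\<theta> p = (fst p, adj (U (fst p)) o\<^sub>L snd p)" if "p \<in> product_system M \<alpha>" for p
    using form that by (auto simp: has_form_def product_system_def)
  have \<theta>_in: "\<theta> p \<in> product_system (commutant M) \<beta>" if "p \<in> product_system M \<alpha>" for p
    using that adj_U_fibre by (auto simp: \<theta> product_system_def)
  have \<eta>_in: "\<eta> p \<in> product_system M \<alpha>" if "p \<in> product_system (commutant M) \<beta>" for p
    using that U_fibre by (auto simp: \<eta>_def product_system_def)
  have \<eta>\<theta>: "\<eta> (\<theta> p) = p" if "p \<in> product_system M \<alpha>" for p
    using \<theta>[OF that] by (simp add: \<eta>_def U_adj_U)
  have \<theta>\<eta>: "\<theta> (\<eta> p) = p" if "p \<in> product_system (commutant M) \<beta>" for p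
    using \<theta>[OF \<eta>_in[OF that]] by (simp add: \<eta>_def adj_U_U)
  note sp = space_ps_borel[OF A.subset_BH, of \<alpha>] space_ps_borel[OF B.subset_BH, of \<beta>]
  have bij: "bij_betw \<theta> (product_system M \<alpha>) (product_system (commutant M) \<beta>)"
    by (rule bij_betw_byWitness[where f'=\<eta>]) (auto simp: \<eta>\<theta> \<theta>\<eta> \<theta>_in \<eta>_in)
  have m\<theta>: "\<theta> \<in> measurable (ps_borel M \<alpha>) (ps_borel (commutant M) \<beta>)"
  proof (rule measurable_ps_borelI[OF A.sep B.subset_BH])
    show "(\<lambda>p. fst (\<theta> p)) \<in> borel_measurable (ps_borel M \<alpha>)"
      using ps_borel_fst by (rule measurable_cong[THEN iffD1, rotated]) (simp add: sp \<theta>)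
    fix x y
    \<comment> \<open>With the unitary moved to the second slot, the coefficient is measurable in
      the point of the product system and continuous in the vector, and that vector is a continuous
      function of the time coordinate.\<close>
    have "(\<lambda>p. cinner (blinfun_apply (snd p) x) (U (fst p) y)) \<in> borel_measurable (ps_borel M \<alpha>)"
    proof (rule caratheodory_measurable[OF ps_borel_fst])
      show "0 < fst p" if "p \<in> space (ps_borel M \<alpha>)" for p using that by (auto simp: sp product_system_def)
      show "continuous_on {0<..} (\<lambda>t. U t y)" by (rule U_continuous)
      show "(\<lambda>p. cinner (blinfun_apply (snd p) x) w) \<in> borel_measurable (ps_borel M \<alpha>)" for w
        by (rule ps_borel_coefficient)
    qed (intro cinner.continuous_on continuous_intros)
    then show "(\<lambda>p. cinner (blinfun_apply (snd (\<theta> p)) x) y) \<in> borel_measurable (ps_borel M \<alpha>)"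
      by (rule measurable_cong[THEN iffD1, rotated]) (simp add: sp \<theta> cinner_adj_left)
  qed (simp add: sp \<theta>_in)
  have m\<eta>: "\<eta> \<in> measurable (ps_borel (commutant M) \<beta>) (ps_borel M \<alpha>)"
  proof (rule measurable_ps_borelI[OF A.sep A.subset_BH])
    show "(\<lambda>p. fst (\<eta> p)) \<in> borel_measurable (ps_borel (commutant M) \<beta>)"
      using ps_borel_fst by (simp add: \<eta>_def)
    fix x y
    have "(\<lambda>p. cinner (blinfun_apply (snd p) x) (adj (U (fst p)) y)) \<in> borel_measurable (ps_borel (commutant M) \<beta>)"
    proof (rule caratheodory_measurable[OF ps_borel_fst])
      show "0 < fst p" if "p \<in> space (ps_borel (commutant M) \<beta>)" for p
        using that by (auto simp: sp product_system_def)
      show "continuous_on {0<..} (\<lambda>t. adj (U t) y)" by (rule adj_U_continuous)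
      show "(\<lambda>p. cinner (blinfun_apply (snd p) x) w) \<in> borel_measurable (ps_borel (commutant M) \<beta>)" for w
        by (rule ps_borel_coefficient)
    qed (intro cinner.continuous_on continuous_intros)
    then show "(\<lambda>p. cinner (blinfun_apply (snd (\<eta> p)) x) y) \<in> borel_measurable (ps_borel (commutant M) \<beta>)"
      by (simp add: \<eta>_def cinner_adj)
  qed (simp add: sp \<eta>_in)
  have "the_inv_into (product_system M \<alpha>) \<theta> p = \<eta> p" if "p \<in> product_system (commutant M) \<beta>" for p
    by (rule the_inv_into_f_eq) (use bij that \<theta>\<eta> \<eta>_in in \<open>auto simp: bij_betw_def\<close>)
  then have "the_inv_into (product_system M \<alpha>) \<theta> \<in> measurable (ps_borel (commutant M) \<beta>) (ps_borel M \<alpha>)"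
    by (intro measurable_cong[THEN iffD2, OF _ m\<eta>]) (simp add: sp)
  then show "borel_isomorphism (ps_borel M \<alpha>) (ps_borel (commutant M) \<beta>) \<theta>"
    using bij m\<theta> by (simp add: borel_isomorphism_def sp)
next
  fix t :: real assume t: "0 < t"
  have "fibre_unitary (fibre M \<alpha> t) (fibre (commutant M) \<beta> t) (\<lambda>T. adj (U t) o\<^sub>L T)"
    unfolding fibre_unitary_def
  proof (intro conjI ballI)
    show "bij_betw (\<lambda>T. adj (U t) o\<^sub>L T) (fibre M \<alpha> t) (fibre (commutant M) \<beta> t)" by (rule fibre_bij[OF t])
    show "clinear_on (fibre M \<alpha> t) (\<lambda>T. adj (U t) o\<^sub>L T)"
      by (simp add: clinear_on_def compose_add_right scale_op_compose_right)
    fix S T assume "S \<in> fibre M \<alpha> t" "T \<in> fibre M \<alpha> t"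
    then have "T \<in> BH" by (auto dest: fibre_D(1))
    then have "adj (adj (U t) o\<^sub>L T) o\<^sub>L (adj (U t) o\<^sub>L S) = adj T o\<^sub>L S"
      by (intro blinfun_eqI) (simp add: adj_compose)
    then show "fibre_inner (adj (U t) o\<^sub>L S) (adj (U t) o\<^sub>L T) = fibre_inner S T"
      by (simp add: fibre_inner_def)
  qed
  then show "\<exists>g. fibre_unitary (fibre M \<alpha> t) (fibre (commutant M) \<beta> t) g \<and>
      (\<forall>T\<in>fibre M \<alpha> t. \<theta> (t, T) = (t, g T))"
    using form t by (auto simp: has_form_def)
next
  fix p q assume pq: "p \<in> product_system M \<alpha>" "q \<in> product_system M \<alpha>"
  then obtain s S t T where p: "p = (s, S)" "0 < s" "S \<in> fibre M \<alpha> s" and q: "q = (t, T)" "0 < t" "T \<in> fibre M \<alpha> t"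
    by (auto simp: product_system_def)
  have "U (s + t) = U s o\<^sub>L U t" using ug by (simp add: unitary_group_def)
  then have adj: "adj (U (s + t)) = adj (U t) o\<^sub>L adj (U s)" by (simp add: adj_compose)
  \<comment> \<open>\<open>adj (U s) o\<^sub>L S\<close> lies in a fibre of \<beta>, hence in the
    commutant, and so passes \<open>T\<close>; this exchange is the source of the reversed
    order.\<close>
  have "adj (U s) (S (T x)) = T (adj (U s) (S x))" for x
    using commutant_apply[OF fibre_D(1)[OF adj_U_fibre[OF p(2,3)]] fibre_D(1)[OF q(3)], of x] by simp
  then have "adj (U (s + t)) o\<^sub>L (S o\<^sub>L T) = (adj (U t) o\<^sub>L T) o\<^sub>L (adj (U s) o\<^sub>L S)"
    by (intro blinfun_eqI) (simp add: adj)
  moreover have "S o\<^sub>L T \<in> fibre M \<alpha> (s + t)" using p q by (simp add: A.fibre_compose)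
  ultimately show "\<theta> (ps_mult p q) = ps_mult (\<theta> q) (\<theta> p)"
    using form p q by (simp add: has_form_def ps_mult_def add.commute)
qed

end

context e0_anti_isomorphism begin

lemma implements_of_extension:
  assumes W: "unitary_group W" "\<forall>t>0. W t = U t"
  shows "implements M \<alpha> \<beta> (\<lambda>t. conj_by (W t))"
  unfolding implements_def
proof (intro allI impI conjI ballI)
  fix t :: real assume t: "0 \<le> t"
  have W0: "W 0 = id_blinfun" using W(1) by (simp add: unitary_group_def)
  show "conj_by (W t) A = \<alpha> t A" if "A \<in> M" for A
  proof (cases "t = 0")
    case True
    then show ?thesis using that by (auto simp: W0 conj_by_def)
  qed (use t that W(2) U_implements(1) in auto)
  show "conj_by (W (- t)) B = \<beta> t B" if "B \<in> commutant M" for B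
  proof (cases "t = 0")
    case True
    then show ?thesis using that by (auto simp: W0 conj_by_def)
  qed (use t that W(2) U_implements(2) unitary_group_minus[OF W(1), of t] in auto)
qed

lemma U_continuous_semigroup: "continuous_unitary_semigroup U"
proof -
  have sg: "unitary_semigroup U" by (auto simp: unitary_semigroup_def U_semigroup)
  then interpret measurable_unitary_semigroup U
    by unfold_locales (auto intro: A.sep U_measurable)
  show ?thesis by unfold_locales (auto intro: sg right_continuous)
qed

end

theorem theorem3p6p1:
  fixes M :: "'h::complex_hilbert op set"
    and \<alpha> \<beta> :: "real \<Rightarrow> 'h op \<Rightarrow> 'h op"
  assumes "separable_space (euclidean :: 'h topology)"
    and "type_I_factor M"
    and "E0_semigroup M \<alpha>"
    and "E0_semigroup (commutant M) \<beta>"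
  shows
    "((\<exists>\<gamma>. automorphism_group \<gamma> \<and> implements M \<alpha> \<beta> \<gamma>) \<longleftrightarrow>
      (\<exists>\<theta>. anti_isomorphism M \<alpha> (commutant M) \<beta> \<theta>)) \<and>
     (\<forall>U. unitary_group U \<and> implements M \<alpha> \<beta> (\<lambda>t. conj_by (U t)) \<longrightarrow>
        (\<forall>t>0. (\<lambda>T. adj (U t) o\<^sub>L T) ` fibre M \<alpha> t = fibre (commutant M) \<beta> t) \<and>
        (\<forall>\<theta>. has_form M \<alpha> \<theta> U \<longrightarrow> anti_isomorphism M \<alpha> (commutant M) \<beta> \<theta>)) \<and>
     (\<forall>\<theta>. anti_isomorphism M \<alpha> (commutant M) \<beta> \<theta> \<longrightarrow>
        (\<exists>U. (\<forall>t>0. unitary (U t)) \<and> has_form M \<alpha> \<theta> U \<and>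
           (\<forall>V. (\<forall>t>0. unitary (V t)) \<and> has_form M \<alpha> \<theta> V \<longrightarrow> (\<forall>t>0. V t = U t)) \<and>
           (\<forall>s>0. \<forall>t>0. U (s + t) = U s o\<^sub>L U t) \<and>
           (\<forall>x. continuous_on {0<..} (\<lambda>t. U t x)) \<and>
           (\<forall>x. ((\<lambda>t. U t x) \<longlongrightarrow> x) (at_right 0)) \<and>
           (\<exists>!W. unitary_group W \<and> (\<forall>t>0. W t = U t)) \<and>
           (\<forall>W. unitary_group W \<and> (\<forall>t>0. W t = U t) \<longrightarrow>
              automorphism_group (\<lambda>t. conj_by (W t)) \<and>
              implements M \<alpha> \<beta> (\<lambda>t. conj_by (W t)))))"
    (is "_ \<and> (\<forall>U. ?A U \<longrightarrow> ?B U) \<and> (\<forall>\<theta>. ?I \<theta> \<longrightarrow> ?C \<theta>)")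
proof -
  have fac: "factor M" using assms(2) by (simp add: type_I_factor_def)
  obtain e where "minimal_projection M e" using assms(2) by (auto simp: type_I_factor_def)
  then have e: "atom M e" by (rule minimal_projection_atom[OF factor_vn[OF fac]])
  obtain f where f: "atom (commutant M) f" by (rule atom_commutant[OF fac e]) auto
  have pair: "e0_pair M e f \<alpha> \<beta>"
    using assms fac e f factor_vn[OF fac] factor_vn[OF factor_commutant[OF fac]] factor_commutant[OF fac]
    by (simp add: e0_pair_def atomic_E0_def atomic_E0_axioms_def)
  interpret P: e0_pair M e f \<alpha> \<beta> by (rule pair)
  have imp: "\<forall>U. ?A U \<longrightarrow> ?B U"
  proof (intro allI impI, elim conjE)
    fix U assume U: "unitary_group U" "implements M \<alpha> \<beta> (\<lambda>t. conj_by (U t))"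
    interpret implementing_group M e f \<alpha> \<beta> U by unfold_locales (rule U)+
    show "?B U"
      using fibre_image anti_isomorphism_of_form by blast
  qed
  have conv: "\<forall>\<theta>. ?I \<theta> \<longrightarrow> ?C \<theta>"
  proof (intro allI impI)
    fix \<theta> assume \<theta>: "anti_isomorphism M \<alpha> (commutant M) \<beta> \<theta>"
    interpret I: e0_anti_isomorphism M e f \<alpha> \<beta> \<theta> by unfold_locales (rule \<theta>)
    interpret S: continuous_unitary_semigroup I.U by (rule I.U_continuous_semigroup)
    have ext: "\<exists>!W. unitary_group W \<and> (\<forall>t>0. W t = I.U t)"
    proof (rule ex1I[of _ S.W])
      show "unitary_group S.W \<and> (\<forall>t>0. S.W t = I.U t)" by (simp add: S.W_group S.W_def)
      fix W assume "unitary_group W \<and> (\<forall>t>0. W t = I.U t)"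
      then show "W = S.W" by (intro unitary_group_unique S.W_group) (auto simp: S.W_def)
    qed
    show "?C \<theta>"
    proof (rule exI[of _ I.U], intro conjI)
      show "\<forall>V. (\<forall>t>0. unitary (V t)) \<and> has_form M \<alpha> \<theta> V \<longrightarrow> (\<forall>t>0. V t = I.U t)"
        using I.U_unique by blast
      show "\<forall>W. unitary_group W \<and> (\<forall>t>0. W t = I.U t) \<longrightarrow>
          automorphism_group (\<lambda>t. conj_by (W t)) \<and> implements M \<alpha> \<beta> (\<lambda>t. conj_by (W t))"
        using unitary_group_automorphism_group I.implements_of_extension by blast
    qed (simp_all add: ext I.U_has_form I.U_semigroup S.U_continuous S.right_cont)
  qed
  have "\<exists>\<theta>. anti_isomorphism M \<alpha> (commutant M) \<beta> \<theta>"
    if \<gamma>: "automorphism_group \<gamma>" "implements M \<alpha> \<beta> \<gamma>" for \<gamma>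
  proof -
    \<comment> \<open>The atom guarantees that the space is nonzero and so provides the unit vector
      on which the construction of implementers is based.\<close>
    obtain x where x: "e x \<noteq> 0" by (rule atom_nonzero[OF e]) auto
    define \<xi> where "\<xi> = (1 / norm (e x)) *\<^sub>R e x"
    have "norm \<xi> = 1" using x by (simp add: \<xi>_def)
    with \<gamma>(1) interpret G: aut_group \<gamma> \<xi> by unfold_locales
    obtain W where W: "unitary_group W" "\<And>t A. A \<in> BH \<Longrightarrow> \<gamma> t A = conj_by (W t) A"
      by (rule G.implemented) auto
    have "implements M \<alpha> \<beta> (\<lambda>t. conj_by (W t))"
      using \<gamma>(2) W(2) P.A.subset_BH P.B.subset_BH by (auto simp: implements_def subset_iff)
    \<comment> \<open>The required form constrains the map only on the product system, so one global
      formula is a valid choice of \<theta>.\<close>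
    moreover have "has_form M \<alpha> (\<lambda>p. (fst p, adj (W (fst p)) o\<^sub>L snd p)) W" by (simp add: has_form_def)
    ultimately show ?thesis using imp W(1) by blast
  qed
  moreover have "\<exists>\<gamma>. automorphism_group \<gamma> \<and> implements M \<alpha> \<beta> \<gamma>"
    if "anti_isomorphism M \<alpha> (commutant M) \<beta> \<theta>" for \<theta>
    using conv[rule_format, OF that] by (elim exE conjE ex1E) blast
  ultimately show ?thesis using imp conv by blast
qed

end
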